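(* Let $G$ be a finite group with $N(G)=h$, let $n$ be a positive integer, and let $\alpha=(\alpha_1,\ldots,\alpha_{|\alpha|})\vdash n$ be a partition of $n$. Then $$N(G\wr S_\alpha)=\prod_{j=1}^{|\alpha|}\ \sum_{\beta\models_h\alpha_j}\ \prod_{i=1}^{h}\mathcal{P}(\beta_i).$$ Moreover, let $\mathbf{r}=(r_1,r_2,\ldots)$ be a sequence of positive integers, let $k\ge1$, and put $h:=N(\mathbf{r}|_{k-1})$. Then the following recursion holds: $$N(\mathbf{r}|_k)=P\left(r_k,N(\mathbf{r}|_{k-1})\right)=\sum_{\alpha\models_h r_k}\ \prod_{i=1}^{h}\mathcal{P}(\alpha_i).$$
   Context: For a finite group $G$, $N(G)$ is the number of equivalence classes of irreducible complex representations of $G$. $\mathcal{P}(n)$ is the number of partitions of the integer $n$, with $\mathcal{P}(0):=1$. $\beta\models_h m$ means that $\beta=(\beta_1,\ldots,\beta_h)$ is a weak composition of $m$ with $h$ parts: each $\beta_i\ge0$ is an integer and $\sum_i\beta_i=m$. Define $P(n,h):=\sum_{\alpha\models_h n}\prod_{i=1}^h\mathcal{P}(\alpha_i)$. For a partition $\alpha\vdash n$, $|\alpha|$ denotes its number of parts (its length), and $S_\alpha=S_{\alpha_1}\times\cdots\times S_{\alpha_{|\alpha|}}\le S_n$ is the corresponding Young subgroup. For $H\le S_n$, $G\wr H$ is the set $G^n\times H$ with multiplication $(a;\pi)(b;\tau)=(ab^\pi;\pi\tau)$, where $b^\pi=(b_{\pi^{-1}(1)},\ldots,b_{\pi^{-1}(n)})$.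 The iterated wreath products are $W(\mathbf{r}|_0)=\{1\}$ and $W(\mathbf{r}|_k)=W(\mathbf{r}|_{k-1})\wr S_{r_k}$, and $N(\mathbf{r}|_k):=N(W(\mathbf{r}|_k))$. *)

theory Defs
  imports
    "HOL-Algebra.Sym_Groups"
    "HOL-Algebra.Weak_Morphisms"
    "HOL-Algebra.Elementary_Groups"
    "Jordan_Normal_Form.VS_Connect"
begin

definition general_linear :: "nat \<Rightarrow> complex mat monoid" where
  "general_linear d = units_of (ring_mat TYPE(complex) d ())"

text \<open>
  A representation is a pair of its degree and a matrix representation of that degree; only the
  values on the carrier of the group matter.
\<close>

type_synonym 'a rep = "nat \<times> ('a \<Rightarrow> complex mat)"

definition is_rep :: "('a, 'b) monoid_scheme \<Rightarrow> 'a rep \<Rightarrow> bool" where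
  "is_rep G = (\<lambda>(d, \<rho>). \<rho> \<in> hom G (general_linear d))"

definition invariant_subspace :: "('a, 'b) monoid_scheme \<Rightarrow> 'a rep \<Rightarrow> complex vec set \<Rightarrow> bool" where
  "invariant_subspace G = (\<lambda>(d, \<rho>) U.
     VectorSpace.subspace class_ring U (module_vec TYPE(complex) d) \<and>
     (\<forall>g\<in>carrier G. \<forall>u\<in>U. \<rho> g *\<^sub>v u \<in> U))"

definition irreducible_rep :: "('a, 'b) monoid_scheme \<Rightarrow> 'a rep \<Rightarrow> bool" where
  "irreducible_rep G = (\<lambda>(d, \<rho>). is_rep G (d, \<rho>) \<and> 0 < d \<and>
     (\<forall>U. invariant_subspace G (d, \<rho>) U \<longrightarrow> U = {0\<^sub>v d} \<or> U = carrier_vec d))"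

definition equivalent_reps :: "('a, 'b) monoid_scheme \<Rightarrow> 'a rep \<Rightarrow> 'a rep \<Rightarrow> bool" where
  "equivalent_reps G = (\<lambda>(d, \<rho>) (e, \<sigma>). d = e \<and>
     (\<exists>T\<in>carrier (general_linear d). \<forall>g\<in>carrier G. T * \<rho> g = \<sigma> g * T))"

definition num_irreps :: "('a, 'b) monoid_scheme \<Rightarrow> nat" where
  "num_irreps G =
     card ({R. irreducible_rep G R} //
           {(R, S). irreducible_rep G R \<and> irreducible_rep G S \<and> equivalent_reps G R S})"

definition is_partition :: "nat list \<Rightarrow> nat \<Rightarrow> bool" where
  "is_partition \<alpha> n \<longleftrightarrow> sorted_wrt (\<ge>) \<alpha> \<and> (\<forall>x\<in>set \<alpha>. 0 < x) \<and> sum_list \<alpha> = n"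

definition num_partitions :: "nat \<Rightarrow> nat" where
  "num_partitions n = card {\<alpha>. is_partition \<alpha> n}"

definition weak_compositions :: "nat \<Rightarrow> nat \<Rightarrow> nat list set" where
  "weak_compositions h m = {\<beta>. length \<beta> = h \<and> sum_list \<beta> = m}"

definition multi_partitions :: "nat \<Rightarrow> nat \<Rightarrow> nat" where
  "multi_partitions n h = (\<Sum>\<alpha>\<in>weak_compositions h n. \<Prod>i<h. num_partitions (\<alpha> ! i))"

lemma num_partitions_0: "num_partitions 0 = 1"
proof -
  have "{\<alpha>. is_partition \<alpha> 0} = {[]}"
    by (auto simp: is_partition_def)
       (metis less_numeral_extra(3) list.set_intros(1) neq_Nil_conv)
  then show ?thesis
    by (simp add: num_partitions_def)
qed

lemma finite_partitions: "finite {\<alpha>. is_partition \<alpha> n}"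
proof (rule finite_subset)
  have "length \<alpha> \<le> sum_list \<alpha>" if "\<forall>x\<in>set \<alpha>. 0 < x" for \<alpha> :: "nat list"
    using that by (induction \<alpha>) (auto simp: Suc_le_eq)
  then show "{\<alpha>. is_partition \<alpha> n} \<subseteq> {\<alpha>. set \<alpha> \<subseteq> {..n} \<and> length \<alpha> \<le> n}"
    using member_le_sum_list by (fastforce simp: is_partition_def)
  show "finite {\<alpha>. set \<alpha> \<subseteq> {..n} \<and> length \<alpha> \<le> n}"
    by (rule finite_lists_length_le) simp
qed

lemma finite_weak_compositions: "finite (weak_compositions h m)"
proof (rule finite_subset)
  show "weak_compositions h m \<subseteq> {\<beta>. set \<beta> \<subseteq> {..m} \<and> length \<beta> = h}"
    using member_le_sum_list by (fastforce simp: weak_compositions_def)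
  show "finite {\<beta>. set \<beta> \<subseteq> {..m} \<and> length \<beta> = h}"
    by (rule finite_lists_length_eq) simp
qed

definition block :: "nat list \<Rightarrow> nat \<Rightarrow> nat set" where
  "block \<alpha> j = {sum_list (take j \<alpha>) <.. sum_list (take (Suc j) \<alpha>)}"

text \<open>
  The factor with index j is embedded as the symmetric group on the j-th block of consecutive
  points, so that their internal direct product consists of the permutations that preserve
  every block.
\<close>

definition young_subgroup :: "nat list \<Rightarrow> (nat \<Rightarrow> nat) set" where
  "young_subgroup \<alpha> =
     {p. p permutes {1..sum_list \<alpha>} \<and> (\<forall>j<length \<alpha>. p ` block \<alpha> j = block \<alpha> j)}"

lemma inv_sym_group:
  assumes "p \<in> carrier (sym_group n)"
  shows "inv\<^bsub>sym_group n\<^esub> p = inv_into UNIV p"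
proof -
  have p: "p permutes {1..n}"
    using assms by (simp add: sym_group_def)
  show ?thesis
  proof (rule group.inv_equality[OF sym_group_is_group])
    show "inv_into UNIV p \<otimes>\<^bsub>sym_group n\<^esub> p = \<one>\<^bsub>sym_group n\<^esub>"
      using permutes_inv_o(2)[OF p] by (simp add: sym_group_def)
    show "inv_into UNIV p \<in> carrier (sym_group n)"
      using permutes_inv[OF p] by (simp add: sym_group_def)
  qed (use assms in simp)
qed

lemma young_subgroup_subgroup: "subgroup (young_subgroup \<alpha>) (sym_group (sum_list \<alpha>))"
proof (rule group.subgroupI[OF sym_group_is_group])
  show "young_subgroup \<alpha> \<subseteq> carrier (sym_group (sum_list \<alpha>))"
    by (auto simp: young_subgroup_def sym_group_def)
  have "id \<in> young_subgroup \<alpha>"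
    by (auto simp: young_subgroup_def intro: permutes_id)
  then show "young_subgroup \<alpha> \<noteq> {}"
    by blast
next
  fix p assume p: "p \<in> young_subgroup \<alpha>"
  then have perm: "p permutes {1..sum_list \<alpha>}"
    by (simp add: young_subgroup_def)
  have "inv_into UNIV p ` block \<alpha> j = block \<alpha> j" if "j < length \<alpha>" for j
  proof -
    have "p ` block \<alpha> j = block \<alpha> j"
      using p that by (simp add: young_subgroup_def)
    then show ?thesis
      using permutes_inj[OF perm] by (metis image_inv_f_f)
  qed
  then have "inv_into UNIV p \<in> young_subgroup \<alpha>"
    using permutes_inv[OF perm] by (simp add: young_subgroup_def)
  then show "inv\<^bsub>sym_group (sum_list \<alpha>)\<^esub> p \<in> young_subgroup \<alpha>"
    using perm by (subst inv_sym_group) (simp_all add: sym_group_def)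
next
  fix p q assume "p \<in> young_subgroup \<alpha>" "q \<in> young_subgroup \<alpha>"
  then show "p \<otimes>\<^bsub>sym_group (sum_list \<alpha>)\<^esub> q \<in> young_subgroup \<alpha>"
    by (simp add: young_subgroup_def sym_group_def permutes_compose image_comp[symmetric]
        del: o_apply)
qed

definition wreath ::
  "('a, 'b) monoid_scheme \<Rightarrow> nat \<Rightarrow> (nat \<Rightarrow> nat) set \<Rightarrow> ((nat \<Rightarrow> 'a) \<times> (nat \<Rightarrow> nat)) monoid" where
  "wreath G n H =
     \<lparr> carrier = ({1..n} \<rightarrow>\<^sub>E carrier G) \<times> H,
       monoid.mult = (\<lambda>(a, \<pi>) (b, \<tau>).
         (\<lambda>i\<in>{1..n}. a i \<otimes>\<^bsub>G\<^esub> b (inv_into UNIV \<pi> i), \<pi> \<circ> \<tau>)),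
       one = (\<lambda>i\<in>{1..n}. \<one>\<^bsub>G\<^esub>, id) \<rparr>"

lemma wreath_is_group:
  assumes "group G" and H: "subgroup H (sym_group n)"
  shows "group (wreath G n H)"
proof -
  interpret group G by fact
  have perm: "p permutes {1..n}" if "p \<in> H" for p
    using subgroup.subset[OF H] that by (auto simp: sym_group_def)
  have inv_in: "inv_into UNIV p i \<in> {1..n} \<longleftrightarrow> i \<in> {1..n}" if "p \<in> H" for p i
    using permutes_in_image[OF permutes_inv[OF perm[OF that]]] .
  have inv_H: "inv_into UNIV p \<in> H" if "p \<in> H" for p
    using subgroup.m_inv_closed[OF H that] inv_sym_group[of p n] perm[OF that]
    by (simp add: sym_group_def)
  have comp_H: "p \<circ> q \<in> H" if "p \<in> H" "q \<in> H" for p q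
    using subgroup.m_closed[OF H that] by (simp add: sym_group_def)
  have id_H: "id \<in> H"
    using subgroup.one_closed[OF H] by (simp add: sym_group_def)
  have inv_comp: "inv_into UNIV (p \<circ> q) i = inv_into UNIV q (inv_into UNIV p i)"
    if "p \<in> H" "q \<in> H" for p q i
    using o_inv_distrib[OF permutes_bij[OF perm[OF that(1)]] permutes_bij[OF perm[OF that(2)]]]
    by simp
  show ?thesis
  proof (rule groupI)
    fix x y assume "x \<in> carrier (wreath G n H)" "y \<in> carrier (wreath G n H)"
    then show "x \<otimes>\<^bsub>wreath G n H\<^esub> y \<in> carrier (wreath G n H)"
      using inv_in comp_H by (auto simp: wreath_def PiE_iff simp del: atLeastAtMost_iff)
  next
    show "\<one>\<^bsub>wreath G n H\<^esub> \<in> carrier (wreath G n H)"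
      using id_H by (auto simp: wreath_def)
  next
    fix x y z
    assume "x \<in> carrier (wreath G n H)" "y \<in> carrier (wreath G n H)" "z \<in> carrier (wreath G n H)"
    then show "x \<otimes>\<^bsub>wreath G n H\<^esub> y \<otimes>\<^bsub>wreath G n H\<^esub> z =
        x \<otimes>\<^bsub>wreath G n H\<^esub> (y \<otimes>\<^bsub>wreath G n H\<^esub> z)"
      using inv_in
      by (auto simp: wreath_def PiE_iff inv_comp m_assoc o_assoc simp del: atLeastAtMost_iff
          intro!: restrict_ext)
  next
    fix x assume "x \<in> carrier (wreath G n H)"
    then show "\<one>\<^bsub>wreath G n H\<^esub> \<otimes>\<^bsub>wreath G n H\<^esub> x = x"
      by (auto simp: wreath_def PiE_iff fun_eq_iff extensional_def)
  next
    fix x assume x: "x \<in> carrier (wreath G n H)"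
    obtain b \<tau> where [simp]: "x = (b, \<tau>)"
      by (cases x)
    have b: "b \<in> {1..n} \<rightarrow>\<^sub>E carrier G" and \<tau>: "\<tau> \<in> H"
      using x by (auto simp: wreath_def)
    let ?y = "(\<lambda>i\<in>{1..n}. inv\<^bsub>G\<^esub> b (\<tau> i), inv_into UNIV \<tau>)"
    have \<tau>_in: "\<tau> i \<in> {1..n} \<longleftrightarrow> i \<in> {1..n}" for i
      using permutes_in_image[OF perm[OF \<tau>]] .
    have "?y \<in> carrier (wreath G n H)"
      using b \<tau>_in inv_H[OF \<tau>] by (auto simp: wreath_def PiE_iff simp del: atLeastAtMost_iff)
    moreover have "?y \<otimes>\<^bsub>wreath G n H\<^esub> x = \<one>\<^bsub>wreath G n H\<^esub>"
      using b \<tau>_in permutes_inv_o(2)[OF perm[OF \<tau>]] permutes_bij[OF perm[OF \<tau>]]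
      by (auto simp: wreath_def PiE_iff inv_inv_eq simp del: atLeastAtMost_iff
          intro!: restrict_ext)
    ultimately show "\<exists>y\<in>carrier (wreath G n H). y \<otimes>\<^bsub>wreath G n H\<^esub> x = \<one>\<^bsub>wreath G n H\<^esub>"
      by blast
  qed
qed

text \<open>
  The type of the elements of a k-fold iterated wreath product would grow with k. The following
  type contains a copy of each of these groups, obtained by wrapping elements in a constructor.
\<close>

datatype wreath_elem = Triv | Node "(nat \<Rightarrow> wreath_elem) \<times> (nat \<Rightarrow> nat)"

fun iter_wreath :: "(nat \<Rightarrow> nat) \<Rightarrow> nat \<Rightarrow> wreath_elem monoid" where
  "iter_wreath r 0 = singleton_group Triv"
| "iter_wreath r (Suc k) =
     image_group Node
       (wreath (iter_wreath r k) (r (Suc k)) (carrier (sym_group (r (Suc k)))))"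

lemma iter_wreath_is_group: "group (iter_wreath r k)"
  and iter_wreath_Suc_iso:
    "Node \<in> iso (wreath (iter_wreath r k) (r (Suc k)) (carrier (sym_group (r (Suc k)))))
                (iter_wreath r (Suc k))"
proof -
  have wr: "group (wreath (iter_wreath r k) m (carrier (sym_group m)))"
    if "group (iter_wreath r k)" for k m
    by (intro wreath_is_group that group.subgroup_self sym_group_is_group)
  have iso: "Node \<in> iso (wreath (iter_wreath r k) (r (Suc k)) (carrier (sym_group (r (Suc k)))))
                (iter_wreath r (Suc k))" for k
    unfolding iter_wreath.simps by (rule inj_imp_image_group_iso) (simp add: inj_on_def)
  show grp: "group (iter_wreath r k)" for k
  proof (induction k)
    case 0
    show ?case by simp
  next
    case (Suc k)
    show ?case
      unfolding iter_wreath.simps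
      by (rule group.inj_imp_image_group_is_group[OF wr[OF Suc.IH]]) (simp add: inj_on_def)
  qed
  show "Node \<in> iso (wreath (iter_wreath r k) (r (Suc k)) (carrier (sym_group (r (Suc k)))))
                (iter_wreath r (Suc k))"
    by (rule iso)
qed

abbreviation num_irreps_iter :: "(nat \<Rightarrow> nat) \<Rightarrow> nat \<Rightarrow> nat" where
  "num_irreps_iter r k \<equiv> num_irreps (iter_wreath r k)"

end

theory Submission
  imports Defs "HOL-Library.Function_Algebras" "Jordan_Normal_Form.Spectral_Radius"
    "HOL-Combinatorics.Orbits" "HOL-Library.Multiset"
begin

text \<open>
  Over the complex numbers the irreducible representations of a finite group are counted by its
  conjugacy classes: irreducible characters are linearly independent class functions, and a nonzero
  class function orthogonal to all of them would act by convolution as a nonzero normal operator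
  that commutes with translations but kills every irreducible subspace of its own range.
  A conjugacy class of a wreath product with a Young subgroup is determined by the cycles of the
  permutation part, each labelled with its block, its length and the conjugacy class of the product
  of the entries along the cycle. So it is the same as a choice of one partition for every block and
  every conjugacy class of the base group, such that the sizes in a block add up to its length.
\<close>

section \<open>Linear algebra and Schur's lemma\<close>

text \<open>Both inequalities between the two counts rest on one fact, that a homogeneous system
  with more unknowns than equations has a nonzero solution: a surplus of representations would give
  a linear relation between characters, a surplus of classes a nonzero class function whose pairing
  with every character vanishes. Normality of the convolution enters because it makes kernel and
  range meet only in 0, so that an irreducible subspace taken inside the range cannot be
  annihilated. On the wreath product side, the obstacle is that equal cycle data must yield an
  actual conjugating element. Conjugacy is therefore written as \<open>g x = y g\<close> and read as
  an isomorphism of labelled permutations, possibly between different sets. Equality of the data is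
  turned into such an isomorphism cycle by cycle, and prescribed data are realised on a set of
  formal points that is then mapped onto the blocks by a colour-preserving bijection.\<close>

lemma homogeneous_system_nontrivial_solution:
  fixes a :: "'j \<Rightarrow> 'i \<Rightarrow> 'k :: field"
  assumes "finite J" "finite I" "card J < card I"
  shows "\<exists>x. (\<exists>i\<in>I. x i \<noteq> 0) \<and> (\<forall>j\<in>J. (\<Sum>i\<in>I. a j i * x i) = 0)"
  using assms
proof (induction J arbitrary: I a rule: finite_induct)
  case empty
  then have "I \<noteq> {}" by auto
  then show ?case by (auto intro!: exI[of _ "\<lambda>_. 1"])
next
  case (insert j J)
  show ?case
  proof (cases "\<forall>i\<in>I. a j i = 0")
    case True
    obtain x where "\<exists>i\<in>I. x i \<noteq> 0" "\<forall>j\<in>J. (\<Sum>i\<in>I. a j i * x i) = 0"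
      using insert.IH[of I a] insert.prems insert.hyps by auto
    then show ?thesis using True by (intro exI[of _ x]) auto
  next
    case False
    then obtain p where p: "p \<in> I" "a j p \<noteq> 0" by blast
    \<comment> \<open>Gaussian elimination: the equation of \<open>j\<close> determines the unknown
      \<open>p\<close>, and substituting it into the others leaves one equation and one unknown
      fewer.\<close>
    let ?I = "I - {p}"
    have "card J < card ?I"
      using insert.prems insert.hyps p by simp
    then obtain x where x: "\<exists>i\<in>?I. x i \<noteq> 0"
      and sol: "\<forall>k\<in>J. (\<Sum>i\<in>?I. (a k i - a k p * a j i / a j p) * x i) = 0"
      using insert.IH[of ?I "\<lambda>k i. a k i - a k p * a j i / a j p"] insert.prems by auto
    define y where "y = x(p := - (\<Sum>i\<in>?I. a j i * x i) / a j p)"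
    have split: "(\<Sum>i\<in>I. a k i * y i) =
        a k p * (- (\<Sum>i\<in>?I. a j i * x i) / a j p) + (\<Sum>i\<in>?I. a k i * x i)" for k
      using insert.prems p by (subst sum.remove[of _ p]) (auto simp: y_def intro!: sum.cong)
    have "(\<Sum>i\<in>I. a k i * y i) = 0" if "k \<in> insert j J" for k
    proof (cases "k = j")
      case True
      then show ?thesis using p by (simp add: split)
    next
      case False
      have "(\<Sum>i\<in>?I. (a k i - a k p * a j i / a j p) * x i) =
          (\<Sum>i\<in>?I. a k i * x i) - a k p / a j p * (\<Sum>i\<in>?I. a j i * x i)"
        by (simp add: sum_subtractf left_diff_distrib sum_distrib_left algebra_simps)
      then show ?thesis using sol that False by (simp add: split)
    qed
    moreover have "\<exists>i\<in>I. y i \<noteq> 0" using x by (auto simp: y_def)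
    ultimately show ?thesis by blast
  qed
qed

section \<open>Matrix representations and invariant subspaces\<close>

lemma carrier_general_linear:
  "carrier (general_linear d) =
     {A \<in> carrier_mat d d. \<exists>B\<in>carrier_mat d d. B * A = 1\<^sub>m d \<and> A * B = 1\<^sub>m d}"
  by (auto simp: general_linear_def units_of_def Units_def ring_mat_simps)

lemma mult_general_linear [simp]: "monoid.mult (general_linear d) = (*)"
  by (simp add: general_linear_def units_of_def ring_mat_simps)

lemma one_general_linear [simp]: "one (general_linear d) = 1\<^sub>m d"
  by (simp add: general_linear_def units_of_def ring_mat_simps)

lemma group_general_linear: "group (general_linear d)"
proof -
  interpret ring "ring_mat TYPE(complex) d ()" by (rule ring_mat)
  show ?thesis unfolding general_linear_def by (rule units_group)
qed

lemma
  assumes "group G" "is_rep G (d, \<rho>)"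
  shows is_rep_carrier: "g \<in> carrier G \<Longrightarrow> \<rho> g \<in> carrier_mat d d"
    and is_rep_mult: "g \<in> carrier G \<Longrightarrow> h \<in> carrier G \<Longrightarrow> \<rho> (g \<otimes>\<^bsub>G\<^esub> h) = \<rho> g * \<rho> h"
    and is_rep_one: "\<rho> \<one>\<^bsub>G\<^esub> = 1\<^sub>m d"
proof -
  have hom: "\<rho> \<in> hom G (general_linear d)" using assms by (simp add: is_rep_def)
  show "\<rho> g \<in> carrier_mat d d" if "g \<in> carrier G"
    using hom_carrier[OF hom] that by (auto simp: carrier_general_linear)
  show "\<rho> (g \<otimes>\<^bsub>G\<^esub> h) = \<rho> g * \<rho> h" if "g \<in> carrier G" "h \<in> carrier G"
    using hom_mult[OF hom that] by simp
  show "\<rho> \<one>\<^bsub>G\<^esub> = 1\<^sub>m d"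
    using hom_one[OF hom assms(1) group_general_linear] by simp
qed

text \<open>The matrices are invertible because \<open>\<rho> (inv g)\<close> is an inverse of
  \<open>\<rho> g\<close>, by multiplicativity and the value at the identity.\<close>

lemma is_repI:
  assumes "group G"
    and carr: "\<And>g. g \<in> carrier G \<Longrightarrow> \<rho> g \<in> carrier_mat d d"
    and mult: "\<And>g h. g \<in> carrier G \<Longrightarrow> h \<in> carrier G \<Longrightarrow> \<rho> (g \<otimes>\<^bsub>G\<^esub> h) = \<rho> g * \<rho> h"
    and one: "\<rho> \<one>\<^bsub>G\<^esub> = 1\<^sub>m d"
  shows "is_rep G (d, \<rho>)"
proof -
  interpret group G by fact
  have "\<rho> g \<in> carrier (general_linear d)" if g: "g \<in> carrier G" for g
    using carr[OF g] carr[OF inv_closed[OF g]] mult[OF g inv_closed[OF g]]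
      mult[OF inv_closed[OF g] g] g one
    by (auto simp: carrier_general_linear intro!: bexI[of _ "\<rho> (inv\<^bsub>G\<^esub> g)"])
  then show ?thesis using mult by (auto simp: is_rep_def hom_def)
qed

lemma subspace_vec_iff:
  "VectorSpace.subspace class_ring U (module_vec TYPE(complex) d) \<longleftrightarrow>
     U \<subseteq> carrier_vec d \<and> 0\<^sub>v d \<in> U \<and> (\<forall>u\<in>U. \<forall>v\<in>U. u + v \<in> U) \<and> (\<forall>c. \<forall>u\<in>U. c \<cdot>\<^sub>v u \<in> U)"
proof -
  interpret vec_space "TYPE(complex)" d .
  show ?thesis
    unfolding VectorSpace.subspace_def submodule_def
    using vec_vs vec_module by (auto simp: module_vec_simps class_ring_simps)
qed

lemma mult_unit_vec:
  fixes A :: "'a :: comm_ring_1 mat"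
  assumes "A \<in> carrier_mat m n" "j < n"
  shows "A *\<^sub>v unit_vec n j = col A j"
proof (rule eq_vecI)
  fix i assume "i < dim_vec (col A j)"
  then have "i < m" using assms by simp
  then show "(A *\<^sub>v unit_vec n j) $ i = col A j $ i"
    using assms scalar_prod_right_unit[of j n "row A i"] by simp
qed (use assms in simp)

lemma smult_one_mult_mat_vec:
  fixes v :: "'a :: comm_ring_1 vec"
  assumes v: "v \<in> carrier_vec d"
  shows "(c \<cdot>\<^sub>m 1\<^sub>m d) *\<^sub>v v = c \<cdot>\<^sub>v v"
proof (rule eq_vecI)
  fix i assume "i < dim_vec (c \<cdot>\<^sub>v v)"
  then have i: "i < d" using v by simp
  then have "row (c \<cdot>\<^sub>m 1\<^sub>m d) i = c \<cdot>\<^sub>v unit_vec d i" by (auto intro!: eq_vecI)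
  then show "((c \<cdot>\<^sub>m 1\<^sub>m d) *\<^sub>v v) $ i = (c \<cdot>\<^sub>v v) $ i"
    using i v by simp
qed (use v in simp)

definition mat_trace :: "complex mat \<Rightarrow> complex" where
  "mat_trace A = (\<Sum>i<dim_row A. A $$ (i, i))"

lemma mat_mult_index:
  assumes "A \<in> carrier_mat l m" "B \<in> carrier_mat m n" "i < l" "j < n"
  shows "(A * B) $$ (i, j) = (\<Sum>k<m. A $$ (i, k) * B $$ (k, j))"
  using assms by (simp add: scalar_prod_def atLeast0LessThan)

lemma mat_trace_comm:
  assumes "A \<in> carrier_mat m n" "B \<in> carrier_mat n m"
  shows "mat_trace (A * B) = mat_trace (B * A)"
proof -
  have "mat_trace (A * B) = (\<Sum>i<m. \<Sum>k<n. A $$ (i, k) * B $$ (k, i))"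
    using assms by (auto simp: mat_trace_def mat_mult_index[OF assms] simp del: index_mult_mat(1))
  also have "\<dots> = (\<Sum>k<n. \<Sum>i<m. B $$ (k, i) * A $$ (i, k))"
    by (subst sum.swap) (simp add: mult.commute)
  also have "\<dots> = mat_trace (B * A)"
    using assms by (auto simp: mat_trace_def mat_mult_index[OF assms(2,1)] simp del: index_mult_mat(1))
  finally show ?thesis .
qed

lemma mat_trace_one: "mat_trace (1\<^sub>m d) = of_nat d"
  by (simp add: mat_trace_def)

text \<open>The matrix is allowed to be rectangular because Schur's lemma compares representations
  of degrees that are a priori different.\<close>

lemma bijective_mat_general_linear:
  assumes T: "T \<in> carrier_mat e d"
    and inj: "\<And>v. v \<in> carrier_vec d \<Longrightarrow> T *\<^sub>v v = 0\<^sub>v e \<Longrightarrow> v = 0\<^sub>v d"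
    and surj: "\<And>w. w \<in> carrier_vec e \<Longrightarrow> \<exists>v\<in>carrier_vec d. T *\<^sub>v v = w"
  shows "d = e \<and> T \<in> carrier (general_linear d)"
proof -
  obtain f where f: "\<And>w. w \<in> carrier_vec e \<Longrightarrow> f w \<in> carrier_vec d \<and> T *\<^sub>v f w = w"
    using surj by metis
  \<comment> \<open>The columns of \<open>S\<close> are preimages of the unit vectors, so
    \<open>S\<close> is a right inverse by construction; injectivity of \<open>T\<close> makes it a
    left inverse.\<close>
  define S where "S = mat_of_cols d (map (\<lambda>j. f (unit_vec e j)) [0..<e])"
  have S: "S \<in> carrier_mat d e" by (auto simp: S_def)
  have colS: "col S j = f (unit_vec e j)" if "j < e" for j
    using that f[of "unit_vec e j"] by (simp add: S_def)
  have TS: "T * S = 1\<^sub>m e"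
  proof (rule mat_col_eqI)
    fix j assume "j < dim_col (1\<^sub>m e :: complex mat)"
    then have j: "j < e" by simp
    show "col (T * S) j = col (1\<^sub>m e) j"
      using f[of "unit_vec e j"] j by (simp add: col_mult2[OF T S] colS)
  qed (use S T in auto)
  have ST: "S * T = 1\<^sub>m d"
  proof (rule mat_col_eqI)
    fix j assume "j < dim_col (1\<^sub>m d :: complex mat)"
    then have j: "j < d" by simp
    have c: "col (S * T) j \<in> carrier_vec d" using S T j by (intro carrier_vecI) simp
    have "T *\<^sub>v col (S * T) j = col (T * (S * T)) j"
      using S T j by (simp add: col_mult2[of T e d "S * T" d])
    also have "T * (S * T) = T" using S T TS by (simp flip: assoc_mult_mat[of T e d S e T d])
    also have "col T j = T *\<^sub>v unit_vec d j" using mult_unit_vec[OF T j] by simp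
    finally have "T *\<^sub>v (col (S * T) j - unit_vec d j) = 0\<^sub>v e"
      using mult_minus_distrib_mat_vec[OF T c unit_vec_carrier[of d j]] T by auto
    then have "col (S * T) j - unit_vec d j = 0\<^sub>v d" using inj c by auto
    then have "col (S * T) j = unit_vec d j"
      using c carrier_matD(1)[OF S] by (auto simp: vec_eq_iff)
    then show "col (S * T) j = col (1\<^sub>m d) j" using j by simp
  qed (use S T in auto)
  \<comment> \<open>comparing traces gives equality of the dimensions without any dimension theory\<close>
  have "of_nat d = mat_trace (S * T)" by (simp add: ST mat_trace_one)
  also have "\<dots> = of_nat e" using mat_trace_comm[OF S T] by (simp add: TS mat_trace_one)
  finally have "d = e" by simp
  then show ?thesis using S T ST TS by (auto simp: carrier_general_linear)
qed

section \<open>Schur's lemma\<close>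

text \<open>Kernel and image of an intertwiner are invariant subspaces, so irreducibility makes a
  nonzero intertwiner injective and surjective.\<close>

lemma schur:
  assumes G: "group G" and \<rho>: "irreducible_rep G (d, \<rho>)" and \<sigma>: "irreducible_rep G (e, \<sigma>)"
    and T: "T \<in> carrier_mat e d"
    and comm: "\<And>g. g \<in> carrier G \<Longrightarrow> T * \<rho> g = \<sigma> g * T"
  shows "T = 0\<^sub>m e d \<or> d = e \<and> T \<in> carrier (general_linear d)"
proof (cases "T = 0\<^sub>m e d")
  case False
  have rep\<rho>: "is_rep G (d, \<rho>)" and rep\<sigma>: "is_rep G (e, \<sigma>)"
    using \<rho> \<sigma> by (auto simp: irreducible_rep_def)
  note \<rho>c = is_rep_carrier[OF G rep\<rho>] and \<sigma>c = is_rep_carrier[OF G rep\<sigma>]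
  have comm_vec: "T *\<^sub>v (\<rho> g *\<^sub>v v) = \<sigma> g *\<^sub>v (T *\<^sub>v v)" if "g \<in> carrier G" "v \<in> carrier_vec d" for g v
    using assoc_mult_mat_vec[OF T \<rho>c[OF that(1)] that(2)]
      assoc_mult_mat_vec[OF \<sigma>c[OF that(1)] T that(2)] comm[OF that(1)] by simp
  let ?K = "{v \<in> carrier_vec d. T *\<^sub>v v = 0\<^sub>v e}"
  have "invariant_subspace G (d, \<rho>) ?K"
  proof -
    have "T *\<^sub>v 0\<^sub>v d = 0\<^sub>v e" using T by auto
    moreover have "T *\<^sub>v (u + v) = 0\<^sub>v e"
      if "u \<in> ?K" "v \<in> ?K" for u v
      using that T by (simp add: mult_add_distrib_mat_vec)
    moreover have "T *\<^sub>v (c \<cdot>\<^sub>v u) = 0\<^sub>v e" if "u \<in> ?K" for c u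
      using that T by (auto simp: mult_mat_vec)
    moreover have "\<rho> g *\<^sub>v u \<in> ?K" if g: "g \<in> carrier G" and u: "u \<in> ?K" for g u
    proof -
      have "\<sigma> g *\<^sub>v 0\<^sub>v e = 0\<^sub>v e" using \<sigma>c[OF g] by auto
      then show ?thesis using \<rho>c[OF g] u comm_vec[OF g, of u] by auto
    qed
    ultimately show ?thesis
      by (simp add: invariant_subspace_def subspace_vec_iff subset_iff)
  qed
  then have K: "?K = {0\<^sub>v d} \<or> ?K = carrier_vec d" using \<rho> by (auto simp: irreducible_rep_def)
  \<comment> \<open>A nonzero matrix has a nonzero column. The corresponding unit vector lies
    outside the kernel and has a nonzero image, which decides both alternatives given by
    irreducibility.\<close>
  obtain j where j: "j < d" "col T j \<noteq> 0\<^sub>v e"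
  proof (rule ccontr)
    assume "\<not> thesis"
    then have "\<And>j. j < d \<Longrightarrow> col T j = 0\<^sub>v e" using that by blast
    then have "T = 0\<^sub>m e d" using T by (intro mat_col_eqI) auto
    then show False using False by simp
  qed
  then have Tj: "T *\<^sub>v unit_vec d j \<noteq> 0\<^sub>v e" using mult_unit_vec[OF T] by simp
  then have "unit_vec d j \<notin> ?K" by simp
  then have K0: "?K = {0\<^sub>v d}" using K unit_vec_carrier by blast
  let ?I = "(\<lambda>v. T *\<^sub>v v) ` carrier_vec d"
  have "invariant_subspace G (e, \<sigma>) ?I"
    unfolding invariant_subspace_def
  proof (clarsimp simp: subspace_vec_iff, intro conjI ballI allI)
    show "?I \<subseteq> carrier_vec e" using T by auto
    show "0\<^sub>v e \<in> ?I" using T by (intro image_eqI[of _ _ "0\<^sub>v d"]) auto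
    fix x :: "complex vec" assume x: "x \<in> carrier_vec d"
    show "T *\<^sub>v x + T *\<^sub>v y \<in> ?I" if "y \<in> carrier_vec d" for y :: "complex vec"
      using T x that by (intro image_eqI[of _ _ "x + y"]) (auto simp: mult_add_distrib_mat_vec)
    show "c \<cdot>\<^sub>v (T *\<^sub>v x) \<in> ?I" for c
      using T x by (intro image_eqI[of _ _ "c \<cdot>\<^sub>v x"]) (auto simp: mult_mat_vec)
    show "\<sigma> g *\<^sub>v (T *\<^sub>v x) \<in> ?I" if "g \<in> carrier G" for g
      using \<rho>c[OF that] x comm_vec[OF that x]
      by (intro image_eqI[of _ _ "\<rho> g *\<^sub>v x"]) auto
  qed
  then have "?I = {0\<^sub>v e} \<or> ?I = carrier_vec e" using \<sigma> by (auto simp: irreducible_rep_def)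
  then have "?I = carrier_vec e" using Tj by (metis image_eqI singletonD unit_vec_carrier)
  then have "d = e \<and> T \<in> carrier (general_linear d)"
  proof (intro bijective_mat_general_linear[OF T])
    show "v = 0\<^sub>v d" if "v \<in> carrier_vec d" "T *\<^sub>v v = 0\<^sub>v e" for v
      using that K0 by blast
    show "\<exists>v\<in>carrier_vec d. T *\<^sub>v v = w" if "w \<in> carrier_vec e" for w
      using that \<open>?I = carrier_vec e\<close> by (metis (no_types, lifting) imageE)
  qed
  then show ?thesis ..
qed simp

text \<open>Over the complex numbers \<open>T\<close> has an eigenvalue \<open>c\<close>. The
  difference \<open>T - c \<cdot>\<^sub>m 1\<^sub>m d\<close> still commutes with the representation
  but kills an eigenvector, so Schur's lemma forces it to vanish.\<close>

lemma schur_scalar: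
  assumes G: "group G" and \<rho>: "irreducible_rep G (d, \<rho>)"
    and T: "T \<in> carrier_mat d d"
    and comm: "\<And>g. g \<in> carrier G \<Longrightarrow> T * \<rho> g = \<rho> g * T"
  obtains c where "T = c \<cdot>\<^sub>m 1\<^sub>m d"
proof -
  have rep: "is_rep G (d, \<rho>)" and d: "0 < d" using \<rho> by (auto simp: irreducible_rep_def)
  note \<rho>c = is_rep_carrier[OF G rep]
  obtain c v where "eigenvector T v c"
    using spectrum_non_empty[OF T] d by (auto simp: spectrum_def eigenvalue_def)
  then have v: "v \<in> carrier_vec d" "v \<noteq> 0\<^sub>v d" "T *\<^sub>v v = c \<cdot>\<^sub>v v"
    using T by (auto simp: eigenvector_def)
  let ?S = "T - c \<cdot>\<^sub>m 1\<^sub>m d"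
  have S: "?S \<in> carrier_mat d d" by (rule minus_carrier_mat) simp
  have "?S * \<rho> g = \<rho> g * ?S" if g: "g \<in> carrier G" for g
    using T \<rho>c[OF g] comm[OF g]
    by (simp add: minus_mult_distrib_mat[of T d d] mult_minus_distrib_mat[of _ d d T d]
        mult_smult_assoc_mat[of _ d d] mult_smult_distrib[OF \<rho>c[OF g] one_carrier_mat])
  then have "?S = 0\<^sub>m d d \<or> ?S \<in> carrier (general_linear d)"
    using schur[OF G \<rho> \<rho> S] by blast
  moreover have "?S \<notin> carrier (general_linear d)"
  proof
    assume "?S \<in> carrier (general_linear d)"
    then obtain B where B: "B \<in> carrier_mat d d" "B * ?S = 1\<^sub>m d"
      by (auto simp: carrier_general_linear)
    have "?S *\<^sub>v v = 0\<^sub>v d"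
      using v by (simp add: minus_mult_distrib_mat_vec[OF T _ v(1)] smult_one_mult_mat_vec)
    then have "(B * ?S) *\<^sub>v v = B *\<^sub>v 0\<^sub>v d" using assoc_mult_mat_vec[OF B(1) S v(1)] by simp
    moreover have "B *\<^sub>v 0\<^sub>v d = 0\<^sub>v d" using B by auto
    ultimately show False using B v by simp
  qed
  ultimately have "T - c \<cdot>\<^sub>m 1\<^sub>m d = 0\<^sub>m d d" by blast
  then have "T = c \<cdot>\<^sub>m 1\<^sub>m d"
    using T by (auto simp: mat_eq_iff)
  then show thesis by (rule that)
qed

section \<open>Characters and conjugacy classes\<close>

text \<open>The inverse-free equation is the form that a computation in the wreath product turns
  directly into the conditions of \<open>cycle_iso\<close>.\<close>

definition conj_class :: "('a, 'b) monoid_scheme \<Rightarrow> 'a \<Rightarrow> 'a set" where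
  "conj_class G x = {y \<in> carrier G. \<exists>g\<in>carrier G. g \<otimes>\<^bsub>G\<^esub> x = y \<otimes>\<^bsub>G\<^esub> g}"

definition conj_classes :: "('a, 'b) monoid_scheme \<Rightarrow> 'a set set" where
  "conj_classes G = conj_class G ` carrier G"

lemma conj_class_eq_iff:
  assumes "group G" "x \<in> carrier G" "y \<in> carrier G"
  shows "conj_class G x = conj_class G y \<longleftrightarrow> (\<exists>g\<in>carrier G. g \<otimes>\<^bsub>G\<^esub> x = y \<otimes>\<^bsub>G\<^esub> g)"
proof -
  interpret group G by fact
  have refl: "z \<in> conj_class G z" if "z \<in> carrier G" for z
    using that by (auto simp: conj_class_def intro!: bexI[of _ "\<one>\<^bsub>G\<^esub>"])
  have sym: "v \<in> conj_class G u" if "u \<in> conj_class G v" "v \<in> carrier G" for u v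
  proof -
    obtain g where g: "g \<in> carrier G" "g \<otimes>\<^bsub>G\<^esub> v = u \<otimes>\<^bsub>G\<^esub> g" and u: "u \<in> carrier G"
      using \<open>u \<in> conj_class G v\<close> by (auto simp: conj_class_def)
    have "inv\<^bsub>G\<^esub> g \<otimes>\<^bsub>G\<^esub> u = inv\<^bsub>G\<^esub> g \<otimes>\<^bsub>G\<^esub> (u \<otimes>\<^bsub>G\<^esub> g) \<otimes>\<^bsub>G\<^esub> inv\<^bsub>G\<^esub> g"
      using g(1) u by (simp add: m_assoc)
    also have "\<dots> = inv\<^bsub>G\<^esub> g \<otimes>\<^bsub>G\<^esub> (g \<otimes>\<^bsub>G\<^esub> v) \<otimes>\<^bsub>G\<^esub> inv\<^bsub>G\<^esub> g"
      by (simp only: g(2))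
    also have "\<dots> = v \<otimes>\<^bsub>G\<^esub> inv\<^bsub>G\<^esub> g"
      using g(1) that(2) by (simp flip: m_assoc)
    finally have "inv\<^bsub>G\<^esub> g \<otimes>\<^bsub>G\<^esub> u = v \<otimes>\<^bsub>G\<^esub> inv\<^bsub>G\<^esub> g" .
    then have "\<exists>h\<in>carrier G. h \<otimes>\<^bsub>G\<^esub> u = v \<otimes>\<^bsub>G\<^esub> h"
      by (rule bexI[of "\<lambda>h. h \<otimes>\<^bsub>G\<^esub> u = v \<otimes>\<^bsub>G\<^esub> h", OF _ inv_closed[OF g(1)]])
    then show ?thesis using that(2) by (simp add: conj_class_def)
  qed
  have trans: "w \<in> conj_class G u" if vw: "w \<in> conj_class G v" and uv: "v \<in> conj_class G u" and u: "u \<in> carrier G" for u v w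
  proof -
    obtain g where g: "g \<in> carrier G" "g \<otimes>\<^bsub>G\<^esub> v = w \<otimes>\<^bsub>G\<^esub> g" and w: "w \<in> carrier G"
      using vw by (auto simp: conj_class_def)
    obtain h where h: "h \<in> carrier G" "h \<otimes>\<^bsub>G\<^esub> u = v \<otimes>\<^bsub>G\<^esub> h" and v: "v \<in> carrier G"
      using uv by (auto simp: conj_class_def)
    note c = w v
    have "(g \<otimes>\<^bsub>G\<^esub> h) \<otimes>\<^bsub>G\<^esub> u = g \<otimes>\<^bsub>G\<^esub> v \<otimes>\<^bsub>G\<^esub> h"
      using g(1) h c u by (simp add: m_assoc)
    also have "\<dots> = w \<otimes>\<^bsub>G\<^esub> (g \<otimes>\<^bsub>G\<^esub> h)"
      using g(1) h(1) c by (simp only: g(2) m_assoc)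
    finally have "g \<otimes>\<^bsub>G\<^esub> h \<otimes>\<^bsub>G\<^esub> u = w \<otimes>\<^bsub>G\<^esub> (g \<otimes>\<^bsub>G\<^esub> h)" .
    then have "\<exists>k\<in>carrier G. k \<otimes>\<^bsub>G\<^esub> u = w \<otimes>\<^bsub>G\<^esub> k"
      by (rule bexI[of "\<lambda>k. k \<otimes>\<^bsub>G\<^esub> u = w \<otimes>\<^bsub>G\<^esub> k", OF _ m_closed[OF g(1) h(1)]])
    then show ?thesis using c(1) by (simp add: conj_class_def)
  qed
  have "conj_class G x = conj_class G y \<longleftrightarrow> y \<in> conj_class G x"
  proof
    assume "y \<in> conj_class G x"
    then show "conj_class G x = conj_class G y"
      using sym[of y x] trans[of _ y x] trans[of _ x y] assms(2,3) by blast
  qed (use refl assms in blast)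
  also have "\<dots> \<longleftrightarrow> (\<exists>g\<in>carrier G. g \<otimes>\<^bsub>G\<^esub> x = y \<otimes>\<^bsub>G\<^esub> g)"
    using assms(3) by (simp add: conj_class_def)
  finally show ?thesis .
qed

section \<open>Orthogonality of irreducible characters\<close>

lemma (in group) sum_left_translate:
  assumes "h \<in> carrier G"
  shows "(\<Sum>g\<in>carrier G. F (h \<otimes> g)) = (\<Sum>g\<in>carrier G. F g)"
  by (rule sum.reindex_bij_witness[of _ "\<lambda>g. inv h \<otimes> g" "\<lambda>g. h \<otimes> g"])
     (use assms in \<open>auto simp flip: m_assoc\<close>)

text \<open>\<open>T\<close> is the unnormalised average of a matrix unit: the sum over the group of
  \<sigma>(g) E \<rho>(g^-1), where E has its only nonzero entry at \<open>(k, l)\<close>. Using one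
  matrix unit at a time gives relations between single matrix coefficients.\<close>

lemma intertwiner_average:
  assumes G: "group G" and \<rho>: "is_rep G (d, \<rho>)" and \<sigma>: "is_rep G (e, \<sigma>)"
    and kl: "k < e" "l < d" and h: "h \<in> carrier G"
  defines "T \<equiv> mat e d (\<lambda>(i, j). \<Sum>g\<in>carrier G. \<sigma> g $$ (i, k) * \<rho> (inv\<^bsub>G\<^esub> g) $$ (l, j))"
  shows "T * \<rho> h = \<sigma> h * T"
proof (rule eq_matI)
  interpret group G by fact
  note \<rho>c = is_rep_carrier[OF G \<rho>] and \<sigma>c = is_rep_carrier[OF G \<sigma>]
  note \<rho>m = is_rep_mult[OF G \<rho>] and \<sigma>m = is_rep_mult[OF G \<sigma>]
  have T: "T \<in> carrier_mat e d" by (simp add: T_def)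
  fix i j assume "i < dim_row (\<sigma> h * T)" "j < dim_col (\<sigma> h * T)"
  then have ij: "i < e" "j < d" using \<sigma>c[OF h] T by auto
  have "(T * \<rho> h) $$ (i, j) = (\<Sum>m<d. T $$ (i, m) * \<rho> h $$ (m, j))"
    by (rule mat_mult_index[OF T \<rho>c[OF h] ij])
  also have "\<dots> = (\<Sum>m<d. \<Sum>g\<in>carrier G. \<sigma> g $$ (i, k) * (\<rho> (inv\<^bsub>G\<^esub> g) $$ (l, m) * \<rho> h $$ (m, j)))"
    using ij by (auto simp: T_def sum_distrib_right mult.assoc intro!: sum.cong)
  also have "\<dots> = (\<Sum>g\<in>carrier G. \<sigma> g $$ (i, k) * (\<Sum>m<d. \<rho> (inv\<^bsub>G\<^esub> g) $$ (l, m) * \<rho> h $$ (m, j)))"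
    by (subst sum.swap) (simp add: sum_distrib_left)
  also have "\<dots> = (\<Sum>g\<in>carrier G. \<sigma> g $$ (i, k) * \<rho> (inv\<^bsub>G\<^esub> g \<otimes>\<^bsub>G\<^esub> h) $$ (l, j))"
    by (intro sum.cong refl)
       (use h kl ij in \<open>simp add: \<rho>m mat_mult_index[OF \<rho>c \<rho>c] del: index_mult_mat\<close>)
  \<comment> \<open>After the substitution of \<open>h g\<close> for \<open>g\<close>, the product
    of \<open>inv (h g)\<close> and \<open>h\<close> is just \<open>inv g\<close>, and a factor
    \<open>\<sigma> h\<close> splits off on the left.\<close>
  also have "\<dots> = (\<Sum>g\<in>carrier G. \<sigma> (h \<otimes>\<^bsub>G\<^esub> g) $$ (i, k) * \<rho> (inv\<^bsub>G\<^esub> (h \<otimes>\<^bsub>G\<^esub> g) \<otimes>\<^bsub>G\<^esub> h) $$ (l, j))"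
    by (rule sum_left_translate[OF h, symmetric])
  also have "\<dots> = (\<Sum>g\<in>carrier G. (\<Sum>m<e. \<sigma> h $$ (i, m) * \<sigma> g $$ (m, k)) * \<rho> (inv\<^bsub>G\<^esub> g) $$ (l, j))"
    by (intro sum.cong refl)
       (use h kl ij in \<open>simp add: \<sigma>m mat_mult_index[OF \<sigma>c \<sigma>c] inv_mult_group m_assoc del: index_mult_mat\<close>)
  also have "\<dots> = (\<Sum>m<e. \<sigma> h $$ (i, m) * (\<Sum>g\<in>carrier G. \<sigma> g $$ (m, k) * \<rho> (inv\<^bsub>G\<^esub> g) $$ (l, j)))"
    by (simp add: sum_distrib_left sum_distrib_right mult.assoc) (rule sum.swap)
  also have "\<dots> = (\<Sum>m<e. \<sigma> h $$ (i, m) * T $$ (m, j))"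
    using ij by (simp add: T_def)
  also have "\<dots> = (\<sigma> h * T) $$ (i, j)"
    by (rule mat_mult_index[OF \<sigma>c[OF h] T ij, symmetric])
  finally show "(T * \<rho> h) $$ (i, j) = (\<sigma> h * T) $$ (i, j)" .
qed (use is_rep_carrier[OF G \<rho> h] is_rep_carrier[OF G \<sigma> h] in \<open>auto simp: T_def\<close>)

lemma character_inner_product:
  assumes G: "group G" and \<rho>: "is_rep G (d, \<rho>)" and \<sigma>: "is_rep G (e, \<sigma>)"
  shows "(\<Sum>g\<in>carrier G. mat_trace (\<sigma> g) * mat_trace (\<rho> (inv\<^bsub>G\<^esub> g))) =
    (\<Sum>i<e. \<Sum>j<d. \<Sum>g\<in>carrier G. \<sigma> g $$ (i, i) * \<rho> (inv\<^bsub>G\<^esub> g) $$ (j, j))"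
proof -
  interpret group G by fact
  have "(\<Sum>g\<in>carrier G. mat_trace (\<sigma> g) * mat_trace (\<rho> (inv\<^bsub>G\<^esub> g))) =
    (\<Sum>g\<in>carrier G. \<Sum>i<e. \<Sum>j<d. \<sigma> g $$ (i, i) * \<rho> (inv\<^bsub>G\<^esub> g) $$ (j, j))"
    by (intro sum.cong refl)
       (use carrier_matD(1)[OF is_rep_carrier[OF G \<rho>]] carrier_matD(1)[OF is_rep_carrier[OF G \<sigma>]]
        in \<open>simp add: mat_trace_def sum_product\<close>)
  also have "\<dots> = (\<Sum>i<e. \<Sum>g\<in>carrier G. \<Sum>j<d. \<sigma> g $$ (i, i) * \<rho> (inv\<^bsub>G\<^esub> g) $$ (j, j))"
    by (rule sum.swap)
  also have "\<dots> = (\<Sum>i<e. \<Sum>j<d. \<Sum>g\<in>carrier G. \<sigma> g $$ (i, i) * \<rho> (inv\<^bsub>G\<^esub> g) $$ (j, j))"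
    by (intro sum.cong refl) (rule sum.swap)
  finally show ?thesis .
qed

text \<open>With the matrix unit at \<open>(i, j)\<close>, the \<open>(i, j)\<close> entry of the
  averaged intertwiner is exactly a summand of the character pairing, and Schur's lemma kills the
  intertwiner. The inverse argument takes the place of complex conjugation.\<close>

lemma character_orthogonal:
  assumes G: "group G" and \<rho>: "irreducible_rep G (d, \<rho>)" and \<sigma>: "irreducible_rep G (e, \<sigma>)"
    and ne: "\<not> equivalent_reps G (d, \<rho>) (e, \<sigma>)"
  shows "(\<Sum>g\<in>carrier G. mat_trace (\<sigma> g) * mat_trace (\<rho> (inv\<^bsub>G\<^esub> g))) = 0"
proof -
  have rep: "is_rep G (d, \<rho>)" "is_rep G (e, \<sigma>)" using \<rho> \<sigma> by (auto simp: irreducible_rep_def)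
  have "(\<Sum>g\<in>carrier G. \<sigma> g $$ (i, i) * \<rho> (inv\<^bsub>G\<^esub> g) $$ (j, j)) = 0" if "i < e" "j < d" for i j
  proof -
    let ?T = "mat e d (\<lambda>(i', j'). \<Sum>g\<in>carrier G. \<sigma> g $$ (i', i) * \<rho> (inv\<^bsub>G\<^esub> g) $$ (j, j'))"
    have comm: "?T * \<rho> h = \<sigma> h * ?T" if "h \<in> carrier G" for h
      using intertwiner_average[OF G rep \<open>i < e\<close> \<open>j < d\<close> that] .
    have "?T = 0\<^sub>m e d"
      using schur[OF G \<rho> \<sigma> mat_carrier comm] ne comm by (auto simp: equivalent_reps_def)
    then have "?T $$ (i, j) = 0" using that by simp
    then show ?thesis using that by simp
  qed
  then show ?thesis by (simp add: character_inner_product[OF G rep])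
qed

text \<open>The averaged matrix unit is now scalar, so index pairs off the diagonal contribute
  nothing and each of the \<open>d\<close> diagonal ones contributes the group order divided by
  \<open>d\<close>.\<close>

lemma character_norm:
  assumes G: "group G" and fin: "finite (carrier G)" and \<rho>: "irreducible_rep G (d, \<rho>)"
  shows "(\<Sum>g\<in>carrier G. mat_trace (\<rho> g) * mat_trace (\<rho> (inv\<^bsub>G\<^esub> g))) = of_nat (card (carrier G))"
proof -
  interpret group G by fact
  have rep: "is_rep G (d, \<rho>)" and d: "0 < d" using \<rho> by (auto simp: irreducible_rep_def)
  note \<rho>c = is_rep_carrier[OF G rep]
  have "(\<Sum>g\<in>carrier G. \<rho> g $$ (i, i) * \<rho> (inv\<^bsub>G\<^esub> g) $$ (j, j)) =
      (if i = j then of_nat (card (carrier G)) / of_nat d else 0)" if ij: "i < d" "j < d" for i j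
  proof -
    let ?T = "mat d d (\<lambda>(i', j'). \<Sum>g\<in>carrier G. \<rho> g $$ (i', i) * \<rho> (inv\<^bsub>G\<^esub> g) $$ (j, j'))"
    have comm: "?T * \<rho> h = \<rho> h * ?T" if "h \<in> carrier G" for h
      using intertwiner_average[OF G rep rep \<open>i < d\<close> \<open>j < d\<close> that] .
    obtain c where c: "?T = c \<cdot>\<^sub>m 1\<^sub>m d"
      using schur_scalar[OF G \<rho> mat_carrier comm] by blast
    \<comment> \<open>The scalar is read off from the trace: each group element contributes the
      \<open>(j, i)\<close> entry of \<open>\<rho> (inv g) * \<rho> g\<close>, which is the identity
      matrix.\<close>
    have "of_nat d * c = (\<Sum>m<d. ?T $$ (m, m))" by (simp add: c)
    also have "\<dots> = (\<Sum>g\<in>carrier G. \<Sum>m<d. \<rho> (inv\<^bsub>G\<^esub> g) $$ (j, m) * \<rho> g $$ (m, i))"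
      by (subst sum.swap) (simp add: mult.commute)
    also have "\<dots> = (\<Sum>g\<in>carrier G. (1\<^sub>m d :: complex mat) $$ (j, i))"
    proof (intro sum.cong refl)
      fix g assume g: "g \<in> carrier G"
      have "(\<rho> (inv\<^bsub>G\<^esub> g) * \<rho> g) = 1\<^sub>m d"
        using is_rep_mult[OF G rep inv_closed[OF g] g] is_rep_one[OF G rep] g by simp
      then show "(\<Sum>m<d. \<rho> (inv\<^bsub>G\<^esub> g) $$ (j, m) * \<rho> g $$ (m, i)) = (1\<^sub>m d :: complex mat) $$ (j, i)"
        using mat_mult_index[OF \<rho>c[OF inv_closed[OF g]] \<rho>c[OF g] ij(2,1)] by simp
    qed
    finally have "of_nat d * c = (if i = j then of_nat (card (carrier G)) else 0)"
      using ij by auto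
    moreover have "?T $$ (i, j) = (if i = j then c else 0)" using ij by (simp only: c) simp
    ultimately show ?thesis using ij d by (auto simp: field_simps)
  qed
  then show ?thesis using d by (simp add: character_inner_product[OF G rep rep])
qed

lemma character_conj:
  assumes G: "group G" and rep: "is_rep G (d, \<rho>)"
    and x: "x \<in> carrier G" and y: "y \<in> carrier G" and eq: "conj_class G x = conj_class G y"
  shows "mat_trace (\<rho> x) = mat_trace (\<rho> y)"
proof -
  interpret group G by fact
  obtain g where g: "g \<in> carrier G" "g \<otimes>\<^bsub>G\<^esub> x = y \<otimes>\<^bsub>G\<^esub> g"
    using eq conj_class_eq_iff[OF G x y] by blast
  have "y = (g \<otimes>\<^bsub>G\<^esub> x) \<otimes>\<^bsub>G\<^esub> inv\<^bsub>G\<^esub> g" using g x y by (simp add: m_assoc)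
  then have "\<rho> y = \<rho> (g \<otimes>\<^bsub>G\<^esub> x) * \<rho> (inv\<^bsub>G\<^esub> g)"
    using is_rep_mult[OF G rep, of "g \<otimes>\<^bsub>G\<^esub> x" "inv\<^bsub>G\<^esub> g"] g(1) x by simp
  also have "mat_trace \<dots> = mat_trace (\<rho> (inv\<^bsub>G\<^esub> g) * \<rho> (g \<otimes>\<^bsub>G\<^esub> x))"
    by (rule mat_trace_comm[of _ d d]) (use g(1) x in \<open>auto intro!: is_rep_carrier[OF G rep]\<close>)
  also have "\<rho> (inv\<^bsub>G\<^esub> g) * \<rho> (g \<otimes>\<^bsub>G\<^esub> x) = \<rho> x"
    using g(1) x by (simp add: m_assoc[symmetric] flip: is_rep_mult[OF G rep])
  finally show ?thesis ..
qed

lemma equivalent_reps_character: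
  assumes G: "group G" and rep: "is_rep G (d, \<rho>)" "is_rep G (e, \<sigma>)"
    and eq: "equivalent_reps G (d, \<rho>) (e, \<sigma>)" and g: "g \<in> carrier G"
  shows "mat_trace (\<rho> g) = mat_trace (\<sigma> g)"
proof -
  obtain T S where [simp]: "d = e" and T: "T \<in> carrier_mat d d" and S: "S \<in> carrier_mat d d"
    and TS: "T * S = 1\<^sub>m d" "S * T = 1\<^sub>m d" and comm: "T * \<rho> g = \<sigma> g * T"
    using eq g by (auto simp: equivalent_reps_def carrier_general_linear)
  have \<rho>: "\<rho> g \<in> carrier_mat d d" and \<sigma>: "\<sigma> g \<in> carrier_mat d d"
    using is_rep_carrier[OF G rep(1) g] is_rep_carrier[OF G rep(2) g] by auto
  have "\<sigma> g = \<sigma> g * (T * S)" using TS \<sigma> by simp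
  also have "\<dots> = T * \<rho> g * S" using assoc_mult_mat[OF \<sigma> T S] by (simp add: comm)
  also have "mat_trace \<dots> = mat_trace (S * (T * \<rho> g))"
    using S T \<rho> by (intro mat_trace_comm[of _ d d]) auto
  also have "S * (T * \<rho> g) = \<rho> g" using assoc_mult_mat[OF S T \<rho>] TS \<rho> by simp
  finally show ?thesis ..
qed

text \<open>A larger family would have more members than there are class representatives at which
  characters must be evaluated, hence a nontrivial linear relation between its characters. Pairing
  this relation with each character isolates its coefficient.\<close>

lemma card_inequivalent_irreps_le:
  assumes G: "group G" and fin: "finite (carrier G)" and X: "finite X"
    and irr: "\<And>R. R \<in> X \<Longrightarrow> irreducible_rep G R"
    and ne: "\<And>R S. R \<in> X \<Longrightarrow> S \<in> X \<Longrightarrow> R \<noteq> S \<Longrightarrow> \<not> equivalent_reps G R S"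
  shows "card X \<le> card (conj_classes G)"
proof (rule ccontr)
  interpret group G by fact
  let ?\<chi> = "\<lambda>R g. mat_trace (snd R g)"
  assume "\<not> ?thesis"
  then have less: "card (conj_classes G) < card X" by simp
  define rp where "rp = (\<lambda>K. SOME g. g \<in> carrier G \<and> conj_class G g = K)"
  have finK: "finite (conj_classes G)" using fin by (simp add: conj_classes_def)
  obtain x where x: "\<exists>R\<in>X. x R \<noteq> 0"
    and sol: "\<forall>K\<in>conj_classes G. (\<Sum>R\<in>X. ?\<chi> R (rp K) * x R) = 0"
    using homogeneous_system_nontrivial_solution[OF finK X less, of "\<lambda>K R. ?\<chi> R (rp K)"] by blast
  have rep: "is_rep G (fst R, snd R)" if "R \<in> X" for R
    using irr[OF that] by (cases R) (auto simp: irreducible_rep_def)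
  have zero: "(\<Sum>R\<in>X. ?\<chi> R g * x R) = 0" if g: "g \<in> carrier G" for g
  proof -
    let ?g = "rp (conj_class G g)"
    have "?g \<in> carrier G \<and> conj_class G ?g = conj_class G g"
      unfolding rp_def by (rule someI[of _ g]) (use g in simp)
    then have "?\<chi> R ?g = ?\<chi> R g" if "R \<in> X" for R
      using character_conj[OF G rep[OF that] _ g] by blast
    moreover have "(\<Sum>R\<in>X. ?\<chi> R ?g * x R) = 0" using sol g by (simp add: conj_classes_def)
    ultimately show ?thesis by simp
  qed
  have "x S = 0" if S: "S \<in> X" for S
  proof -
    have orth: "(\<Sum>g\<in>carrier G. ?\<chi> R g * ?\<chi> S (inv\<^bsub>G\<^esub> g)) =
        (if R = S then of_nat (card (carrier G)) else 0)" if R: "R \<in> X" for R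
    proof (cases "R = S")
      case True
      then show ?thesis using character_norm[OF G fin, of "fst S" "snd S"] irr[OF S] by simp
    next
      case False
      then show ?thesis
        using character_orthogonal[OF G, of "fst S" "snd S" "fst R" "snd R"] irr[OF S] irr[OF R]
          ne[OF S R] by simp
    qed
    have "0 = (\<Sum>g\<in>carrier G. (\<Sum>R\<in>X. ?\<chi> R g * x R) * ?\<chi> S (inv\<^bsub>G\<^esub> g))" by (simp add: zero)
    also have "\<dots> = (\<Sum>R\<in>X. x R * (\<Sum>g\<in>carrier G. ?\<chi> R g * ?\<chi> S (inv\<^bsub>G\<^esub> g)))"
      by (simp add: sum_distrib_left sum_distrib_right mult_ac) (rule sum.swap)
    also have "\<dots> = (\<Sum>R\<in>X. if R = S then x S * of_nat (card (carrier G)) else 0)"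
      by (intro sum.cong refl) (simp add: orth)
    also have "\<dots> = x S * of_nat (card (carrier G))" using X S by simp
    finally have "x S * of_nat (card (carrier G)) = 0" by simp
    moreover have "card (carrier G) \<noteq> 0" using fin one_closed by (metis card_eq_0_iff empty_iff)
    ultimately show ?thesis by simp
  qed
  then show False using x by blast
qed

section \<open>Completeness of the irreducible characters\<close>

text \<open>A nonzero candidate of least dimension is minimal; the finite set \<open>B\<close> keeps
  all dimensions finite. The predicate \<open>P\<close> will be invariance under left
  translation.\<close>

lemma (in vector_space) exists_minimal_subspace:
  assumes fin: "finite B" and W: "subspace W" "W \<subseteq> span B" "P W" "W \<noteq> {0}"
  obtains U where "subspace U" "U \<subseteq> W" "P U" "U \<noteq> {0}"
    "\<forall>V. subspace V \<longrightarrow> V \<subseteq> U \<longrightarrow> P V \<longrightarrow> V \<noteq> {0} \<longrightarrow> V = U"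
proof -
  define Q where "Q U \<longleftrightarrow> subspace U \<and> U \<subseteq> W \<and> P U \<and> U \<noteq> {0}" for U
  have "Q W" using W by (simp add: Q_def)
  then obtain U where U: "Q U" and least: "\<And>V. Q V \<Longrightarrow> dim U \<le> dim V"
    using ex_has_least_nat[of Q W dim] by blast
  have "V = U" if V: "subspace V" "V \<subseteq> U" "P V" "V \<noteq> {0}" for V
  proof (rule ccontr)
    assume "V \<noteq> U"
    then obtain x where x: "x \<in> U" "x \<notin> V" using V by blast
    obtain C where C: "C \<subseteq> V" "independent C" "V \<subseteq> span C" "card C = dim V"
      by (rule basis_exists[of V])
    obtain D where D: "D \<subseteq> U" "independent D" "U \<subseteq> span D" "card D = dim U"
      by (rule basis_exists[of U])
    have "D \<subseteq> span B" using D(1) U W(2) by (auto simp: Q_def)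
    then have finD: "finite D" using independent_span_bound[OF fin D(2)] by simp
    \<comment> \<open>A vector of \<open>U\<close> outside \<open>V\<close> extends a basis of
      \<open>V\<close> to a larger independent set inside the span of a basis of \<open>U\<close>,
      so the dimension strictly drops.\<close>
    have "x \<notin> span C" using x(2) C(1) V(1) by (metis span_minimal subsetD)
    then have ind: "independent (insert x C)" "x \<notin> C"
      using independent_insertI[OF _ C(2)] span_base[of x C] by blast+
    have "insert x C \<subseteq> span D" using x(1) C(1) V(2) D(3) by blast
    then have "finite (insert x C)" "card (insert x C) \<le> card D"
      using independent_span_bound[OF finD ind(1)] by simp_all
    then have "dim V < dim U" using C(4) D(4) ind(2) by simp
    moreover have "Q V" using V U by (auto simp: Q_def)
    ultimately show False using least[of V] by simp
  qed
  then have "\<forall>V. subspace V \<longrightarrow> V \<subseteq> U \<longrightarrow> P V \<longrightarrow> V \<noteq> {0} \<longrightarrow> V = U"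
    by simp
  then show thesis using that[of U] U by (simp add: Q_def)
qed

text \<open>Passes from an invariant subspace to matrices by choosing a basis \<open>b\<close>,
  which is part of the conclusion because a convolution will be evaluated on it through the matrix
  coefficients. The group laws are required on \<open>U\<close> only: translation by the identity
  truncates functions outside the carrier.\<close>

lemma irreducible_rep_of_minimal_subspace:
  fixes scale :: "complex \<Rightarrow> 'v :: ab_group_add \<Rightarrow> 'v" and L :: "'a \<Rightarrow> 'v \<Rightarrow> 'v"
  assumes vs: "vector_space scale" and G: "group G"
    and U: "module.subspace scale U" "U \<noteq> {0}"
    and fin: "finite B" "U \<subseteq> module.span scale B"
    and inv: "\<And>g u. g \<in> carrier G \<Longrightarrow> u \<in> U \<Longrightarrow> L g u \<in> U"
    and add: "\<And>g u v. L g (u + v) = L g u + L g v"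
    and sc: "\<And>g c u. L g (scale c u) = scale c (L g u)"
    and one: "\<And>u. u \<in> U \<Longrightarrow> L \<one>\<^bsub>G\<^esub> u = u"
    and mult: "\<And>g h u. g \<in> carrier G \<Longrightarrow> h \<in> carrier G \<Longrightarrow> u \<in> U \<Longrightarrow>
      L (g \<otimes>\<^bsub>G\<^esub> h) u = L g (L h u)"
    and minimal: "\<forall>V. module.subspace scale V \<longrightarrow> V \<subseteq> U \<longrightarrow>
      (\<forall>g\<in>carrier G. \<forall>v\<in>V. L g v \<in> V) \<longrightarrow> V \<noteq> {0} \<longrightarrow> V = U"
  obtains d \<rho> b where "irreducible_rep G (d, \<rho>)"
    "\<forall>j<d. b j \<in> U" "\<forall>j<d. b j \<noteq> 0"
    "\<forall>g\<in>carrier G. \<forall>j<d. L g (b j) = (\<Sum>i<d. scale (\<rho> g $$ (i, j)) (b i))"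
proof -
  interpret vector_space scale by (rule vs)
  interpret group G by (rule G)
  obtain C where C: "C \<subseteq> U" "independent C" "U \<subseteq> span C" "card C = dim U"
    by (rule basis_exists[of U])
  have finC: "finite C" using independent_span_bound[OF fin(1) C(2)] order_trans[OF C(1) fin(2)] by simp
  define d where "d = card C"
  obtain b where b: "bij_betw b {..<d} C"
    using ex_bij_betw_nat_finite[OF finC] unfolding d_def lessThan_atLeast0 by blast
  have bC: "b j \<in> C" if "j < d" for j using b that by (auto simp: bij_betw_def)
  \<comment> \<open>\<open>\<Phi>\<close> sends coordinates to vectors of \<open>U\<close>.
    Coordinates are functions on all natural numbers of which only the values below \<open>d\<close>
    count, so injectivity is a statement about those values.\<close>
  define \<Phi> where "\<Phi> x = (\<Sum>i<d. scale (x i) (b i))" for x :: "nat \<Rightarrow> complex"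
  have \<Phi>_cong: "\<Phi> x = \<Phi> y" if "\<And>i. i < d \<Longrightarrow> x i = y i" for x y
    unfolding \<Phi>_def using that by (intro sum.cong) auto
  have \<Phi>_U: "\<Phi> x \<in> U" for x
    unfolding \<Phi>_def using U(1) C(1) bC by (intro subspace_sum subspace_scale) auto
  have \<Phi>_add: "\<Phi> x + \<Phi> y = \<Phi> (\<lambda>i. x i + y i)" for x y
    by (simp add: \<Phi>_def scale_left_distrib sum.distrib)
  have \<Phi>_scale: "scale c (\<Phi> x) = \<Phi> (\<lambda>i. c * x i)" for c x
    by (simp add: \<Phi>_def scale_sum_right)
  have \<Phi>_0: "\<Phi> (\<lambda>_. 0) = 0" by (simp add: \<Phi>_def)
  have \<Phi>_unit: "\<Phi> (\<lambda>i. if i = j then 1 else 0) = b j" if "j < d" for j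
    using that by (simp add: \<Phi>_def if_distrib[of "\<lambda>c. scale c _"] cong: if_cong)
  have \<Phi>_kernel: "x i = 0" if "\<Phi> x = 0" "i < d" for x i
  proof -
    have "(\<Sum>v\<in>C. scale (x (the_inv_into {..<d} b v)) v) = \<Phi> x"
      unfolding \<Phi>_def using b
      by (intro sum.reindex_bij_betw[OF b, symmetric, THEN trans] sum.cong)
         (auto simp: the_inv_into_f_f bij_betw_def)
    then have "x (the_inv_into {..<d} b (b i)) = 0"
      using independentD[OF C(2) finC] that bC[OF that(2)] by auto
    then show ?thesis using b that by (simp add: the_inv_into_f_f bij_betw_def)
  qed
  have \<Phi>_inj: "x i = y i" if eq: "\<Phi> x = \<Phi> y" and i: "i < d" for x y i
  proof -
    have "\<Phi> (\<lambda>i. x i - y i) = \<Phi> x - \<Phi> y"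
      by (simp add: \<Phi>_def scale_left_diff_distrib sum_subtractf)
    then show ?thesis using \<Phi>_kernel[of "\<lambda>i. x i - y i" i] eq i by simp
  qed
  have \<Phi>_surj: "\<exists>x. u = \<Phi> x" if u: "u \<in> U" for u
  proof -
    obtain y where "u = (\<Sum>v\<in>C. scale (y v) v)"
      using u C(3) span_finite[OF finC] by auto
    also have "\<dots> = \<Phi> (\<lambda>i. y (b i))"
      unfolding \<Phi>_def by (rule sum.reindex_bij_betw[OF b, symmetric])
    finally show ?thesis by blast
  qed
  have L_0: "L g 0 = 0" for g using sc[of g 0 0] by simp
  have L_sum: "L g (\<Sum>i<n. h i) = (\<Sum>i<n. L g (h i))" for g h and n :: nat
    by (induction n) (auto simp: L_0 add)
  have "\<forall>g j. \<exists>x. g \<in> carrier G \<and> j < d \<longrightarrow> L g (b j) = \<Phi> x"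
    using \<Phi>_surj inv bC C(1) by blast
  then obtain R where R: "\<And>g j. g \<in> carrier G \<Longrightarrow> j < d \<Longrightarrow> L g (b j) = \<Phi> (R g j)"
    by metis
  define \<rho> where "\<rho> g = mat d d (\<lambda>(i, j). R g j i)" for g
  have L_\<Phi>: "L g (\<Phi> x) = \<Phi> (\<lambda>i. \<Sum>j<d. R g j i * x j)" if g: "g \<in> carrier G" for g x
  proof -
    have "L g (\<Phi> x) = (\<Sum>j<d. scale (x j) (\<Phi> (R g j)))"
      unfolding \<Phi>_def[of x] using g by (simp add: L_sum sc R)
    also have "\<dots> = (\<Sum>i<d. \<Sum>j<d. scale (R g j i * x j) (b i))"
      unfolding \<Phi>_scale unfolding \<Phi>_def by (subst sum.swap) (simp add: mult.commute)
    also have "\<dots> = \<Phi> (\<lambda>i. \<Sum>j<d. R g j i * x j)"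
      by (simp add: \<Phi>_def scale_sum_left)
    finally show ?thesis .
  qed
  have rep: "is_rep G (d, \<rho>)"
  proof (rule is_repI[OF G])
    show "\<rho> g \<in> carrier_mat d d" for g by (simp add: \<rho>_def)
    show "\<rho> \<one>\<^bsub>G\<^esub> = 1\<^sub>m d"
    proof (rule eq_matI)
      fix i j assume "i < dim_row (1\<^sub>m d :: complex mat)" "j < dim_col (1\<^sub>m d :: complex mat)"
      then have ij: "i < d" "j < d" by auto
      have "\<Phi> (R \<one>\<^bsub>G\<^esub> j) = \<Phi> (\<lambda>i. if i = j then 1 else 0)"
        using R[OF one_closed ij(2)] one bC[OF ij(2)] C(1) \<Phi>_unit[OF ij(2)] by auto
      from \<Phi>_inj[OF this ij(1)] show "\<rho> \<one>\<^bsub>G\<^esub> $$ (i, j) = 1\<^sub>m d $$ (i, j)"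
        using ij by (simp add: \<rho>_def)
    qed (simp_all add: \<rho>_def)
    fix g h assume g: "g \<in> carrier G" and h: "h \<in> carrier G"
    show "\<rho> (g \<otimes>\<^bsub>G\<^esub> h) = \<rho> g * \<rho> h"
    proof (rule eq_matI)
      fix i j assume "i < dim_row (\<rho> g * \<rho> h)" "j < dim_col (\<rho> g * \<rho> h)"
      then have ij: "i < d" "j < d" by (auto simp: \<rho>_def)
      have "\<Phi> (R (g \<otimes>\<^bsub>G\<^esub> h) j) = L g (L h (b j))"
        using R[of "g \<otimes>\<^bsub>G\<^esub> h" j] mult[OF g h, of "b j"] bC[OF ij(2)] C(1) g h ij by auto
      also have "\<dots> = \<Phi> (\<lambda>i. \<Sum>k<d. R g k i * R h j k)"
        by (simp add: R[OF h ij(2)] L_\<Phi>[OF g])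
      finally have "R (g \<otimes>\<^bsub>G\<^esub> h) j i = (\<Sum>k<d. R g k i * R h j k)"
        using \<Phi>_inj ij by blast
      also have "\<dots> = (\<rho> g * \<rho> h) $$ (i, j)"
        by (subst mat_mult_index[of _ d d _ d]) (use ij in \<open>simp_all add: \<rho>_def\<close>)
      finally show "\<rho> (g \<otimes>\<^bsub>G\<^esub> h) $$ (i, j) = (\<rho> g * \<rho> h) $$ (i, j)"
        using ij by (simp add: \<rho>_def)
    qed (simp_all add: \<rho>_def)
  qed
  have "0 < d"
  proof (rule ccontr)
    assume "\<not> 0 < d"
    then have "C = {}" using finC by (simp add: d_def)
    then show False using C(3) U subspace_0[OF U(1)] by auto
  qed
  have "V = {0\<^sub>v d} \<or> V = carrier_vec d" if V: "invariant_subspace G (d, \<rho>) V" for V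
  proof -
    \<comment> \<open>Pushed along the basis, an invariant subspace of the coordinate space becomes
      an invariant subspace of \<open>U\<close>, where minimality applies.\<close>
    define \<Psi> where "\<Psi> v = \<Phi> (\<lambda>i. v $ i)" for v :: "complex vec"
    have Vc: "V \<subseteq> carrier_vec d" and V0: "0\<^sub>v d \<in> V"
      and Vadd: "\<And>u v. u \<in> V \<Longrightarrow> v \<in> V \<Longrightarrow> u + v \<in> V"
      and Vsc: "\<And>c u. u \<in> V \<Longrightarrow> c \<cdot>\<^sub>v u \<in> V"
      and Vinv: "\<And>g u. g \<in> carrier G \<Longrightarrow> u \<in> V \<Longrightarrow> \<rho> g *\<^sub>v u \<in> V"
      using V by (auto simp: invariant_subspace_def subspace_vec_iff)
    have Vdim: "dim_vec v = d" if "v \<in> V" for v using that Vc by auto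
    have \<Psi>_inj: "u = v" if "\<Psi> u = \<Psi> v" "u \<in> carrier_vec d" "v \<in> carrier_vec d" for u v
      using that \<Phi>_inj unfolding \<Psi>_def by (intro eq_vecI) auto
    have \<Psi>_0: "\<Psi> (0\<^sub>v d) = 0" unfolding \<Psi>_def \<Phi>_0[symmetric] by (rule \<Phi>_cong) simp
    have "subspace (\<Psi> ` V)"
    proof (rule subspaceI)
      show "0 \<in> \<Psi> ` V" using V0 \<Psi>_0 by (metis imageI)
      fix x assume "x \<in> \<Psi> ` V"
      then obtain u where u: "u \<in> V" "x = \<Psi> u" by blast
      show "scale c x \<in> \<Psi> ` V" for c
      proof -
        have "scale c x = \<Psi> (c \<cdot>\<^sub>v u)"
          unfolding u(2) \<Psi>_def \<Phi>_scale by (rule \<Phi>_cong) (use u Vdim in simp)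
        then show ?thesis using Vsc[OF u(1)] by blast
      qed
      fix y assume "y \<in> \<Psi> ` V"
      then obtain v where v: "v \<in> V" "y = \<Psi> v" by blast
      have "x + y = \<Psi> (u + v)"
        unfolding u(2) v(2) \<Psi>_def \<Phi>_add by (rule \<Phi>_cong) (use u v Vdim in simp)
      then show "x + y \<in> \<Psi> ` V" using Vadd[OF u(1) v(1)] by blast
    qed
    moreover have "\<Psi> ` V \<subseteq> U" unfolding \<Psi>_def using \<Phi>_U by blast
    moreover have "\<forall>g\<in>carrier G. \<forall>x\<in>\<Psi> ` V. L g x \<in> \<Psi> ` V"
    proof clarify
      fix g v assume g: "g \<in> carrier G" and v: "v \<in> V"
      have "L g (\<Psi> v) = \<Psi> (\<rho> g *\<^sub>v v)"
        unfolding \<Psi>_def L_\<Phi>[OF g] by (rule \<Phi>_cong)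
          (use v Vdim in \<open>simp add: \<rho>_def scalar_prod_def lessThan_atLeast0\<close>)
      then show "L g (\<Psi> v) \<in> \<Psi> ` V" using Vinv[OF g v] by blast
    qed
    ultimately have "\<Psi> ` V = {0} \<or> \<Psi> ` V = U" using minimal by blast
    then show ?thesis
    proof
      assume eq: "\<Psi> ` V = {0}"
      have "v = 0\<^sub>v d" if "v \<in> V" for v
        using \<Psi>_inj[of v "0\<^sub>v d"] \<Psi>_0 eq that Vc by auto
      then show ?thesis using V0 by blast
    next
      assume eq: "\<Psi> ` V = U"
      have "w \<in> V" if w: "w \<in> carrier_vec d" for w
      proof -
        have "\<Psi> w \<in> \<Psi> ` V" unfolding eq unfolding \<Psi>_def by (rule \<Phi>_U)
        then obtain v where "v \<in> V" "\<Psi> w = \<Psi> v" by blast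
        then show ?thesis using \<Psi>_inj[of w v] w Vc by blast
      qed
      then show ?thesis using Vc by blast
    qed
  qed
  then have "irreducible_rep G (d, \<rho>)" using rep \<open>0 < d\<close> by (simp add: irreducible_rep_def)
  moreover have "\<forall>j<d. b j \<in> U" using bC C(1) by blast
  moreover have "\<forall>j<d. b j \<noteq> 0"
    using bC C(2) dependent_zero by metis
  moreover have "\<forall>g\<in>carrier G. \<forall>j<d. L g (b j) = (\<Sum>i<d. scale (\<rho> g $$ (i, j)) (b i))"
    using R by (simp add: \<Phi>_def \<rho>_def)
  ultimately show thesis by (rule that)
qed

lemma (in group) sum_right_translate:
  assumes "h \<in> carrier G"
  shows "(\<Sum>g\<in>carrier G. F (g \<otimes> h)) = (\<Sum>g\<in>carrier G. F g)"
  by (rule sum.reindex_bij_witness[of _ "\<lambda>g. g \<otimes> inv h" "\<lambda>g. g \<otimes> h"])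
     (use assms in \<open>auto simp: m_assoc\<close>)

lemma (in group) sum_inv_translate:
  assumes "h \<in> carrier G"
  shows "(\<Sum>g\<in>carrier G. F (h \<otimes> inv g)) = (\<Sum>g\<in>carrier G. F g)"
proof -
  have "h \<otimes> (inv h \<otimes> g) = g" if "g \<in> carrier G" for g
    using assms that by (simp flip: m_assoc)
  then show ?thesis
    by (intro sum.reindex_bij_witness[of _ "\<lambda>g. inv g \<otimes> h" "\<lambda>g. h \<otimes> inv g"])
       (use assms in \<open>auto simp: m_assoc inv_mult_group\<close>)
qed

text \<open>The sum of \<open>f g\<close> times \<open>\<rho> g\<close> commutes with the
  representation because \<open>f\<close> is a class function, so it is a scalar matrix. Its trace
  is the pairing of \<open>f\<close> with the character, hence the scalar is 0.\<close>

lemma class_function_scalar: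
  assumes G: "group G" and irr: "irreducible_rep G (d, \<rho>)"
    and cf: "\<And>g h. g \<in> carrier G \<Longrightarrow> h \<in> carrier G \<Longrightarrow> f (h \<otimes>\<^bsub>G\<^esub> g) = f (g \<otimes>\<^bsub>G\<^esub> h)"
    and orth: "(\<Sum>g\<in>carrier G. f g * mat_trace (\<rho> g)) = 0"
    and ij: "i < d" "j < d"
  shows "(\<Sum>g\<in>carrier G. f g * \<rho> g $$ (i, j)) = 0"
proof -
  interpret group G by (rule G)
  have rep: "is_rep G (d, \<rho>)" and d: "0 < d" using irr by (auto simp: irreducible_rep_def)
  note \<rho>c = is_rep_carrier[OF G rep]
  define M where "M = mat d d (\<lambda>(i, j). \<Sum>g\<in>carrier G. f g * \<rho> g $$ (i, j))"
  have M: "M \<in> carrier_mat d d" by (simp add: M_def)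
  have "M * \<rho> h = \<rho> h * M" if h: "h \<in> carrier G" for h
  proof (rule eq_matI)
    fix i j assume "i < dim_row (\<rho> h * M)" "j < dim_col (\<rho> h * M)"
    then have ij: "i < d" "j < d" using \<rho>c[OF h] M by auto
    have "(M * \<rho> h) $$ (i, j) = (\<Sum>m<d. (\<Sum>g\<in>carrier G. f g * \<rho> g $$ (i, m)) * \<rho> h $$ (m, j))"
      by (subst mat_mult_index[OF M \<rho>c[OF h] ij]) (simp add: M_def ij)
    also have "\<dots> = (\<Sum>g\<in>carrier G. f g * (\<Sum>m<d. \<rho> g $$ (i, m) * \<rho> h $$ (m, j)))"
      by (simp add: sum_distrib_left sum_distrib_right mult.assoc) (rule sum.swap)
    \<comment> \<open>Invariance of \<open>f\<close> writes \<open>f g\<close> as its value at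
      \<open>inv h\<close> times \<open>g h\<close>, so the whole summand depends on
      \<open>g h\<close> alone and the sum can be translated.\<close>
    also have "\<dots> = (\<Sum>g\<in>carrier G. f (inv\<^bsub>G\<^esub> h \<otimes>\<^bsub>G\<^esub> (g \<otimes>\<^bsub>G\<^esub> h)) * \<rho> (g \<otimes>\<^bsub>G\<^esub> h) $$ (i, j))"
    proof (intro sum.cong refl)
      fix g assume g: "g \<in> carrier G"
      have "f (inv\<^bsub>G\<^esub> h \<otimes>\<^bsub>G\<^esub> (g \<otimes>\<^bsub>G\<^esub> h)) = f (g \<otimes>\<^bsub>G\<^esub> h \<otimes>\<^bsub>G\<^esub> inv\<^bsub>G\<^esub> h)"
        using cf[of "g \<otimes>\<^bsub>G\<^esub> h" "inv\<^bsub>G\<^esub> h"] g h by simp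
      also have "g \<otimes>\<^bsub>G\<^esub> h \<otimes>\<^bsub>G\<^esub> inv\<^bsub>G\<^esub> h = g" using g h by (simp add: m_assoc)
      finally show "f g * (\<Sum>m<d. \<rho> g $$ (i, m) * \<rho> h $$ (m, j)) =
          f (inv\<^bsub>G\<^esub> h \<otimes>\<^bsub>G\<^esub> (g \<otimes>\<^bsub>G\<^esub> h)) * \<rho> (g \<otimes>\<^bsub>G\<^esub> h) $$ (i, j)"
        using mat_mult_index[OF \<rho>c[OF g] \<rho>c[OF h] ij] is_rep_mult[OF G rep g h] by simp
    qed
    also have "\<dots> = (\<Sum>g\<in>carrier G. f (inv\<^bsub>G\<^esub> h \<otimes>\<^bsub>G\<^esub> g) * \<rho> g $$ (i, j))"
      by (rule sum_right_translate[OF h])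
    also have "\<dots> = (\<Sum>g\<in>carrier G. f (inv\<^bsub>G\<^esub> h \<otimes>\<^bsub>G\<^esub> (h \<otimes>\<^bsub>G\<^esub> g)) * \<rho> (h \<otimes>\<^bsub>G\<^esub> g) $$ (i, j))"
      by (rule sum_left_translate[OF h, symmetric])
    also have "\<dots> = (\<Sum>g\<in>carrier G. f g * (\<Sum>m<d. \<rho> h $$ (i, m) * \<rho> g $$ (m, j)))"
    proof (intro sum.cong refl)
      fix g assume g: "g \<in> carrier G"
      have "inv\<^bsub>G\<^esub> h \<otimes>\<^bsub>G\<^esub> (h \<otimes>\<^bsub>G\<^esub> g) = g" using g h by (simp flip: m_assoc)
      then show "f (inv\<^bsub>G\<^esub> h \<otimes>\<^bsub>G\<^esub> (h \<otimes>\<^bsub>G\<^esub> g)) * \<rho> (h \<otimes>\<^bsub>G\<^esub> g) $$ (i, j) =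
          f g * (\<Sum>m<d. \<rho> h $$ (i, m) * \<rho> g $$ (m, j))"
        using mat_mult_index[OF \<rho>c[OF h] \<rho>c[OF g] ij] is_rep_mult[OF G rep h g] by simp
    qed
    also have "\<dots> = (\<Sum>m<d. \<rho> h $$ (i, m) * (\<Sum>g\<in>carrier G. f g * \<rho> g $$ (m, j)))"
      by (simp add: sum_distrib_left mult.left_commute) (rule sum.swap)
    also have "\<dots> = (\<rho> h * M) $$ (i, j)"
      by (subst mat_mult_index[OF \<rho>c[OF h] M ij]) (simp add: M_def ij)
    finally show "(M * \<rho> h) $$ (i, j) = (\<rho> h * M) $$ (i, j)" .
  qed (use \<rho>c[OF h] M in auto)
  then obtain c where c: "M = c \<cdot>\<^sub>m 1\<^sub>m d" using schur_scalar[OF G irr M] by blast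
  have "of_nat d * c = (\<Sum>m<d. M $$ (m, m))" by (simp add: c)
  also have "\<dots> = (\<Sum>g\<in>carrier G. \<Sum>m<d. f g * \<rho> g $$ (m, m))"
    by (simp add: M_def) (rule sum.swap)
  also have "\<dots> = (\<Sum>g\<in>carrier G. f g * mat_trace (\<rho> g))"
    by (intro sum.cong refl)
      (use carrier_matD(1)[OF \<rho>c] in \<open>simp add: mat_trace_def sum_distrib_left\<close>)
  finally have "c = 0" using orth d by simp
  then have "M $$ (i, j) = 0" using ij by (simp add: c)
  then show ?thesis using ij by (simp add: M_def)
qed

lemma vector_space_fun: "vector_space (\<lambda>(c :: 'k :: field) (w :: 'a \<Rightarrow> 'k) x. c * w x)"
  by unfold_locales (auto simp: fun_eq_iff algebra_simps)

lemma sum_fun_apply: "(\<Sum>i\<in>I. h i) x = (\<Sum>i\<in>I. h i x)" for h :: "'i \<Rightarrow> 'a \<Rightarrow> 'b :: comm_monoid_add"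
  by (induction I rule: infinite_finite_induct) auto

text \<open>In the regular representation, convolution by \<open>f\<close> is the sum of
  \<open>f g\<close> times translation by \<open>g\<close>; by \<open>class_function_scalar\<close>
  it vanishes on irreducible subspaces once all pairings vanish. The contradiction arises on a
  minimal invariant subspace of the range.\<close>

lemma class_function_character_nonzero:
  fixes f :: "'a \<Rightarrow> complex" and G :: "('a, 'b) monoid_scheme"
  assumes G: "group G" and fin: "finite (carrier G)"
    and cf: "\<And>g h. g \<in> carrier G \<Longrightarrow> h \<in> carrier G \<Longrightarrow> f (h \<otimes>\<^bsub>G\<^esub> g) = f (g \<otimes>\<^bsub>G\<^esub> h)"
    and nz: "x0 \<in> carrier G" "f x0 \<noteq> 0"
  obtains d \<rho> where "irreducible_rep G (d, \<rho>)"
    "(\<Sum>g\<in>carrier G. f g * mat_trace (\<rho> g)) \<noteq> 0"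
proof (rule ccontr)
  note result = that
  assume no: "\<not> thesis"
  have orth: "(\<Sum>g\<in>carrier G. f g * mat_trace (\<rho> g)) = 0"
    if "irreducible_rep G (d, \<rho>)" for d \<rho>
    using result[OF that] no by blast
  interpret group G by (rule G)
  let ?C = "carrier G"
  define sc where "sc = (\<lambda>(c :: complex) (w :: 'a \<Rightarrow> complex) x. c * w x)"
  have vs: "vector_space sc" unfolding sc_def by (rule vector_space_fun)
  interpret V: vector_space sc by (rule vs)
  \<comment> \<open>Functions live on the whole type, so all operators cut off outside the carrier.
    \<open>S\<close> collects the functions that vanish there, and equality of its members is
    checked on the carrier.\<close>
  define L where "L g w = (\<lambda>x. if x \<in> ?C then w (inv\<^bsub>G\<^esub> g \<otimes>\<^bsub>G\<^esub> x) else 0)" for g and w :: "'a \<Rightarrow> complex"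
  define A where "A w = (\<lambda>x. if x \<in> ?C then \<Sum>k\<in>?C. f (x \<otimes>\<^bsub>G\<^esub> inv\<^bsub>G\<^esub> k) * w k else 0)" for w
  define A' where "A' w = (\<lambda>x. if x \<in> ?C then \<Sum>k\<in>?C. cnj (f (k \<otimes>\<^bsub>G\<^esub> inv\<^bsub>G\<^esub> x)) * w k else 0)" for w
  define S where "S = {w :: 'a \<Rightarrow> complex. \<forall>x. x \<notin> ?C \<longrightarrow> w x = 0}"
  define ip where "ip v w = (\<Sum>x\<in>?C. v x * cnj (w x))" for v w
  have A_S: "A w \<in> S" and A'_S: "A' w \<in> S" and L_S: "L g w \<in> S" for g w
    by (simp_all add: S_def A_def A'_def L_def)
  have S_eqI: "u = v" if "u \<in> S" "v \<in> S" "\<And>x. x \<in> ?C \<Longrightarrow> u x = v x" for u v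
  proof (rule ext)
    show "u x = v x" for x using that by (cases "x \<in> ?C") (simp_all add: S_def)
  qed
  have A_add: "A (u + v) = A u + A v" for u v
    by (auto simp: A_def fun_eq_iff algebra_simps sum.distrib)
  have A_sc: "A (sc c u) = sc c (A u)" for c u
    by (auto simp: A_def sc_def fun_eq_iff sum_distrib_left mult.left_commute)
  have L_add: "L g (u + v) = L g u + L g v" for g u v
    by (auto simp: L_def fun_eq_iff)
  have L_sc: "L g (sc c u) = sc c (L g u)" for g c u
    by (auto simp: L_def sc_def fun_eq_iff)
  \<comment> \<open>Convolution commutes with translation since, in the argument of a class
    function, the factor \<open>inv g\<close> may move from the right end to the left.\<close>
  have LA: "L g (A w) = A (L g w)" if g: "g \<in> ?C" for g w
  proof (rule S_eqI[OF L_S A_S])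
    fix x assume x: "x \<in> ?C"
    have "A (L g w) x = (\<Sum>k\<in>?C. f (x \<otimes>\<^bsub>G\<^esub> inv\<^bsub>G\<^esub> k) * w (inv\<^bsub>G\<^esub> g \<otimes>\<^bsub>G\<^esub> k))"
      using x by (simp add: A_def L_def)
    also have "\<dots> = (\<Sum>k\<in>?C. f (x \<otimes>\<^bsub>G\<^esub> inv\<^bsub>G\<^esub> (g \<otimes>\<^bsub>G\<^esub> k)) * w (inv\<^bsub>G\<^esub> g \<otimes>\<^bsub>G\<^esub> (g \<otimes>\<^bsub>G\<^esub> k)))"
      by (rule sum_left_translate[OF g, symmetric])
    also have "\<dots> = (\<Sum>k\<in>?C. f (inv\<^bsub>G\<^esub> g \<otimes>\<^bsub>G\<^esub> x \<otimes>\<^bsub>G\<^esub> inv\<^bsub>G\<^esub> k) * w k)"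
    proof (intro sum.cong refl)
      fix k assume k: "k \<in> ?C"
      have "f (x \<otimes>\<^bsub>G\<^esub> inv\<^bsub>G\<^esub> (g \<otimes>\<^bsub>G\<^esub> k)) = f (x \<otimes>\<^bsub>G\<^esub> inv\<^bsub>G\<^esub> k \<otimes>\<^bsub>G\<^esub> inv\<^bsub>G\<^esub> g)"
        using g k x by (simp add: inv_mult_group m_assoc)
      also have "\<dots> = f (inv\<^bsub>G\<^esub> g \<otimes>\<^bsub>G\<^esub> (x \<otimes>\<^bsub>G\<^esub> inv\<^bsub>G\<^esub> k))"
        using g k x by (intro cf) auto
      also have "\<dots> = f (inv\<^bsub>G\<^esub> g \<otimes>\<^bsub>G\<^esub> x \<otimes>\<^bsub>G\<^esub> inv\<^bsub>G\<^esub> k)"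
        using g k x by (simp add: m_assoc)
      finally show "f (x \<otimes>\<^bsub>G\<^esub> inv\<^bsub>G\<^esub> (g \<otimes>\<^bsub>G\<^esub> k)) * w (inv\<^bsub>G\<^esub> g \<otimes>\<^bsub>G\<^esub> (g \<otimes>\<^bsub>G\<^esub> k)) =
          f (inv\<^bsub>G\<^esub> g \<otimes>\<^bsub>G\<^esub> x \<otimes>\<^bsub>G\<^esub> inv\<^bsub>G\<^esub> k) * w k"
        using g k by (simp add: m_assoc[symmetric])
    qed
    also have "\<dots> = L g (A w) x" using x g by (simp add: L_def A_def)
    finally show "L g (A w) x = A (L g w) x" ..
  qed
  have adj: "ip (A u) v = ip u (A' v)" for u v
    unfolding ip_def A_def A'_def
    by (simp add: sum_distrib_left sum_distrib_right mult_ac) (rule sum.swap)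
  have adj': "ip (A' u) v = ip u (A v)" for u v
    unfolding ip_def A_def A'_def
    by (simp add: sum_distrib_left sum_distrib_right mult_ac) (rule sum.swap)
  \<comment> \<open>\<open>A'\<close> is the adjoint of \<open>A\<close> for the standard inner product \<open>ip\<close>\<close>
  have normal: "A (A' w) = A' (A w)" for w
  proof (rule S_eqI[OF A_S A'_S])
    fix x assume x: "x \<in> ?C"
    have "A (A' w) x = (\<Sum>m\<in>?C. (\<Sum>k\<in>?C. f (x \<otimes>\<^bsub>G\<^esub> inv\<^bsub>G\<^esub> k) * cnj (f (m \<otimes>\<^bsub>G\<^esub> inv\<^bsub>G\<^esub> k))) * w m)"
      using x by (simp add: A_def A'_def sum_distrib_left sum_distrib_right mult.assoc)
        (rule sum.swap)
    also have "\<dots> = (\<Sum>m\<in>?C. (\<Sum>k\<in>?C. cnj (f (k \<otimes>\<^bsub>G\<^esub> inv\<^bsub>G\<^esub> x)) * f (k \<otimes>\<^bsub>G\<^esub> inv\<^bsub>G\<^esub> m)) * w m)"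
    proof (intro sum.cong refl)
      fix m assume m: "m \<in> ?C"
      \<comment> \<open>The kernels of the two products are matched by substituting the product of
        \<open>x\<close>, \<open>inv k\<close> and \<open>m\<close> for the summation variable; the
        class function property brings the arguments into the required form.\<close>
      let ?F = "\<lambda>k. cnj (f (k \<otimes>\<^bsub>G\<^esub> inv\<^bsub>G\<^esub> x)) * f (k \<otimes>\<^bsub>G\<^esub> inv\<^bsub>G\<^esub> m)"
      have "(\<Sum>k\<in>?C. f (x \<otimes>\<^bsub>G\<^esub> inv\<^bsub>G\<^esub> k) * cnj (f (m \<otimes>\<^bsub>G\<^esub> inv\<^bsub>G\<^esub> k))) =
          (\<Sum>k\<in>?C. ?F (x \<otimes>\<^bsub>G\<^esub> inv\<^bsub>G\<^esub> k \<otimes>\<^bsub>G\<^esub> m))"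
      proof (intro sum.cong refl)
        fix k assume k: "k \<in> ?C"
        have "f (x \<otimes>\<^bsub>G\<^esub> inv\<^bsub>G\<^esub> k \<otimes>\<^bsub>G\<^esub> m \<otimes>\<^bsub>G\<^esub> inv\<^bsub>G\<^esub> x) = f (inv\<^bsub>G\<^esub> x \<otimes>\<^bsub>G\<^esub> (x \<otimes>\<^bsub>G\<^esub> inv\<^bsub>G\<^esub> k \<otimes>\<^bsub>G\<^esub> m))"
          using x k m by (intro cf) auto
        also have "inv\<^bsub>G\<^esub> x \<otimes>\<^bsub>G\<^esub> (x \<otimes>\<^bsub>G\<^esub> inv\<^bsub>G\<^esub> k \<otimes>\<^bsub>G\<^esub> m) = inv\<^bsub>G\<^esub> k \<otimes>\<^bsub>G\<^esub> m"
          using x k m by (simp add: m_assoc[symmetric])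
        also have "f (inv\<^bsub>G\<^esub> k \<otimes>\<^bsub>G\<^esub> m) = f (m \<otimes>\<^bsub>G\<^esub> inv\<^bsub>G\<^esub> k)" using k m by (intro cf) auto
        finally have 1: "f (x \<otimes>\<^bsub>G\<^esub> inv\<^bsub>G\<^esub> k \<otimes>\<^bsub>G\<^esub> m \<otimes>\<^bsub>G\<^esub> inv\<^bsub>G\<^esub> x) = f (m \<otimes>\<^bsub>G\<^esub> inv\<^bsub>G\<^esub> k)" .
        have 2: "x \<otimes>\<^bsub>G\<^esub> inv\<^bsub>G\<^esub> k \<otimes>\<^bsub>G\<^esub> m \<otimes>\<^bsub>G\<^esub> inv\<^bsub>G\<^esub> m = x \<otimes>\<^bsub>G\<^esub> inv\<^bsub>G\<^esub> k"
          using x k m by (simp add: m_assoc)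
        show "f (x \<otimes>\<^bsub>G\<^esub> inv\<^bsub>G\<^esub> k) * cnj (f (m \<otimes>\<^bsub>G\<^esub> inv\<^bsub>G\<^esub> k)) = ?F (x \<otimes>\<^bsub>G\<^esub> inv\<^bsub>G\<^esub> k \<otimes>\<^bsub>G\<^esub> m)"
          by (simp only: 1 2 mult.commute)
      qed
      also have "\<dots> = (\<Sum>k\<in>?C. ?F (k \<otimes>\<^bsub>G\<^esub> m))"
        by (rule sum_inv_translate[OF x])
      also have "\<dots> = (\<Sum>k\<in>?C. ?F k)" by (rule sum_right_translate[OF m])
      finally show "(\<Sum>k\<in>?C. f (x \<otimes>\<^bsub>G\<^esub> inv\<^bsub>G\<^esub> k) * cnj (f (m \<otimes>\<^bsub>G\<^esub> inv\<^bsub>G\<^esub> k))) * w m =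
          (\<Sum>k\<in>?C. ?F k) * w m"
        by (rule arg_cong)
    qed
    also have "\<dots> = A' (A w) x"
      using x by (simp add: A_def A'_def sum_distrib_left sum_distrib_right mult.assoc)
        (rule sum.swap)
    finally show "A (A' w) x = A' (A w) x" .
  qed
  have ip_zero: "v = 0" if "ip v v = 0" "v \<in> S" for v
  proof -
    have "ip v v = of_real (\<Sum>x\<in>?C. (cmod (v x))\<^sup>2)"
      by (simp add: ip_def complex_norm_square del: of_real_power)
    then have "(\<Sum>x\<in>?C. (cmod (v x))\<^sup>2) = 0" using that(1) by (metis of_real_eq_0_iff)
    then have "\<forall>x\<in>?C. v x = 0" using fin by (subst (asm) sum_nonneg_eq_0_iff) auto
    then show ?thesis using that(2) by (auto simp: S_def fun_eq_iff)
  qed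
  \<comment> \<open>If \<open>u\<close> is in the range and \<open>A u = 0\<close>, normality gives
    \<open>ip (A' u) (A' u) = ip (A' (A u)) u = 0\<close>, hence \<open>A' u = 0\<close>. Then
    \<open>ip u u = ip (A w) u = ip w (A' u) = 0\<close>.\<close>
  have kernel: "u = 0" if "u = A w" "A u = 0" for u w
  proof -
    have uS: "u \<in> S" using that(1) A_S by simp
    have ip0: "ip 0 v = 0" for v by (simp add: ip_def)
    have "A' 0 = 0" by (simp add: A'_def fun_eq_iff)
    then have "ip (A' u) (A' u) = 0"
      using adj[of "A' u" u] normal[of u] that(2) by (simp add: ip0)
    then have "A' u = 0" by (rule ip_zero[OF _ A'_S])
    then have "ip (A w) u = 0" by (simp add: adj) (simp add: ip_def)
    then show ?thesis using ip_zero[OF _ uS] that(1) by simp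
  qed
  \<comment> \<open>The point masses provide the finite spanning set that the minimality argument
    requires. Moreover \<open>A\<close> maps the mass at the identity to \<open>f\<close> on the
    carrier, so its range is nonzero.\<close>
  define \<delta> where "\<delta> a = (\<lambda>x. if x = a then 1 else 0 :: complex)" for a :: 'a
  have S_span: "S \<subseteq> V.span (\<delta> ` ?C)"
  proof
    fix w assume w: "w \<in> S"
    have "w = (\<Sum>a\<in>?C. sc (w a) (\<delta> a))"
      using w fin by (auto simp: sum_fun_apply fun_eq_iff S_def sc_def \<delta>_def if_distrib cong: if_cong)
    also have "\<dots> \<in> V.span (\<delta> ` ?C)"
      by (intro V.span_sum V.span_scale V.span_base) auto
    finally show "w \<in> V.span (\<delta> ` ?C)" .
  qed
  let ?W = "range A" and ?P = "\<lambda>U. \<forall>g\<in>?C. \<forall>u\<in>U. L g u \<in> U"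
  have subW: "V.subspace ?W"
  proof (rule V.subspaceI)
    show "0 \<in> ?W" by (rule image_eqI[of _ _ 0]) (auto simp: A_def fun_eq_iff)
    show "x + y \<in> ?W" if "x \<in> ?W" "y \<in> ?W" for x y using that by (auto simp flip: A_add)
    show "sc c x \<in> ?W" if "x \<in> ?W" for c x using that by (auto simp flip: A_sc)
  qed
  have spanW: "?W \<subseteq> V.span (\<delta> ` ?C)" using A_S S_span by blast
  have invW: "?P ?W" using LA by auto
  have "A (\<delta> \<one>\<^bsub>G\<^esub>) x0 = f x0"
    using nz(1) fin by (simp add: A_def \<delta>_def if_distrib cong: if_cong)
  then have neW: "?W \<noteq> {0}" using nz(2) by (metis rangeI singletonD zero_fun_apply)
  obtain U where U: "V.subspace U" "U \<subseteq> ?W" "?P U" "U \<noteq> {0}"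
    "\<forall>V. V.subspace V \<longrightarrow> V \<subseteq> U \<longrightarrow> ?P V \<longrightarrow> V \<noteq> {0} \<longrightarrow> V = U"
    by (rule V.exists_minimal_subspace[OF finite_imageI[OF fin] subW spanW, of ?P, OF invW neW])
  have US: "U \<subseteq> S" using U(2) A_S by blast
  have spanU: "U \<subseteq> V.span (\<delta> ` ?C)" using US S_span by blast
  have LU: "L g u \<in> U" if "g \<in> ?C" "u \<in> U" for g u using that U(3) by simp
  have L_one: "L \<one>\<^bsub>G\<^esub> u = u" if "u \<in> U" for u
    by (rule S_eqI[OF L_S]) (use that US in \<open>auto simp: L_def\<close>)
  have L_mult: "L (g \<otimes>\<^bsub>G\<^esub> h) u = L g (L h u)" 
    if "g \<in> ?C" "h \<in> ?C" "u \<in> U" for g h u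
    using that by (auto simp: L_def fun_eq_iff inv_mult_group m_assoc)
  obtain d \<rho> b where irr: "irreducible_rep G (d, \<rho>)"
    and bU: "\<forall>j<d. b j \<in> U" and b0: "\<forall>j<d. b j \<noteq> 0"
    and Lb: "\<forall>g\<in>?C. \<forall>j<d. L g (b j) = (\<Sum>i<d. sc (\<rho> g $$ (i, j)) (b i))"
    by (rule irreducible_rep_of_minimal_subspace[OF vs G U(1,4) finite_imageI[OF fin] spanU LU
          L_add L_sc L_one L_mult U(5)])
  have d: "0 < d" using irr by (simp add: irreducible_rep_def)
  have "A (b 0) = 0"
  proof (rule S_eqI[OF A_S])
    show "0 \<in> S" by (simp add: S_def)
    fix x assume x: "x \<in> ?C"
    \<comment> \<open>Writing \<open>b 0 k\<close> as the value at \<open>x\<close> of a translate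
      of \<open>b 0\<close> exhibits \<open>A\<close> as the sum of \<open>f g\<close> times
      \<open>L g\<close>. On the basis this becomes column 0 of the matrix sum that
      \<open>class_function_scalar\<close> shows to be zero.\<close>
    have "A (b 0) x = (\<Sum>k\<in>?C. f (x \<otimes>\<^bsub>G\<^esub> inv\<^bsub>G\<^esub> k) * L (x \<otimes>\<^bsub>G\<^esub> inv\<^bsub>G\<^esub> k) (b 0) x)"
      using x by (simp add: A_def L_def inv_mult_group m_assoc)
    also have "\<dots> = (\<Sum>g\<in>?C. f g * L g (b 0) x)"
      by (rule sum_inv_translate[OF x])
    also have "\<dots> = (\<Sum>g\<in>?C. \<Sum>i<d. f g * \<rho> g $$ (i, 0) * b i x)"
      by (intro sum.cong refl)
        (simp add: Lb d sum_fun_apply sc_def sum_distrib_left mult.assoc)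
    also have "\<dots> = (\<Sum>i<d. (\<Sum>g\<in>?C. f g * \<rho> g $$ (i, 0)) * b i x)"
      by (subst sum.swap) (simp add: sum_distrib_right)
    also have "\<dots> = 0"
      using class_function_scalar[OF G irr cf orth[OF irr] _ d] by simp
    finally show "A (b 0) x = 0 x" by simp
  qed
  moreover obtain w where "b 0 = A w" using bU d U(2) by blast
  ultimately show False using kernel b0 d by blast
qed

section \<open>As many irreducible representations as conjugacy classes\<close>

lemma equiv_irreps:
  assumes G: "group G"
  shows "equiv {R. irreducible_rep G R}
    {(R, S). irreducible_rep G R \<and> irreducible_rep G S \<and> equivalent_reps G R S}"
proof (rule equivI)
  have carr: "snd R g \<in> carrier_mat (fst R) (fst R)"
    if "irreducible_rep G R" "g \<in> carrier G" for R g
    using that is_rep_carrier[OF G, of "fst R" "snd R"]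
    by (cases R) (auto simp: irreducible_rep_def)
  have "equivalent_reps G R R" if "irreducible_rep G R" for R
  proof -
    obtain d \<rho> where R: "R = (d, \<rho>)" by (cases R)
    have "1\<^sub>m d \<in> carrier (general_linear d)" by (auto simp: carrier_general_linear)
    moreover have "1\<^sub>m d * \<rho> g = \<rho> g * 1\<^sub>m d" if "g \<in> carrier G" for g
      using carr[OF \<open>irreducible_rep G R\<close> that] by (simp add: R)
    ultimately show ?thesis by (auto simp: R equivalent_reps_def)
  qed
  then show "refl_on {R. irreducible_rep G R}
      {(R, S). irreducible_rep G R \<and> irreducible_rep G S \<and> equivalent_reps G R S}"
    by (auto simp: refl_on_def)
  have sym: "equivalent_reps G S R"
    if irr: "irreducible_rep G R" "irreducible_rep G S" and eq: "equivalent_reps G R S" for R S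
  proof -
    obtain d \<rho> \<sigma> where RS: "R = (d, \<rho>)" "S = (d, \<sigma>)"
      using eq by (cases R; cases S) (auto simp: equivalent_reps_def)
    obtain T B where T: "T \<in> carrier_mat d d" and B: "B \<in> carrier_mat d d"
      and BT: "B * T = 1\<^sub>m d" "T * B = 1\<^sub>m d" and comm: "\<And>g. g \<in> carrier G \<Longrightarrow> T * \<rho> g = \<sigma> g * T"
      using eq by (auto simp: RS equivalent_reps_def carrier_general_linear)
    have "B * \<sigma> g = \<rho> g * B" if g: "g \<in> carrier G" for g
    proof -
      have \<rho>: "\<rho> g \<in> carrier_mat d d" and \<sigma>: "\<sigma> g \<in> carrier_mat d d"
        using carr[OF irr(1) g] carr[OF irr(2) g] by (auto simp: RS)
      have eq: "\<sigma> g = \<sigma> g * T * B" using assoc_mult_mat[OF \<sigma> T B] BT \<sigma> by simp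
      have "B * \<sigma> g = B * (T * \<rho> g * B)"
        unfolding comm[OF g] by (rule arg_cong[OF eq])
      also have "\<dots> = B * (T * \<rho> g) * B"
        using assoc_mult_mat[OF B mult_carrier_mat[OF T \<rho>] B] by simp
      also have "B * (T * \<rho> g) = \<rho> g"
        using assoc_mult_mat[OF B T \<rho>] BT \<rho> by simp
      finally show ?thesis .
    qed
    moreover have "B \<in> carrier (general_linear d)"
      using T B BT by (auto simp: carrier_general_linear)
    ultimately show ?thesis by (auto simp: RS equivalent_reps_def)
  qed
  then show "sym {(R, S). irreducible_rep G R \<and> irreducible_rep G S \<and> equivalent_reps G R S}"
    by (auto simp: sym_def)
  have trans: "equivalent_reps G R Q"
    if irr: "irreducible_rep G R" "irreducible_rep G S" "irreducible_rep G Q"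
      and eq: "equivalent_reps G R S" "equivalent_reps G S Q" for R S Q
  proof -
    obtain d \<rho> where R: "R = (d, \<rho>)" by (cases R)
    obtain \<sigma> where S: "S = (d, \<sigma>)" using eq(1) by (cases S) (simp add: R equivalent_reps_def)
    obtain \<tau> where Q: "Q = (d, \<tau>)" using eq(2) by (cases Q) (simp add: S equivalent_reps_def)
    note RS = R S Q
    obtain T where T: "T \<in> carrier (general_linear d)"
      and comm: "\<And>g. g \<in> carrier G \<Longrightarrow> T * \<rho> g = \<sigma> g * T"
      using eq(1) by (auto simp: RS equivalent_reps_def)
    obtain T' where T': "T' \<in> carrier (general_linear d)"
      and comm': "\<And>g. g \<in> carrier G \<Longrightarrow> T' * \<sigma> g = \<tau> g * T'"
      using eq(2) by (auto simp: RS equivalent_reps_def)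
    have TT: "T' * T \<in> carrier (general_linear d)"
      using monoid.m_closed[OF group.is_monoid[OF group_general_linear] T' T] by simp
    have Tc: "T \<in> carrier_mat d d" "T' \<in> carrier_mat d d"
      using T T' by (auto simp: carrier_general_linear)
    have "T' * T * \<rho> g = \<tau> g * (T' * T)" if g: "g \<in> carrier G" for g
    proof -
      have c: "\<rho> g \<in> carrier_mat d d" "\<sigma> g \<in> carrier_mat d d" "\<tau> g \<in> carrier_mat d d"
        using carr[OF irr(1) g] carr[OF irr(2) g] carr[OF irr(3) g] by (auto simp: RS)
      have "T' * T * \<rho> g = T' * (\<sigma> g * T)"
        using assoc_mult_mat[OF Tc(2,1) c(1)] comm[OF g] by simp
      also have "\<dots> = \<tau> g * T' * T"
        using assoc_mult_mat[OF Tc(2) c(2) Tc(1)] comm'[OF g] by simp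
      also have "\<dots> = \<tau> g * (T' * T)" by (rule assoc_mult_mat[OF c(3) Tc(2,1)])
      finally show ?thesis .
    qed
    then show ?thesis using TT by (auto simp: RS equivalent_reps_def)
  qed
  then show "trans {(R, S). irreducible_rep G R \<and> irreducible_rep G S \<and> equivalent_reps G R S}"
    unfolding trans_def by blast
  qed auto

theorem num_irreps_eq_card_conj_classes:
  assumes G: "group G" and fin: "finite (carrier G)"
  shows "num_irreps G = card (conj_classes G)"
proof -
  interpret group G by (rule G)
  define Irr where "Irr = {R. irreducible_rep G R}"
  define E where "E = {(R, S). irreducible_rep G R \<and> irreducible_rep G S \<and> equivalent_reps G R S}"
  have E: "equiv Irr E" unfolding Irr_def E_def by (rule equiv_irreps[OF G])
  define rp where "rp q = (SOME R. R \<in> q)" for q :: "'a rep set"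
  have rp: "rp q \<in> q" if "q \<in> Irr // E" for q
    unfolding rp_def using in_quotient_imp_non_empty[OF E that] by (simp add: some_in_eq)
  have rpI: "rp q \<in> Irr" if "q \<in> Irr // E" for q
    using rp[OF that] in_quotient_imp_subset[OF E that] by blast
  have rpE: "q = q'" if "q \<in> Irr // E" "q' \<in> Irr // E" "equivalent_reps G (rp q) (rp q')" for q q'
  proof -
    have "(rp q, rp q') \<in> E" using rpI[OF that(1)] rpI[OF that(2)] that(3) by (auto simp: E_def Irr_def)
    then show ?thesis using quotient_eqI[OF E that(1,2) rp[OF that(1)] rp[OF that(2)]] by blast
  qed
  \<comment> \<open>The bound comes first for finite sets of equivalence classes: finiteness of the
    quotient is a consequence of it, and the cardinality of an infinite set would be 0.\<close>
  have bound: "card X \<le> card (conj_classes G)" if "X \<subseteq> Irr // E" "finite X" for X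
  proof -
    have refl: "equivalent_reps G (rp q) (rp q)" if "q \<in> X" for q
      using equiv_class_self[OF E rpI[of q]] that \<open>X \<subseteq> Irr // E\<close> by (auto simp: E_def)
    have "inj_on rp X" using rpE refl that(1) by (intro inj_onI) (metis subsetD)
    then have "card X = card (rp ` X)" by (simp add: card_image)
    also have "\<dots> \<le> card (conj_classes G)"
    proof (rule card_inequivalent_irreps_le[OF G fin])
      show "finite (rp ` X)" using that by simp
      show "irreducible_rep G R" if "R \<in> rp ` X" for R
        using that rpI \<open>X \<subseteq> Irr // E\<close> by (auto simp: Irr_def)
      show "\<not> equivalent_reps G R S" if "R \<in> rp ` X" "S \<in> rp ` X" "R \<noteq> S" for R S
        using that rpE \<open>X \<subseteq> Irr // E\<close> by blast
    qed
    finally show ?thesis .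
  qed
  have finQ: "finite (Irr // E)"
  proof (rule ccontr)
    assume "infinite (Irr // E)"
    then obtain X where "X \<subseteq> Irr // E" "finite X" "card X = Suc (card (conj_classes G))"
      using infinite_arbitrarily_large by blast
    then show False using bound[of X] by simp
  qed
  have finK: "finite (conj_classes G)" using fin by (simp add: conj_classes_def)
  \<comment> \<open>The unknowns are the values of a class function, with one equation per
    equivalence class of representations. In each equation, values of the character are collected
    over a whole conjugacy class.\<close>
  have "card (conj_classes G) \<le> card (Irr // E)"
  proof (rule ccontr)
    assume "\<not> ?thesis"
    then have less: "card (Irr // E) < card (conj_classes G)" by simp
    let ?\<chi> = "\<lambda>R g. mat_trace (snd R g)"
    obtain x where x: "\<exists>K\<in>conj_classes G. x K \<noteq> 0"
      and sol: "\<forall>q\<in>Irr // E. (\<Sum>K\<in>conj_classes G.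
        (\<Sum>g | g \<in> carrier G \<and> conj_class G g = K. ?\<chi> (rp q) g) * x K) = 0"
      using homogeneous_system_nontrivial_solution[OF finQ finK less,
        of "\<lambda>q K. \<Sum>g | g \<in> carrier G \<and> conj_class G g = K. ?\<chi> (rp q) g"] by blast
    define f where "f g = x (conj_class G g)" for g
    have sum0: "(\<Sum>g\<in>carrier G. f g * ?\<chi> (rp q) g) = 0" if "q \<in> Irr // E" for q
    proof -
      have "(\<Sum>g\<in>carrier G. f g * ?\<chi> (rp q) g) =
          (\<Sum>K\<in>conj_classes G. \<Sum>g | g \<in> carrier G \<and> conj_class G g = K. f g * ?\<chi> (rp q) g)"
        by (rule sum.group[symmetric]) (use fin finK in \<open>auto simp: conj_classes_def\<close>)
      also have "\<dots> = (\<Sum>K\<in>conj_classes G.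
          (\<Sum>g | g \<in> carrier G \<and> conj_class G g = K. ?\<chi> (rp q) g) * x K)"
        by (auto simp: sum_distrib_left f_def mult.commute[of _ "x _"] intro!: sum.cong)
      finally show ?thesis using sol that by simp
    qed
    obtain x0 where x0: "x0 \<in> carrier G" "f x0 \<noteq> 0"
      using x by (auto simp: conj_classes_def f_def)
    have cf: "f (h \<otimes>\<^bsub>G\<^esub> g) = f (g \<otimes>\<^bsub>G\<^esub> h)" if gh: "g \<in> carrier G" "h \<in> carrier G" for g h
    proof -
      have "g \<otimes>\<^bsub>G\<^esub> (h \<otimes>\<^bsub>G\<^esub> g) = g \<otimes>\<^bsub>G\<^esub> h \<otimes>\<^bsub>G\<^esub> g" using gh by (simp add: m_assoc)
      then have "conj_class G (h \<otimes>\<^bsub>G\<^esub> g) = conj_class G (g \<otimes>\<^bsub>G\<^esub> h)"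
        using gh conj_class_eq_iff[OF G m_closed[OF gh(2,1)] m_closed[OF gh]] by blast
      then show ?thesis by (simp add: f_def)
    qed
    obtain d \<rho> where irr: "irreducible_rep G (d, \<rho>)"
      and ne: "(\<Sum>g\<in>carrier G. f g * mat_trace (\<rho> g)) \<noteq> 0"
      using class_function_character_nonzero[OF G fin cf x0] by blast
    \<comment> \<open>The representation obtained need not be the chosen representative of its
      equivalence class, but equivalent representations have the same character.\<close>
    define q where "q = E `` {(d, \<rho>)}"
    have q: "q \<in> Irr // E" using irr by (auto simp: q_def Irr_def intro: quotientI)
    obtain e \<sigma> where rpq: "rp q = (e, \<sigma>)" by (cases "rp q")
    have eq: "irreducible_rep G (e, \<sigma>)" "equivalent_reps G (d, \<rho>) (e, \<sigma>)"
      using rp[OF q] unfolding rpq by (auto simp: q_def E_def)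
    have "mat_trace (\<rho> g) = mat_trace (\<sigma> g)" if "g \<in> carrier G" for g
      by (rule equivalent_reps_character[OF G _ _ eq(2) that])
         (use irr eq(1) in \<open>auto simp: irreducible_rep_def\<close>)
    then have "(\<Sum>g\<in>carrier G. f g * mat_trace (\<rho> g)) = (\<Sum>g\<in>carrier G. f g * ?\<chi> (rp q) g)"
      by (intro sum.cong) (auto simp: rpq)
    then show False using ne sum0[OF q] by simp
  qed
  moreover have "card (Irr // E) \<le> card (conj_classes G)" using bound finQ by blast
  ultimately show ?thesis by (simp add: num_irreps_def Irr_def E_def)
qed

section \<open>Labelled permutations up to isomorphism\<close>

text \<open>The orbit size is the first return time of \<open>i\<close>, so the powers below it
  enumerate the cycle without repetition.\<close>

lemma
  assumes "\<pi> permutes A" "finite A"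
  shows card_orbit_pos: "0 < card (orbit \<pi> i)"
    and funpow_card_orbit: "(\<pi> ^^ card (orbit \<pi> i)) i = i"
    and inj_on_orbit: "inj_on (\<lambda>m. (\<pi> ^^ m) i) {..<card (orbit \<pi> i)}"
    and orbit_eq_funpow: "orbit \<pi> i = (\<lambda>m. (\<pi> ^^ m) i) ` {..<card (orbit \<pi> i)}"
proof -
  have perm: "permutation \<pi>" using assms by (auto simp: permutation_permutes)
  have self: "i \<in> orbit \<pi> i" by (rule permutation_self_in_orbit[OF perm])
  have orb: "orbit \<pi> i = (\<lambda>m. (\<pi> ^^ m) i) ` {0..<funpow_dist1 \<pi> i i}"
    by (rule orbit_conv_funpow_dist1[OF self])
  have inj: "inj_on (\<lambda>m. (\<pi> ^^ m) i) {0..<funpow_dist1 \<pi> i i}"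
    by (rule inj_on_funpow_dist1[OF self])
  have card: "card (orbit \<pi> i) = funpow_dist1 \<pi> i i"
    using card_image[OF inj] orb by simp
  show "0 < card (orbit \<pi> i)" by (simp add: card)
  show "(\<pi> ^^ card (orbit \<pi> i)) i = i"
    unfolding card by (rule funpow_dist1_prop[OF self])
  show "inj_on (\<lambda>m. (\<pi> ^^ m) i) {..<card (orbit \<pi> i)}"
    using inj by (simp only: card lessThan_atLeast0)
  show "orbit \<pi> i = (\<lambda>m. (\<pi> ^^ m) i) ` {..<card (orbit \<pi> i)}"
    unfolding card lessThan_atLeast0 by (rule orb)
qed

lemma orbit_self: "\<pi> permutes A \<Longrightarrow> finite A \<Longrightarrow> i \<in> orbit \<pi> i"
  by (rule permutation_self_in_orbit) (auto simp: permutation_permutes)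

lemma orbit_eq_of_mem:
  assumes "\<pi> permutes A" "finite A" "x \<in> orbit \<pi> i"
  shows "orbit \<pi> x = orbit \<pi> i"
proof -
  have "i \<in> orbit \<pi> x" by (rule orbit_swap[OF orbit_self[OF assms(1,2)] assms(3)])
  then show ?thesis using orbit_trans[OF _ assms(3)] orbit_trans[of _ \<pi> i x] by blast
qed

lemma funpow_permutes_mem: "\<pi> permutes A \<Longrightarrow> i \<in> A \<Longrightarrow> (\<pi> ^^ m) i \<in> A"
  by (induction m) (auto simp: permutes_in_image)

text \<open>Bijections between corresponding fibres glue together. This serves twice: to match
  cycles of equal label and length, and to place formal points into blocks.\<close>

lemma exists_fiber_bijection:
  assumes "finite X" "finite Y"
    and "\<And>v. card {x \<in> X. f x = v} = card {y \<in> Y. g y = v}"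
  shows "\<exists>H. bij_betw H X Y \<and> (\<forall>x\<in>X. g (H x) = f x)"
proof -
  have "\<forall>v. \<exists>h. bij_betw h {x \<in> X. f x = v} {y \<in> Y. g y = v}"
    using assms by (intro allI finite_same_card_bij) auto
  then obtain h where h: "\<And>v. bij_betw (h v) {x \<in> X. f x = v} {y \<in> Y. g y = v}"
    by metis
  define H where "H x = h (f x) x" for x
  have H: "H x \<in> Y \<and> g (H x) = f x" if "x \<in> X" for x
    using bij_betwE[OF h[of "f x"]] that by (auto simp: H_def)
  have "inj_on H X"
  proof (rule inj_onI)
    fix x y assume xy: "x \<in> X" "y \<in> X" "H x = H y"
    then have "f x = f y" using H by metis
    then show "x = y"
      using xy bij_betw_imp_inj_on[OF h[of "f x"]] by (auto simp: H_def inj_on_def)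
  qed
  moreover have "y \<in> H ` X" if "y \<in> Y" for y
  proof -
    have "y \<in> h (g y) ` {x \<in> X. f x = g y}"
      using that bij_betw_imp_surj_on[OF h[of "g y"]] by auto
    then obtain x where "x \<in> X" "f x = g y" "y = h (g y) x" by auto
    then have "x \<in> X" "y = H x" by (simp_all add: H_def)
    then show ?thesis by blast
  qed
  ultimately have "bij_betw H X Y" using H unfolding bij_betw_def by blast
  then show ?thesis using H by blast
qed

lemma count_image_mset_mset_set:
  assumes "finite A"
  shows "count (image_mset f (mset_set A)) y = card {x \<in> A. f x = y}"
  using assms
proof (induction A rule: finite_induct)
  case (insert x A)
  have "{z \<in> insert x A. f z = y} = (if f x = y then insert x {z \<in> A. f z = y} else {z \<in> A. f z = y})"
    by auto
  then show ?case using insert by simp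
qed simp

text \<open>
  A permutation with a group element at every point is viewed as a connection on its functional
  graph: the arrow from a point to its image carries the element at the image. Conjugation in the
  wreath product then becomes a change of gauge.
\<close>

primrec transport :: "('a, 'b) monoid_scheme \<Rightarrow> ('i \<Rightarrow> 'a) \<Rightarrow> ('i \<Rightarrow> 'i) \<Rightarrow> nat \<Rightarrow> 'i \<Rightarrow> 'a" where
  "transport G a \<pi> 0 i = \<one>\<^bsub>G\<^esub>"
| "transport G a \<pi> (Suc m) i = a ((\<pi> ^^ Suc m) i) \<otimes>\<^bsub>G\<^esub> transport G a \<pi> m i"

text \<open>This is the holonomy around the cycle through \<open>i\<close>. Only its conjugacy class
  is kept, because moving the starting point conjugates it.\<close>

definition cycle_class :: "('a, 'b) monoid_scheme \<Rightarrow> ('i \<Rightarrow> 'a) \<Rightarrow> ('i \<Rightarrow> 'i) \<Rightarrow> 'i \<Rightarrow> 'a set" where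
  "cycle_class G a \<pi> i = conj_class G (transport G a \<pi> (card (orbit \<pi> i)) i)"

text \<open>Forming the set of orbits first makes each cycle count once; only then are the lengths
  collected with multiplicity.\<close>

definition cycle_type :: "('a, 'b) monoid_scheme \<Rightarrow> 'i set \<Rightarrow> ('i \<Rightarrow> 'c) \<Rightarrow> ('i \<Rightarrow> 'a) \<Rightarrow> ('i \<Rightarrow> 'i) \<Rightarrow>
    'c \<times> 'a set \<Rightarrow> nat multiset" where
  "cycle_type G A clr a \<pi> q =
     image_mset card (mset_set (orbit \<pi> ` {i \<in> A. (clr i, cycle_class G a \<pi> i) = q}))"

lemma transport_closed:
  assumes "group G" "\<pi> permutes A" "a \<in> A \<rightarrow> carrier G" "i \<in> A"
  shows "transport G a \<pi> m i \<in> carrier G"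
proof -
  interpret group G by fact
  have "a ((\<pi> ^^ k) i) \<in> carrier G" for k
    using funpow_permutes_mem[OF assms(2,4), of k] assms(3) by blast
  then show ?thesis by (induction m) (auto simp del: funpow.simps)
qed

text \<open>The definition peels off the last arrow of the walk, this form the first.\<close>

lemma transport_Suc_front:
  assumes "group G" "\<pi> permutes A" "a \<in> A \<rightarrow> carrier G" "i \<in> A"
  shows "transport G a \<pi> (Suc m) i = transport G a \<pi> m (\<pi> i) \<otimes>\<^bsub>G\<^esub> a (\<pi> i)"
proof -
  interpret group G by fact
  have \<pi>i: "\<pi> i \<in> A" using assms by (simp add: permutes_in_image)
  have a: "a ((\<pi> ^^ k) j) \<in> carrier G" if "j \<in> A" for k j
    using assms(2,3) funpow_permutes_mem[of \<pi> A j k] that by blast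
  show ?thesis
  proof (induction m)
    case 0
    show ?case using a[OF \<pi>i, of 0] by simp
  next
    case (Suc m)
    have "transport G a \<pi> (Suc (Suc m)) i =
        a ((\<pi> ^^ Suc m) (\<pi> i)) \<otimes>\<^bsub>G\<^esub> (transport G a \<pi> m (\<pi> i) \<otimes>\<^bsub>G\<^esub> a (\<pi> i))"
      unfolding Suc.IH[symmetric] by (simp add: funpow_swap1)
    then show ?case
      using a[OF \<pi>i, of "Suc m"] a[OF \<pi>i, of 0] transport_closed[OF assms(1-3) \<pi>i]
      by (simp add: m_assoc del: funpow.simps)
  qed
qed

text \<open>The walk of one full turn plus one step from \<open>i\<close> can be split at either
  end; comparing the two splittings shows that \<open>a (\<pi> i)\<close> conjugates one holonomy
  into the other.\<close>

lemma cycle_class_step: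
  assumes G: "group G" and \<pi>: "\<pi> permutes A" "finite A" and a: "a \<in> A \<rightarrow> carrier G" and i: "i \<in> A"
  shows "cycle_class G a \<pi> (\<pi> i) = cycle_class G a \<pi> i"
proof -
  interpret group G by (rule G)
  have \<pi>i: "\<pi> i \<in> A" using i \<pi> by (simp add: permutes_in_image)
  have mem: "\<pi> i \<in> orbit \<pi> i" by (rule orbit.base)
  let ?l = "card (orbit \<pi> i)"
  have eq: "orbit \<pi> (\<pi> i) = orbit \<pi> i" using orbit_eq_of_mem[OF \<pi> mem] .
  have "(\<pi> ^^ Suc ?l) i = \<pi> i" using funpow_card_orbit[OF \<pi>, of i] by simp
  then have "a (\<pi> i) \<otimes>\<^bsub>G\<^esub> transport G a \<pi> ?l i = transport G a \<pi> ?l (\<pi> i) \<otimes>\<^bsub>G\<^esub> a (\<pi> i)"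
    using transport_Suc_front[OF G \<pi>(1) a i, of ?l] by simp
  moreover have "a (\<pi> i) \<in> carrier G" using a \<pi>i by blast
  ultimately have "conj_class G (transport G a \<pi> ?l i) = conj_class G (transport G a \<pi> ?l (\<pi> i))"
    using conj_class_eq_iff[OF G transport_closed[OF G \<pi>(1) a i] transport_closed[OF G \<pi>(1) a \<pi>i]]
    by blast
  then show ?thesis by (simp add: cycle_class_def eq)
qed

lemma funpow_invariant:
  assumes "\<pi> permutes A" "\<And>i. i \<in> A \<Longrightarrow> f (\<pi> i) = f i" "i \<in> A"
  shows "f ((\<pi> ^^ m) i) = f i"
proof (induction m)
  case (Suc m)
  then show ?case using assms(2)[OF funpow_permutes_mem[OF assms(1,3)], of m] by simp
qed simp

lemma orbit_invariant:
  assumes \<pi>: "\<pi> permutes A" "finite A" and inv: "\<And>i. i \<in> A \<Longrightarrow> f (\<pi> i) = f i"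
    and i: "i \<in> A" and x: "x \<in> orbit \<pi> i"
  shows "f x = f i"
proof -
  obtain m where "x = (\<pi> ^^ m) i" using x orbit_eq_funpow[OF \<pi>, of i] by blast
  then show ?thesis using funpow_invariant[where f = f, OF \<pi>(1) _ i] inv by simp
qed

section \<open>Isomorphisms of labelled permutations\<close>

text \<open>\<open>\<sigma>\<close> renames the points and \<open>c\<close> is a gauge
  transformation: the element on the arrow into \<open>\<pi> i\<close> is multiplied by
  \<open>c (\<pi> i)\<close> at the head and by the inverse of \<open>c i\<close> at the tail. The
  two point sets may have different types, so that formal points can be compared with points of
  blocks.\<close>

definition cycle_iso :: "('a, 'b) monoid_scheme \<Rightarrow> 'i set \<Rightarrow> ('i \<Rightarrow> 'c) \<Rightarrow> ('i \<Rightarrow> 'a) \<Rightarrow> ('i \<Rightarrow> 'i) \<Rightarrow>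
    'j set \<Rightarrow> ('j \<Rightarrow> 'c) \<Rightarrow> ('j \<Rightarrow> 'a) \<Rightarrow> ('j \<Rightarrow> 'j) \<Rightarrow> ('i \<Rightarrow> 'j) \<Rightarrow> ('i \<Rightarrow> 'a) \<Rightarrow> bool" where
  "cycle_iso G A clr a \<pi> B clr' a' \<pi>' \<sigma> c \<longleftrightarrow>
     bij_betw \<sigma> A B \<and> c \<in> A \<rightarrow> carrier G \<and>
     (\<forall>i\<in>A. clr' (\<sigma> i) = clr i \<and> \<sigma> (\<pi> i) = \<pi>' (\<sigma> i) \<and>
        c (\<pi> i) \<otimes>\<^bsub>G\<^esub> a (\<pi> i) = a' (\<pi>' (\<sigma> i)) \<otimes>\<^bsub>G\<^esub> c i)"

lemma cycle_iso_imp_cycle_type_eq: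
  assumes G: "group G"
    and \<pi>: "\<pi> permutes A" "finite A" and a: "a \<in> A \<rightarrow> carrier G"
    and \<pi>': "\<pi>' permutes B" "finite B" and a': "a' \<in> B \<rightarrow> carrier G"
    and iso: "cycle_iso G A clr a \<pi> B clr' a' \<pi>' \<sigma> c"
  shows "cycle_type G A clr a \<pi> = cycle_type G B clr' a' \<pi>'"
proof
  interpret group G by (rule G)
  fix q
  have bij: "bij_betw \<sigma> A B" and c: "c \<in> A \<rightarrow> carrier G"
    and clr: "\<And>i. i \<in> A \<Longrightarrow> clr' (\<sigma> i) = clr i"
    and eqv: "\<And>i. i \<in> A \<Longrightarrow> \<sigma> (\<pi> i) = \<pi>' (\<sigma> i)"
    and gauge: "\<And>i. i \<in> A \<Longrightarrow> c (\<pi> i) \<otimes>\<^bsub>G\<^esub> a (\<pi> i) = a' (\<pi>' (\<sigma> i)) \<otimes>\<^bsub>G\<^esub> c i"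
    using iso by (auto simp: cycle_iso_def)
  have \<sigma>B: "\<sigma> i \<in> B" if "i \<in> A" for i using bij that by (auto simp: bij_betw_def)
  have pow: "\<sigma> ((\<pi> ^^ m) i) = (\<pi>' ^^ m) (\<sigma> i)" if "i \<in> A" for m i
    by (induction m) (auto simp: eqv funpow_permutes_mem[OF \<pi>(1) that])
  have orb: "orbit \<pi>' (\<sigma> i) = \<sigma> ` orbit \<pi> i" if i: "i \<in> A" for i
    unfolding orbit_altdef using pow[OF i, symmetric] by auto
  have orbA: "orbit \<pi> i \<subseteq> A" if "i \<in> A" for i
    using permutes_orbit_subset[OF \<pi>(1) that] .
  have card: "card (\<sigma> ` X) = card X" if "X \<subseteq> A" for X
    using bij that by (intro card_image) (auto simp: bij_betw_def intro: inj_on_subset)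
  \<comment> \<open>Along any walk the gauge cancels at the inner points and survives only at the
    two ends. Around a full cycle the ends agree, so the holonomies are conjugate.\<close>
  have tr: "c ((\<pi> ^^ m) i) \<otimes>\<^bsub>G\<^esub> transport G a \<pi> m i = transport G a' \<pi>' m (\<sigma> i) \<otimes>\<^bsub>G\<^esub> c i"
    if i: "i \<in> A" for m i
  proof (induction m)
    case 0
    have "c i \<in> carrier G" using c i by blast
    then show ?case by simp
  next
    case (Suc m)
    define j where "j = (\<pi> ^^ m) i"
    have j: "j \<in> A" unfolding j_def using funpow_permutes_mem[OF \<pi>(1) i] .
    have \<pi>j: "\<pi> j \<in> A" using j \<pi> by (simp add: permutes_in_image)
    have t: "transport G a \<pi> m i \<in> carrier G" "transport G a' \<pi>' m (\<sigma> i) \<in> carrier G"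
      using transport_closed[OF G \<pi>(1) a i] transport_closed[OF G \<pi>'(1) a' \<sigma>B[OF i]] by auto
    have cl: "c j \<in> carrier G" "c (\<pi> j) \<in> carrier G" "c i \<in> carrier G" "a (\<pi> j) \<in> carrier G"
      "a' (\<pi>' (\<sigma> j)) \<in> carrier G"
      using c a a' i j \<pi>j \<sigma>B[OF \<pi>j] eqv[OF j] by (auto simp: Pi_iff)
    have "c (\<pi> j) \<otimes>\<^bsub>G\<^esub> (a (\<pi> j) \<otimes>\<^bsub>G\<^esub> transport G a \<pi> m i) =
        (c (\<pi> j) \<otimes>\<^bsub>G\<^esub> a (\<pi> j)) \<otimes>\<^bsub>G\<^esub> transport G a \<pi> m i"
      using cl t by (simp add: m_assoc)
    also have "\<dots> = a' (\<pi>' (\<sigma> j)) \<otimes>\<^bsub>G\<^esub> (c j \<otimes>\<^bsub>G\<^esub> transport G a \<pi> m i)"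
      using cl t by (simp add: gauge[OF j] m_assoc)
    also have "\<dots> = a' (\<pi>' (\<sigma> j)) \<otimes>\<^bsub>G\<^esub> transport G a' \<pi>' m (\<sigma> i) \<otimes>\<^bsub>G\<^esub> c i"
      using Suc.IH cl t by (simp add: m_assoc j_def)
    finally show ?case using pow[OF i, of m] by (simp add: j_def)
  qed
  have cls: "cycle_class G a' \<pi>' (\<sigma> i) = cycle_class G a \<pi> i" if i: "i \<in> A" for i
  proof -
    let ?l = "card (orbit \<pi> i)"
    have l: "card (orbit \<pi>' (\<sigma> i)) = ?l" using orb[OF i] card[OF orbA[OF i]] by simp
    have "c i \<otimes>\<^bsub>G\<^esub> transport G a \<pi> ?l i = transport G a' \<pi>' ?l (\<sigma> i) \<otimes>\<^bsub>G\<^esub> c i"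
      using tr[OF i, of ?l] funpow_card_orbit[OF \<pi>, of i] by simp
    moreover have "c i \<in> carrier G" using c i by blast
    ultimately have "conj_class G (transport G a \<pi> ?l i) = conj_class G (transport G a' \<pi>' ?l (\<sigma> i))"
      using conj_class_eq_iff[OF G transport_closed[OF G \<pi>(1) a i]
          transport_closed[OF G \<pi>'(1) a' \<sigma>B[OF i]]] by blast
    then show ?thesis by (simp add: cycle_class_def l)
  qed
  let ?X = "{i \<in> A. (clr i, cycle_class G a \<pi> i) = q}"
  have "{i \<in> B. (clr' i, cycle_class G a' \<pi>' i) = q} = \<sigma> ` ?X"
    using bij clr cls by (auto simp: bij_betw_def)
  moreover have "orbit \<pi>' ` \<sigma> ` ?X = (`) \<sigma> ` orbit \<pi> ` ?X"
    unfolding image_image by (rule image_cong) (use orb in auto)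
  moreover have "inj_on ((`) \<sigma>) (orbit \<pi> ` ?X)"
  proof (rule inj_onI)
    fix X Y assume XY: "X \<in> orbit \<pi> ` ?X" "Y \<in> orbit \<pi> ` ?X" "\<sigma> ` X = \<sigma> ` Y"
    then have "X \<subseteq> A" "Y \<subseteq> A" using orbA by auto
    then show "X = Y"
      using XY(3) inj_on_image_eq_iff[OF bij_betw_imp_inj_on[OF bij]] by blast
  qed
  ultimately have "cycle_type G B clr' a' \<pi>' q =
      image_mset card (image_mset ((`) \<sigma>) (mset_set (orbit \<pi> ` ?X)))"
    by (simp add: cycle_type_def image_mset_mset_set)
  also have "\<dots> = image_mset (card \<circ> (`) \<sigma>) (mset_set (orbit \<pi> ` ?X))"
    by (rule multiset.map_comp)
  also have "\<dots> = cycle_type G A clr a \<pi> q"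
    unfolding cycle_type_def by (intro image_mset_cong) (use \<pi>(2) card orbA in auto)
  finally show "cycle_type G A clr a \<pi> q = cycle_type G B clr' a' \<pi>' q" ..
qed

text \<open>Cycles of equal label and length are matched by \<open>H\<close>. Each cycle gets a base
  point, and \<open>\<sigma>\<close> pairs the points at equal distance from the base points. The
  gauge \<open>c\<close> is forced by its value at the base point, and it closes up around the cycle
  exactly when this value conjugates one holonomy into the other.\<close>

lemma cycle_type_eq_imp_cycle_iso:
  fixes A :: "'i set" and B :: "'j set"
  assumes G: "group G"
    and \<pi>: "\<pi> permutes A" "finite A" and a: "a \<in> A \<rightarrow> carrier G"
    and \<pi>': "\<pi>' permutes B" "finite B" and a': "a' \<in> B \<rightarrow> carrier G"
    and clr: "\<And>i. i \<in> A \<Longrightarrow> clr (\<pi> i) = clr i" and clr': "\<And>i. i \<in> B \<Longrightarrow> clr' (\<pi>' i) = clr' i"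
    and eq: "cycle_type G A clr a \<pi> = cycle_type G B clr' a' \<pi>'"
  shows "\<exists>\<sigma> c. cycle_iso G A clr a \<pi> B clr' a' \<pi>' \<sigma> c"
proof -
  interpret group G by (rule G)
  define lab where "lab i = (clr i, cycle_class G a \<pi> i)" for i
  define lab' where "lab' i = (clr' i, cycle_class G a' \<pi>' i)" for i
  \<comment> \<open>Representatives are chosen from the orbit as a set, so all points of one cycle
    share them.\<close>
  define rp :: "'i set \<Rightarrow> 'i" where "rp X = (SOME i. i \<in> X)" for X
  define rp' :: "'j set \<Rightarrow> 'j" where "rp' X = (SOME i. i \<in> X)" for X
  have lab_orbit: "lab x = lab i" if "i \<in> A" "x \<in> orbit \<pi> i" for x i
    using orbit_invariant[OF \<pi>, of lab i x] that cycle_class_step[OF G \<pi> a] clr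
    by (simp add: lab_def)
  have lab'_orbit: "lab' x = lab' i" if "i \<in> B" "x \<in> orbit \<pi>' i" for x i
    using orbit_invariant[OF \<pi>', of lab' i x] that cycle_class_step[OF G \<pi>' a'] clr'
    by (simp add: lab'_def)
  have rp: "rp (orbit \<pi> i) \<in> orbit \<pi> i" for i
    unfolding rp_def using orbit_self[OF \<pi>, of i] by (rule someI)
  have rp': "rp' (orbit \<pi>' i) \<in> orbit \<pi>' i" for i
    unfolding rp'_def using orbit_self[OF \<pi>', of i] by (rule someI)
  let ?X = "orbit \<pi> ` A" and ?Y = "orbit \<pi>' ` B"
  let ?f = "\<lambda>X. (lab (rp X), card X)" and ?g = "\<lambda>X. (lab' (rp' X), card X)"
  have "card {X \<in> ?X. ?f X = (q, l)} = card {Y \<in> ?Y. ?g Y = (q, l)}" for q l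
  proof -
    have "{X \<in> ?X. ?f X = (q, l)} = {X \<in> orbit \<pi> ` {i \<in> A. lab i = q}. card X = l}"
      using lab_orbit rp by auto
    moreover have "{Y \<in> ?Y. ?g Y = (q, l)} = {Y \<in> orbit \<pi>' ` {i \<in> B. lab' i = q}. card Y = l}"
      using lab'_orbit rp' by auto
    moreover have "card {X \<in> orbit \<pi> ` {i \<in> A. lab i = q}. card X = l} = count (cycle_type G A clr a \<pi> q) l"
      using \<pi>(2) by (simp add: cycle_type_def lab_def count_image_mset_mset_set)
    moreover have "card {X \<in> orbit \<pi>' ` {i \<in> B. lab' i = q}. card X = l} = count (cycle_type G B clr' a' \<pi>' q) l"
      using \<pi>'(2) by (simp add: cycle_type_def lab'_def count_image_mset_mset_set)
    ultimately show ?thesis using eq by simp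
  qed
  then obtain H where H: "bij_betw H ?X ?Y" and Hf: "\<forall>X\<in>?X. ?g (H X) = ?f X"
    using exists_fiber_bijection[of ?X ?Y ?f ?g] \<pi>(2) \<pi>'(2) by auto
  define r where "r x = rp (orbit \<pi> x)" for x
  define r' where "r' x = rp' (H (orbit \<pi> x))" for x
  define pos where "pos x = (SOME m. m < card (orbit \<pi> x) \<and> (\<pi> ^^ m) (r x) = x)" for x
  have orb_r: "orbit \<pi> (r x) = orbit \<pi> x" for x
    unfolding r_def by (rule orbit_eq_of_mem[OF \<pi> rp])
  have rA: "r x \<in> A" if "x \<in> A" for x
    using rp[of x] permutes_orbit_subset[OF \<pi>(1) that] by (auto simp: r_def)
  have Hx: "\<exists>y\<in>B. H (orbit \<pi> x) = orbit \<pi>' y" if "x \<in> A" for x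
  proof -
    have "H (orbit \<pi> x) \<in> ?Y" using bij_betwE[OF H] that by blast
    then show ?thesis by blast
  qed
  have r': "r' x \<in> B \<and> orbit \<pi>' (r' x) = H (orbit \<pi> x)" if x: "x \<in> A" for x
  proof -
    obtain y where y: "y \<in> B" "H (orbit \<pi> x) = orbit \<pi>' y" using Hx[OF x] by blast
    then show ?thesis
      using rp'[of y] permutes_orbit_subset[OF \<pi>'(1) y(1)] orbit_eq_of_mem[OF \<pi>' rp'[of y]]
      by (auto simp: r'_def)
  qed
  have len: "card (orbit \<pi>' (r' x)) = card (orbit \<pi> x)" if x: "x \<in> A" for x
    using Hf x r'[OF x] by auto
  have lab_r: "lab' (r' x) = lab x" if x: "x \<in> A" for x
    using Hf x lab_orbit[OF x rp] by (auto simp: r'_def)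
  have pos: "pos x < card (orbit \<pi> x) \<and> (\<pi> ^^ pos x) (r x) = x" for x
  proof -
    have "x \<in> (\<lambda>m. (\<pi> ^^ m) (r x)) ` {..<card (orbit \<pi> x)}"
      using orbit_eq_funpow[OF \<pi>, of "r x"] orbit_self[OF \<pi>, of x] by (simp only: orb_r)
    then obtain m where "m < card (orbit \<pi> x)" "x = (\<pi> ^^ m) (r x)" by blast
    then show ?thesis
      unfolding pos_def
      using someI[where P = "\<lambda>m. m < card (orbit \<pi> x) \<and> (\<pi> ^^ m) (r x) = x" and x = m] by simp
  qed
  have orb_pow: "orbit \<pi> ((\<pi> ^^ m) x) = orbit \<pi> x" for m x
    by (rule orbit_eq_of_mem[OF \<pi> funpow_in_orbit[OF orbit_self[OF \<pi>]]])
  have r_pow: "r ((\<pi> ^^ m) x) = r x" and r'_pow: "r' ((\<pi> ^^ m) x) = r' x" for m x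
    by (simp_all add: r_def r'_def orb_pow)
  have pos_pow: "pos ((\<pi> ^^ m) (r x)) = m" if "m < card (orbit \<pi> x)" for m x
  proof -
    have rr: "r (r x) = r x" by (simp add: r_def[of "r x"] orb_r) (simp add: r_def)
    have "(\<pi> ^^ pos ((\<pi> ^^ m) (r x))) (r x) = (\<pi> ^^ m) (r x)"
      and "pos ((\<pi> ^^ m) (r x)) < card (orbit \<pi> x)"
      using pos[of "(\<pi> ^^ m) (r x)"] by (simp_all add: r_pow orb_pow orb_r rr)
    then show ?thesis
      using inj_on_orbit[OF \<pi>, of "r x"] that by (auto simp: orb_r inj_on_def)
  qed
  let ?t = "transport G a \<pi>" and ?t' = "transport G a' \<pi>'"
  have ex: "\<exists>u. u \<in> carrier G \<and> u \<otimes>\<^bsub>G\<^esub> ?t (card (orbit \<pi> x)) (r x) = ?t' (card (orbit \<pi> x)) (r' x) \<otimes>\<^bsub>G\<^esub> u"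
    if x: "x \<in> A" for x
  proof -
    have "cycle_class G a \<pi> (r x) = cycle_class G a' \<pi>' (r' x)"
      using lab_r[OF x] lab_orbit[OF x rp] by (simp add: lab_def lab'_def r_def)
    then show ?thesis
      using conj_class_eq_iff[OF G transport_closed[OF G \<pi>(1) a rA[OF x]]
          transport_closed[OF G \<pi>'(1) a'], of "r' x"] r'[OF x] len[OF x]
      by (auto simp: cycle_class_def orb_r)
  qed
  \<comment> \<open>The choice refers to \<open>x\<close> only through its orbit, so
    \<open>u0\<close> is constant on cycles.\<close>
  define u0 where "u0 x = (SOME u. u \<in> carrier G \<and>
    u \<otimes>\<^bsub>G\<^esub> ?t (card (orbit \<pi> x)) (rp (orbit \<pi> x)) =
      ?t' (card (orbit \<pi> x)) (rp' (H (orbit \<pi> x))) \<otimes>\<^bsub>G\<^esub> u)" for x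
  have u0: "u0 x \<in> carrier G \<and>
    u0 x \<otimes>\<^bsub>G\<^esub> ?t (card (orbit \<pi> x)) (r x) = ?t' (card (orbit \<pi> x)) (r' x) \<otimes>\<^bsub>G\<^esub> u0 x"
    if x: "x \<in> A" for x
    using someI_ex[OF ex[OF x]] by (simp only: u0_def r_def r'_def)
  have u0_cong: "u0 x = u0 y" if "orbit \<pi> x = orbit \<pi> y" for x y
    by (simp only: u0_def that)
  define \<sigma> where "\<sigma> x = (\<pi>' ^^ pos x) (r' x)" for x
  \<comment> \<open>From \<open>x\<close> back to the base point along the source cycle, across by
    \<open>u0\<close>, then forward along the target cycle.\<close>
  define c where "c x = ?t' (pos x) (r' x) \<otimes>\<^bsub>G\<^esub> u0 x \<otimes>\<^bsub>G\<^esub> inv\<^bsub>G\<^esub> (?t (pos x) (r x))" for x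
  have tc: "?t m (r x) \<in> carrier G" "?t' m (r' x) \<in> carrier G" if "x \<in> A" for m x
    using transport_closed[OF G \<pi>(1) a rA[OF that]] transport_closed[OF G \<pi>'(1) a'] r'[OF that]
    by auto
  \<comment> \<open>The bound includes the full length \<open>m = card (orbit \<pi> x)\<close>, so
    that the last step of a cycle is treated like the others. At this \<open>m\<close> both points
    are back at their bases, and the formula for \<open>c\<close> returns \<open>u0 x\<close> by the
    conjugation property of \<open>u0\<close>.\<close>
  have \<sigma>_pow: "\<sigma> ((\<pi> ^^ m) (r x)) = (\<pi>' ^^ m) (r' x)"
    and c_pow: "c ((\<pi> ^^ m) (r x)) = ?t' m (r' x) \<otimes>\<^bsub>G\<^esub> u0 x \<otimes>\<^bsub>G\<^esub> inv\<^bsub>G\<^esub> (?t m (r x))"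
    if x: "x \<in> A" and m: "m \<le> card (orbit \<pi> x)" for x m
  proof -
    have rr: "r (r x) = r x" "r' (r x) = r' x" by (metis r_def orb_r) (metis r'_def orb_r)
    have uu: "u0 ((\<pi> ^^ m) (r x)) = u0 x" for m
      by (rule u0_cong) (simp only: orb_pow orb_r)
    have less: "\<sigma> ((\<pi> ^^ m) (r x)) = (\<pi>' ^^ m) (r' x) \<and>
        c ((\<pi> ^^ m) (r x)) = ?t' m (r' x) \<otimes>\<^bsub>G\<^esub> u0 x \<otimes>\<^bsub>G\<^esub> inv\<^bsub>G\<^esub> (?t m (r x))"
      if "m < card (orbit \<pi> x)" for m
      using that by (simp add: \<sigma>_def c_def pos_pow r_pow r'_pow rr uu)
    let ?l = "card (orbit \<pi> x)"
    have "(\<pi> ^^ ?l) (r x) = (\<pi> ^^ 0) (r x)" "(\<pi>' ^^ ?l) (r' x) = (\<pi>' ^^ 0) (r' x)"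
      using funpow_card_orbit[OF \<pi>, of "r x"] funpow_card_orbit[OF \<pi>', of "r' x"] len[OF x]
      by (simp_all add: orb_r)
    moreover have "?t' ?l (r' x) \<otimes>\<^bsub>G\<^esub> u0 x \<otimes>\<^bsub>G\<^esub> inv\<^bsub>G\<^esub> (?t ?l (r x)) = u0 x"
      using u0[OF x] tc[OF x] by (metis inv_solve_right' m_closed)
    moreover have "?t' 0 (r' x) \<otimes>\<^bsub>G\<^esub> u0 x \<otimes>\<^bsub>G\<^esub> inv\<^bsub>G\<^esub> (?t 0 (r x)) = u0 x"
      using u0[OF x] by simp
    ultimately have "\<sigma> ((\<pi> ^^ m) (r x)) = (\<pi>' ^^ m) (r' x) \<and>
        c ((\<pi> ^^ m) (r x)) = ?t' m (r' x) \<otimes>\<^bsub>G\<^esub> u0 x \<otimes>\<^bsub>G\<^esub> inv\<^bsub>G\<^esub> (?t m (r x))"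
      if "m = ?l" for m
      using less[of 0] card_orbit_pos[OF \<pi>, of x] that by simp
    then show "\<sigma> ((\<pi> ^^ m) (r x)) = (\<pi>' ^^ m) (r' x)"
      and "c ((\<pi> ^^ m) (r x)) = ?t' m (r' x) \<otimes>\<^bsub>G\<^esub> u0 x \<otimes>\<^bsub>G\<^esub> inv\<^bsub>G\<^esub> (?t m (r x))"
      using less[of m] m by (auto simp: le_less)
  qed
  have \<sigma>B: "\<sigma> x \<in> B" if "x \<in> A" for x
    using r'[OF that] funpow_permutes_mem[OF \<pi>'(1)] by (simp add: \<sigma>_def)
  have orb\<sigma>: "orbit \<pi>' (\<sigma> x) = H (orbit \<pi> x)" if x: "x \<in> A" for x
  proof -
    have "\<sigma> x \<in> orbit \<pi>' (r' x)"
      unfolding \<sigma>_def by (rule funpow_in_orbit[OF orbit_self[OF \<pi>']])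
    then have "orbit \<pi>' (\<sigma> x) = orbit \<pi>' (r' x)" by (rule orbit_eq_of_mem[OF \<pi>'])
    then show ?thesis using r'[OF x] by simp
  qed
  have "inj_on \<sigma> A"
  proof (rule inj_onI)
    fix x y assume xy: "x \<in> A" "y \<in> A" "\<sigma> x = \<sigma> y"
    then have "H (orbit \<pi> x) = H (orbit \<pi> y)" using orb\<sigma>[OF xy(1)] orb\<sigma>[OF xy(2)] by simp
    then have o: "orbit \<pi> x = orbit \<pi> y"
      using inj_onD[OF bij_betw_imp_inj_on[OF H]] xy(1,2) by blast
    then have r: "r x = r y" "r' x = r' y" by (simp_all add: r_def r'_def)
    then have "(\<pi>' ^^ pos x) (r' x) = (\<pi>' ^^ pos y) (r' x)" using xy(3) by (simp add: \<sigma>_def)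
    then have "pos x = pos y"
      using inj_on_orbit[OF \<pi>', of "r' x"] pos[of x] pos[of y] len[OF xy(1)] o
      by (auto simp: inj_on_def)
    then have "(\<pi> ^^ pos x) (r x) = (\<pi> ^^ pos y) (r y)" using r by simp
    then show "x = y" by (simp add: pos)
  qed
  moreover have "y \<in> \<sigma> ` A" if y: "y \<in> B" for y
  proof -
    obtain x where x: "x \<in> A" "H (orbit \<pi> x) = orbit \<pi>' y"
    proof -
      have "orbit \<pi>' y \<in> H ` ?X" using bij_betw_imp_surj_on[OF H] y by blast
      then show thesis using that by auto
    qed
    have "y \<in> orbit \<pi>' (r' x)" using r'[OF x(1)] x(2) orbit_self[OF \<pi>', of y] by simp
    then obtain m where m: "m < card (orbit \<pi> x)" "y = (\<pi>' ^^ m) (r' x)"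
      using orbit_eq_funpow[OF \<pi>', of "r' x"] len[OF x(1)] by auto
    then have "y = \<sigma> ((\<pi> ^^ m) (r x))" using \<sigma>_pow[OF x(1)] by simp
    then show ?thesis using funpow_permutes_mem[OF \<pi>(1) rA[OF x(1)]] by blast
  qed
  ultimately have "bij_betw \<sigma> A B" using \<sigma>B unfolding bij_betw_def by blast
  moreover have "c \<in> A \<rightarrow> carrier G" using tc u0 by (auto simp: c_def)
  moreover have "clr' (\<sigma> x) = clr x" if x: "x \<in> A" for x
    using funpow_invariant[where f = clr' and i = "r' x" and m = "pos x", OF \<pi>'(1)] clr' r'[OF x] lab_r[OF x]
    by (simp add: \<sigma>_def lab_def lab'_def)
  moreover have "\<sigma> (\<pi> x) = \<pi>' (\<sigma> x)"
    and "c (\<pi> x) \<otimes>\<^bsub>G\<^esub> a (\<pi> x) = a' (\<pi>' (\<sigma> x)) \<otimes>\<^bsub>G\<^esub> c x" if x: "x \<in> A" for x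
  proof -
    obtain m where m: "m < card (orbit \<pi> x)" "(\<pi> ^^ m) (r x) = x"
      by (rule that[of "pos x"]) (simp_all add: pos)
    have \<pi>x: "\<pi> x = (\<pi> ^^ Suc m) (r x)" using m(2) by simp
    have \<sigma>x: "\<sigma> x = (\<pi>' ^^ m) (r' x)" using \<sigma>_pow[OF x, of m] m by simp
    show "\<sigma> (\<pi> x) = \<pi>' (\<sigma> x)" using \<sigma>_pow[OF x, of "Suc m"] m(1) \<pi>x \<sigma>x by simp
    have ax: "a (\<pi> x) \<in> carrier G" using a x \<pi>(1) by (auto simp: permutes_in_image)
    have ax': "a' (\<pi>' (\<sigma> x)) \<in> carrier G" using a' \<sigma>B[OF x] \<pi>'(1) by (auto simp: permutes_in_image)
    have tS: "?t (Suc m) (r x) = a (\<pi> x) \<otimes>\<^bsub>G\<^esub> ?t m (r x)" using m(2) by simp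
    have tS': "?t' (Suc m) (r' x) = a' (\<pi>' (\<sigma> x)) \<otimes>\<^bsub>G\<^esub> ?t' m (r' x)" using \<sigma>x by simp
    have "c (\<pi> x) \<otimes>\<^bsub>G\<^esub> a (\<pi> x) =
        ?t' (Suc m) (r' x) \<otimes>\<^bsub>G\<^esub> u0 x \<otimes>\<^bsub>G\<^esub> inv\<^bsub>G\<^esub> (?t (Suc m) (r x)) \<otimes>\<^bsub>G\<^esub> a (\<pi> x)"
      using c_pow[OF x, of "Suc m"] m(1) by (simp only: \<pi>x)
    also have "\<dots> = a' (\<pi>' (\<sigma> x)) \<otimes>\<^bsub>G\<^esub> (?t' m (r' x) \<otimes>\<^bsub>G\<^esub> u0 x \<otimes>\<^bsub>G\<^esub> inv\<^bsub>G\<^esub> (?t m (r x)))"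
      unfolding tS tS' using ax ax' tc[OF x] u0[OF x, THEN conjunct1]
      by (simp add: inv_mult_group m_assoc)
    also have "?t' m (r' x) \<otimes>\<^bsub>G\<^esub> u0 x \<otimes>\<^bsub>G\<^esub> inv\<^bsub>G\<^esub> (?t m (r x)) = c x"
      using c_pow[OF x, of m] m by simp
    finally show "c (\<pi> x) \<otimes>\<^bsub>G\<^esub> a (\<pi> x) = a' (\<pi>' (\<sigma> x)) \<otimes>\<^bsub>G\<^esub> c x" .
  qed
  ultimately have "cycle_iso G A clr a \<pi> B clr' a' \<pi>' \<sigma> c"
    unfolding cycle_iso_def by blast
  then show ?thesis by blast
qed

section \<open>Admissible cycle types and their realisation\<close>

lemma Union_orbits_of_label:
  assumes \<pi>: "\<pi> permutes A" "finite A" and inv: "\<And>i. i \<in> A \<Longrightarrow> lab (\<pi> i) = lab i"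
  shows "\<Union> (orbit \<pi> ` {i \<in> A. lab i = q}) = {i \<in> A. lab i = q}"
proof
  show "\<Union> (orbit \<pi> ` {i \<in> A. lab i = q}) \<subseteq> {i \<in> A. lab i = q}"
  proof
    fix x assume "x \<in> \<Union> (orbit \<pi> ` {i \<in> A. lab i = q})"
    then obtain i where i: "i \<in> A" "lab i = q" "x \<in> orbit \<pi> i" by blast
    then show "x \<in> {i \<in> A. lab i = q}"
      using permutes_orbit_subset[OF \<pi>(1) i(1)] orbit_invariant[where f = lab, OF \<pi> _ i(1,3)] inv by auto
  qed
  show "{i \<in> A. lab i = q} \<subseteq> \<Union> (orbit \<pi> ` {i \<in> A. lab i = q})"
    using orbit_self[OF \<pi>] by blast
qed

text \<open>Labels are constant along cycles, so the cycles with label \<open>q\<close> partition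
  the points with that label.\<close>

lemma sum_mset_cycle_type:
  assumes G: "group G" and \<pi>: "\<pi> permutes A" "finite A" and a: "a \<in> A \<rightarrow> carrier G"
    and clr: "\<And>i. i \<in> A \<Longrightarrow> clr (\<pi> i) = clr i"
  shows "\<Sum>\<^sub># (cycle_type G A clr a \<pi> q) = card {i \<in> A. (clr i, cycle_class G a \<pi> i) = q}"
proof -
  let ?Z = "orbit \<pi> ` {i \<in> A. (clr i, cycle_class G a \<pi> i) = q}"
  have fin: "finite (orbit \<pi> i)" for i
    using orbit_eq_funpow[OF \<pi>, of i] by (metis finite_imageI finite_lessThan)
  have "\<Sum>\<^sub># (cycle_type G A clr a \<pi> q) = (\<Sum>X\<in>?Z. card X)"
    by (simp add: cycle_type_def sum_unfold_sum_mset)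
  also have "\<dots> = card (\<Union> ?Z)"
  proof (rule card_Union_disjoint[symmetric])
    show "pairwise disjnt ?Z"
    proof (rule pairwiseI)
      fix X Y assume "X \<in> ?Z" "Y \<in> ?Z" "X \<noteq> Y"
      then obtain i j where ij: "X = orbit \<pi> i" "Y = orbit \<pi> j" by blast
      have False if "x \<in> X" "x \<in> Y" for x
        using orbit_eq_of_mem[OF \<pi>, of x i] orbit_eq_of_mem[OF \<pi>, of x j] that ij \<open>X \<noteq> Y\<close> by simp
      then show "disjnt X Y" by (auto simp: disjnt_def)
    qed
  qed (use fin in auto)
  also have "\<Union> ?Z = {i \<in> A. (clr i, cycle_class G a \<pi> i) = q}"
    by (rule Union_orbits_of_label[OF \<pi>]) (simp add: clr cycle_class_step[OF G \<pi> a])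
  finally show ?thesis .
qed

lemma cycle_class_in_conj_classes:
  assumes "group G" "\<pi> permutes A" "a \<in> A \<rightarrow> carrier G" "i \<in> A"
  shows "cycle_class G a \<pi> i \<in> conj_classes G"
  unfolding cycle_class_def conj_classes_def by (rule imageI) (rule transport_closed[OF assms])

text \<open>Every point has its cycle class in \<open>conj_classes G\<close>, so summing over the
  classes for a fixed colour recovers all points of that colour. Apart from positivity and support
  this is the only constraint on a cycle type, as \<open>cycle_type_realization\<close>
  shows.\<close>

lemma sum_cycle_type:
  assumes G: "group G" "finite (carrier G)"
    and \<pi>: "\<pi> permutes A" "finite A" and a: "a \<in> A \<rightarrow> carrier G"
    and clr: "\<And>i. i \<in> A \<Longrightarrow> clr (\<pi> i) = clr i"
  shows "(\<Sum>K\<in>conj_classes G. \<Sum>\<^sub># (cycle_type G A clr a \<pi> (j, K))) = card {i \<in> A. clr i = j}"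
proof -
  have fin: "finite (conj_classes G)" using G(2) by (simp add: conj_classes_def)
  have "(\<Sum>K\<in>conj_classes G. \<Sum>\<^sub># (cycle_type G A clr a \<pi> (j, K))) =
      (\<Sum>K\<in>conj_classes G. card {i \<in> A. clr i = j \<and> cycle_class G a \<pi> i = K})"
    by (simp add: sum_mset_cycle_type[where clr = clr, OF G(1) \<pi> a] clr)
  also have "\<dots> = card (\<Union>K\<in>conj_classes G. {i \<in> A. clr i = j \<and> cycle_class G a \<pi> i = K})"
    by (rule card_UN_disjoint[symmetric]) (use fin \<pi>(2) in auto)
  also have "(\<Union>K\<in>conj_classes G. {i \<in> A. clr i = j \<and> cycle_class G a \<pi> i = K}) = {i \<in> A. clr i = j}"
    using cycle_class_in_conj_classes[OF G(1) \<pi>(1) a] by auto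
  finally show ?thesis .
qed

lemma zero_notin_cycle_type:
  assumes "\<pi> permutes A" "finite A"
  shows "0 \<notin># cycle_type G A clr a \<pi> q"
proof
  assume "0 \<in># cycle_type G A clr a \<pi> q"
  then obtain i where "card (orbit \<pi> i) = 0" using assms(2) by (auto simp: cycle_type_def)
  then show False using card_orbit_pos[OF assms, of i] by simp
qed

lemma cycle_type_eq_empty:
  assumes "group G" "\<pi> permutes A" "finite A" "a \<in> A \<rightarrow> carrier G"
    and "q \<notin> clr ` A \<times> conj_classes G"
  shows "cycle_type G A clr a \<pi> q = {#}"
proof -
  have "{i \<in> A. (clr i, cycle_class G a \<pi> i) = q} = {}"
    using assms(5) cycle_class_in_conj_classes[OF assms(1,2,4)] by auto
  then show ?thesis unfolding cycle_type_def by (simp only: image_empty) simp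
qed

text \<open>The permutation is first built on formal points, where every cycle is a rotation of an
  initial segment of the natural numbers. Since the numbers of points of each colour agree, it can
  be transferred to \<open>A\<close> with colours respected and trivial gauge.\<close>

lemma cycle_type_realization:
  fixes T :: "'c \<times> 'a set \<Rightarrow> nat multiset" and A :: "'i set" and G :: "('a, 'b) monoid_scheme"
  assumes G: "group G" "finite (carrier G)" and A: "finite A" and J: "finite J" "clr ` A \<subseteq> J"
    and T0: "\<And>q. 0 \<notin># T q"
    and Tsupp: "\<And>q. q \<notin> J \<times> conj_classes G \<Longrightarrow> T q = {#}"
    and Tsum: "\<And>j. j \<in> J \<Longrightarrow> (\<Sum>K\<in>conj_classes G. \<Sum>\<^sub># (T (j, K))) = card {i \<in> A. clr i = j}"
  obtains \<pi> a where "\<pi> permutes A" "a \<in> A \<rightarrow> carrier G" "\<forall>i\<in>A. clr (\<pi> i) = clr i"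
    "cycle_type G A clr a \<pi> = T"
proof -
  interpret group G by (rule G(1))
  \<comment> \<open>\<open>L q\<close> lists the prescribed lengths in some order, so that cycles of
    equal length are told apart by their index \<open>s\<close>.\<close>
  define L where "L q = (SOME xs. mset xs = T q)" for q
  have L: "mset (L q) = T q" for q unfolding L_def by (rule someI_ex) (rule ex_mset)
  have Lpos: "0 < L q ! s" if "s < length (L q)" for q s
    using T0[of q] nth_mem[OF that] by (simp flip: L) (metis gr0I)
  define rp where "rp K = (SOME g. g \<in> carrier G \<and> conj_class G g = K)" for K
  have rp: "rp K \<in> carrier G \<and> conj_class G (rp K) = K" if "K \<in> conj_classes G" for K
    unfolding rp_def by (rule someI_ex) (use that in \<open>auto simp: conj_classes_def\<close>)
  have finK: "finite (conj_classes G)" using G(2) by (simp add: conj_classes_def)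
  \<comment> \<open>a triple \<open>(q, s, m)\<close> is the \<open>m\<close>-th point of the \<open>s\<close>-th cycle with label \<open>q\<close>\<close>
  define D where "D = (SIGMA q : J \<times> conj_classes G. SIGMA s : {..<length (L q)}. {..<L q ! s})"
  have D: "(q, s, m) \<in> D \<longleftrightarrow> q \<in> J \<times> conj_classes G \<and> s < length (L q) \<and> m < L q ! s" for q s m
    by (auto simp: D_def)
  have finD: "finite D" unfolding D_def using J finK by auto
  define \<pi>0 where "\<pi>0 x = (if x \<in> D then (case x of (q, s, m) \<Rightarrow> (q, s, Suc m mod L q ! s)) else x)" for x
  have \<pi>0: "\<pi>0 (q, s, m) = (q, s, Suc m mod L q ! s)" if "(q, s, m) \<in> D" for q s m
    using that by (simp add: \<pi>0_def)
  have \<pi>0D: "\<pi>0 x \<in> D" if "x \<in> D" for x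
    using that Lpos by (cases x) (auto simp: \<pi>0 D)
  have "D \<subseteq> \<pi>0 ` D"
  proof
    fix x assume x: "x \<in> D"
    obtain q s m where qsm: "x = (q, s, m)" by (cases x)
    have m: "m < L q ! s" using x by (simp add: qsm D)
    let ?m = "if m = 0 then L q ! s - 1 else m - 1"
    have "(q, s, ?m) \<in> D" "Suc ?m mod L q ! s = m" using x m by (auto simp: qsm D)
    then have "\<pi>0 (q, s, ?m) = x" by (simp only: \<pi>0 qsm)
    then show "x \<in> \<pi>0 ` D" using \<open>(q, s, ?m) \<in> D\<close> by (metis imageI)
  qed
  then have im: "\<pi>0 ` D = D" using \<pi>0D by blast
  then have "bij_betw \<pi>0 D D"
    using eq_card_imp_inj_on[OF finD, of \<pi>0] by (simp add: bij_betw_def)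
  then have perm: "\<pi>0 permutes D" by (rule bij_imp_permutes) (simp add: \<pi>0_def)
  \<comment> \<open>Each cycle carries a representative of its class on the arrow into point 0 and
    the identity elsewhere, so the holonomy from point 0 is this representative.\<close>
  define a0 where "a0 = (\<lambda>(q :: 'c \<times> 'a set, s :: nat, m :: nat). if m = 0 then rp (snd q) else \<one>\<^bsub>G\<^esub>)"
  define clr0 where "clr0 = (\<lambda>(q :: 'c \<times> 'a set, s :: nat, m :: nat). fst q)"
  have a0: "a0 \<in> D \<rightarrow> carrier G"
    using rp by (auto simp: a0_def D)
  have clr0: "clr0 (\<pi>0 x) = clr0 x" if "x \<in> D" for x
    using that by (cases x) (auto simp: clr0_def \<pi>0)
  have pow: "(\<pi>0 ^^ k) (q, s, m) = (q, s, (m + k) mod L q ! s)" if x: "(q, s, m) \<in> D" for q s m k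
  proof (induction k)
    case 0
    show ?case using x by (simp add: D)
  next
    case (Suc k)
    have "(q, s, (m + k) mod L q ! s) \<in> D" using x Lpos by (auto simp: D)
    then show ?case using Suc by (simp add: \<pi>0 mod_Suc_eq)
  qed
  have orb: "orbit \<pi>0 (q, s, m) = {q} \<times> {s} \<times> {..<L q ! s}" if x: "(q, s, m) \<in> D" for q s m
  proof -
    have m: "m < L q ! s" using x by (simp add: D)
    have "permutation \<pi>0" using perm finD by (auto simp: permutation_permutes)
    then have "orbit \<pi>0 (q, s, m) = {(q, s, (m + k) mod L q ! s) | k. True}"
      by (simp add: orbit_altdef_permutation pow[OF x])
    also have "\<dots> = {q} \<times> {s} \<times> {..<L q ! s}"
    proof -
      have "\<exists>k. m' = (m + k) mod L q ! s" if "m' < L q ! s" for m'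
        using m that by (intro exI[of _ "m' + (L q ! s - m)"]) simp
      then show ?thesis using m by auto
    qed
    finally show ?thesis .
  qed
  have cls: "cycle_class G a0 \<pi>0 (q, s, m) = snd q" if x: "(q, s, m) \<in> D" for q s m
  proof -
    let ?l = "L q ! s"
    have base: "(q, s, 0) \<in> D" using x Lpos by (auto simp: D)
    have K: "snd q \<in> conj_classes G" using x by (auto simp: D)
    have l: "0 < ?l" using x by (auto simp: D)
    have "cycle_class G a0 \<pi>0 (q, s, m) = cycle_class G a0 \<pi>0 (q, s, 0)"
    proof (rule orbit_invariant[OF perm finD _ base])
      show "(q, s, m) \<in> orbit \<pi>0 (q, s, 0)" using x by (simp add: orb[OF base] D)
    qed (rule cycle_class_step[OF G(1) perm finD a0])
    \<comment> \<open>A walk from point 0 meets point 0 again only in the last step of the turn; up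
      to then the transport is trivial.\<close>
    moreover have tr: "k < ?l \<Longrightarrow> transport G a0 \<pi>0 k (q, s, 0) = \<one>\<^bsub>G\<^esub>" for k
    proof (induction k)
      case (Suc k)
      have "(\<pi>0 ^^ Suc k) (q, s, 0) = (q, s, Suc k)" using pow[OF base, of "Suc k"] Suc.prems by simp
      then show ?case using Suc by (simp add: a0_def del: funpow.simps)
    qed simp
    have "transport G a0 \<pi>0 ?l (q, s, 0) = rp (snd q)"
    proof -
      obtain k where k: "?l = Suc k" using l by (cases ?l) auto
      have "(\<pi>0 ^^ Suc k) (q, s, 0) = (q, s, 0)" using pow[OF base, of "Suc k"] k by simp
      then show ?thesis using tr[of k] k rp[OF K] by (simp add: a0_def del: funpow.simps)
    qed
    moreover have "card (orbit \<pi>0 (q, s, 0)) = ?l" by (simp add: orb[OF base] card_cartesian_product)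
    ultimately show ?thesis using rp[OF K] by (simp add: cycle_class_def)
  qed
  have type: "cycle_type G D clr0 a0 \<pi>0 q = T q" for q
  proof (cases "q \<in> J \<times> conj_classes G")
    case False
    have "clr0 ` D \<subseteq> J" by (auto simp: clr0_def D)
    then have "q \<notin> clr0 ` D \<times> conj_classes G" using False by (cases q) auto
    then show ?thesis using cycle_type_eq_empty[OF G(1) perm finD a0] Tsupp[OF False] by simp
  next
    case True
    let ?f = "\<lambda>s. {q} \<times> {s} \<times> {..<L q ! s}"
    have "orbit \<pi>0 ` {x \<in> D. (clr0 x, cycle_class G a0 \<pi>0 x) = q} = ?f ` {..<length (L q)}"
    proof
      show "orbit \<pi>0 ` {x \<in> D. (clr0 x, cycle_class G a0 \<pi>0 x) = q} \<subseteq> ?f ` {..<length (L q)}"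
      proof
        fix X assume "X \<in> orbit \<pi>0 ` {x \<in> D. (clr0 x, cycle_class G a0 \<pi>0 x) = q}"
        then obtain x where xD: "x \<in> D" and X: "X = orbit \<pi>0 x"
          and q: "(clr0 x, cycle_class G a0 \<pi>0 x) = q" by blast
        obtain q' s m where x: "x = (q', s, m)" by (cases x)
        have "q = q'" using q cls[OF xD[unfolded x]] by (simp add: clr0_def x prod_eq_iff)
        then show "X \<in> ?f ` {..<length (L q)}"
          using xD orb[OF xD[unfolded x]] by (auto simp: X x D)
      qed
      show "?f ` {..<length (L q)} \<subseteq> orbit \<pi>0 ` {x \<in> D. (clr0 x, cycle_class G a0 \<pi>0 x) = q}"
      proof
        fix X assume "X \<in> ?f ` {..<length (L q)}"
        then obtain s where s: "s < length (L q)" "X = ?f s" by blast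
        then have x: "(q, s, 0) \<in> D" using True Lpos by (simp add: D)
        have "X = orbit \<pi>0 (q, s, 0)" using orb[OF x] s by simp
        moreover have "(clr0 (q, s, 0), cycle_class G a0 \<pi>0 (q, s, 0)) = q"
          using cls[OF x] by (simp add: clr0_def)
        ultimately show "X \<in> orbit \<pi>0 ` {x \<in> D. (clr0 x, cycle_class G a0 \<pi>0 x) = q}"
          using x by blast
      qed
    qed
    moreover have "inj_on ?f {..<length (L q)}"
    proof (rule inj_onI)
      fix s t assume s: "s \<in> {..<length (L q)}" and eq: "?f s = ?f t"
      have "(q, s, 0) \<in> ?f s" using Lpos s by simp
      then have "(q, s, 0) \<in> ?f t" by (simp only: eq)
      then show "s = t" by simp
    qed
    ultimately have "cycle_type G D clr0 a0 \<pi>0 q = image_mset card (image_mset ?f (mset_set {..<length (L q)}))"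
      by (simp add: cycle_type_def image_mset_mset_set)
    also have "\<dots> = image_mset ((!) (L q)) (mset_set {..<length (L q)})"
      unfolding multiset.map_comp by (rule image_mset_cong) (simp add: card_cartesian_product)
    also have "\<dots> = mset (map ((!) (L q)) [0..<length (L q)])"
      by (simp add: lessThan_atLeast0)
    also have "\<dots> = T q" by (simp only: map_nth L)
    finally show ?thesis .
  qed
  \<comment> \<open>Applied to the formal points, \<open>sum_cycle_type\<close> expresses their
    number of each colour by \<open>T\<close>, which meets the hypothesis \<open>Tsum\<close>. For
    colours outside \<open>J\<close> both sides are 0.\<close>
  have "card {x \<in> D. clr0 x = j} = card {i \<in> A. clr i = j}" for j
  proof (cases "j \<in> J")
    case True
    then show ?thesis
      using sum_cycle_type[OF G perm finD a0, of clr0 j] clr0 Tsum by (simp add: type)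
  next
    case False
    then have "{x \<in> D. clr0 x = j} = {}" "{i \<in> A. clr i = j} = {}"
      using J(2) by (auto simp: D clr0_def)
    then show ?thesis by (simp only: card.empty)
  qed
  then obtain \<phi> where \<phi>: "bij_betw \<phi> D A" and \<phi>clr: "\<forall>x\<in>D. clr (\<phi> x) = clr0 x"
    using exists_fiber_bijection[OF finD A, of clr0 clr] by blast
  define \<psi> where "\<psi> = inv_into D \<phi>"
  have \<psi>: "bij_betw \<psi> A D" unfolding \<psi>_def by (rule bij_betw_inv_into[OF \<phi>])
  have \<psi>\<phi>: "\<psi> (\<phi> x) = x" if "x \<in> D" for x
    unfolding \<psi>_def by (rule inv_into_f_f[OF bij_betw_imp_inj_on[OF \<phi>] that])
  define \<pi> where "\<pi> i = (if i \<in> A then \<phi> (\<pi>0 (\<psi> i)) else i)" for i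
  define a where "a i = a0 (\<psi> i)" for i
  have \<phi>A: "\<phi> x \<in> A" if "x \<in> D" for x using bij_betwE[OF \<phi>] that by blast
  have \<psi>D: "\<psi> i \<in> D" if "i \<in> A" for i using bij_betwE[OF \<psi>] that by blast
  have "bij_betw (\<phi> \<circ> (\<pi>0 \<circ> \<psi>)) A A"
    by (rule bij_betw_trans[OF bij_betw_trans[OF \<psi> \<open>bij_betw \<pi>0 D D\<close>] \<phi>])
  then have "bij_betw \<pi> A A" by (rule bij_betw_cong[THEN iffD1, rotated]) (simp add: \<pi>_def)
  then have \<pi>: "\<pi> permutes A" by (rule bij_imp_permutes) (simp add: \<pi>_def)
  have a: "a \<in> A \<rightarrow> carrier G" using a0 \<psi>D by (auto simp: a_def)
  have "cycle_iso G D clr0 a0 \<pi>0 A clr a \<pi> \<phi> (\<lambda>_. \<one>\<^bsub>G\<^esub>)"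
    unfolding cycle_iso_def
  proof (intro conjI ballI)
    show "bij_betw \<phi> D A" by (rule \<phi>)
    show "(\<lambda>_. \<one>\<^bsub>G\<^esub>) \<in> D \<rightarrow> carrier G" by simp
    fix x assume x: "x \<in> D"
    show "clr (\<phi> x) = clr0 x" using \<phi>clr x by blast
    show eq: "\<phi> (\<pi>0 x) = \<pi> (\<phi> x)" using x \<phi>A by (simp add: \<pi>_def \<psi>\<phi>)
    have "a0 (\<pi>0 x) \<in> carrier G" using a0 \<pi>0D[OF x] by blast
    then show "\<one>\<^bsub>G\<^esub> \<otimes>\<^bsub>G\<^esub> a0 (\<pi>0 x) = a (\<pi> (\<phi> x)) \<otimes>\<^bsub>G\<^esub> \<one>\<^bsub>G\<^esub>"
      using \<pi>0D[OF x] by (simp add: a_def \<psi>\<phi> flip: eq)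
  qed
  then have "cycle_type G D clr0 a0 \<pi>0 = cycle_type G A clr a \<pi>"
    by (rule cycle_iso_imp_cycle_type_eq[OF G(1) perm finD a0 \<pi> A a])
  then have "cycle_type G A clr a \<pi> = cycle_type G D clr0 a0 \<pi>0" ..
  also have "\<dots> = T" using type by (rule ext)
  finally have "cycle_type G A clr a \<pi> = T" .
  moreover have "\<forall>i\<in>A. clr (\<pi> i) = clr i"
  proof
    fix i assume i: "i \<in> A"
    have "\<phi> (\<psi> i) = i" unfolding \<psi>_def by (rule bij_betw_inv_into_right[OF \<phi> i])
    then show "clr (\<pi> i) = clr i"
      using i \<phi>clr \<psi>D[OF i] \<pi>0D[OF \<psi>D[OF i]] clr0[OF \<psi>D[OF i]] by (metis \<pi>_def)
  qed
  ultimately show thesis using \<pi> a by (intro that)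
qed

section \<open>Counting cycle types\<close>

text \<open>Partitions are weakly decreasing lists, so the inverse map sorts and then
  reverses.\<close>

lemma bij_betw_partitions_multisets:
  "bij_betw mset {\<alpha>. is_partition \<alpha> k} {M. 0 \<notin># M \<and> \<Sum>\<^sub># M = k}"
proof (rule bij_betw_byWitness[where f' = "\<lambda>M. rev (sorted_list_of_multiset M)"])
  have desc: "sorted_wrt (\<ge>) xs \<longleftrightarrow> sorted (rev xs)" for xs :: "nat list"
    by (simp add: sorted_wrt_rev)
  show "\<forall>\<alpha>\<in>{\<alpha>. is_partition \<alpha> k}. rev (sorted_list_of_multiset (mset \<alpha>)) = \<alpha>"
  proof
    fix \<alpha> assume "\<alpha> \<in> {\<alpha>. is_partition \<alpha> k}"
    then have "sorted (rev \<alpha>)" by (simp add: is_partition_def desc)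
    then have "sort \<alpha> = rev \<alpha>" by (intro properties_for_sort) simp_all
    then show "rev (sorted_list_of_multiset (mset \<alpha>)) = \<alpha>" by simp
  qed
  show "\<forall>M\<in>{M. 0 \<notin># M \<and> \<Sum>\<^sub># M = k}. mset (rev (sorted_list_of_multiset M)) = M"
    by simp
  show "mset ` {\<alpha>. is_partition \<alpha> k} \<subseteq> {M. 0 \<notin># M \<and> \<Sum>\<^sub># M = k}"
    by (auto simp: is_partition_def sum_mset_sum_list)
  show "(\<lambda>M. rev (sorted_list_of_multiset M)) ` {M. 0 \<notin># M \<and> \<Sum>\<^sub># M = k} \<subseteq> {\<alpha>. is_partition \<alpha> k}"
  proof (rule image_subsetI)
    fix M :: "nat multiset" assume M: "M \<in> {M. 0 \<notin># M \<and> \<Sum>\<^sub># M = k}"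
    have "sum_list (sorted_list_of_multiset M) = \<Sum>\<^sub># M"
      by (metis mset_sorted_list_of_multiset sum_mset_sum_list)
    then show "rev (sorted_list_of_multiset M) \<in> {\<alpha>. is_partition \<alpha> k}"
      using M by (auto simp: is_partition_def desc sum_list_rev intro: gr0I)
  qed
qed

lemma card_partition_multisets: "card {M. 0 \<notin># M \<and> \<Sum>\<^sub># M = k} = num_partitions k"
  using bij_betw_same_card[OF bij_betw_partitions_multisets[of k]] by (simp add: num_partitions_def)

lemma finite_partition_multisets: "finite {M. 0 \<notin># M \<and> \<Sum>\<^sub># M = (k :: nat)}"
  using bij_betw_finite[OF bij_betw_partitions_multisets[of k]] finite_partitions by simp

text \<open>These are the \<open>h\<close>-tuples of partitions of total size \<open>m\<close>,
  coded as extensional functions so that each tuple is counted once.\<close>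

definition multiset_families :: "nat \<Rightarrow> nat \<Rightarrow> (nat \<Rightarrow> nat multiset) set" where
  "multiset_families h m = {F \<in> {..<h} \<rightarrow>\<^sub>E {M. 0 \<notin># M}. (\<Sum>i<h. \<Sum>\<^sub># (F i)) = m}"

text \<open>Grouping the tuples by the list of their sizes gives one product of partition numbers
  for each weak composition.\<close>

lemma card_multiset_families:
  "card (multiset_families h m) = (\<Sum>\<beta>\<in>weak_compositions h m. \<Prod>i<h. num_partitions (\<beta> ! i))"
proof -
  let ?P = "\<lambda>k. {M. 0 \<notin># M \<and> \<Sum>\<^sub># M = (k :: nat)}"
  let ?E = "\<lambda>\<beta>. PiE {..<h} (\<lambda>i. ?P (\<beta> ! i))"
  have "multiset_families h m = (\<Union>\<beta>\<in>weak_compositions h m. ?E \<beta>)"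
  proof
    show "multiset_families h m \<subseteq> (\<Union>\<beta>\<in>weak_compositions h m. ?E \<beta>)"
    proof
      fix F assume F: "F \<in> multiset_families h m"
      let ?\<beta> = "map (\<lambda>i. \<Sum>\<^sub># (F i)) [0..<h]"
      have "?\<beta> \<in> weak_compositions h m"
        using F by (simp add: weak_compositions_def multiset_families_def
            interv_sum_list_conv_sum_set_nat lessThan_atLeast0)
      moreover have "F \<in> ?E ?\<beta>"
        using F by (auto simp: multiset_families_def PiE_iff)
      ultimately show "F \<in> (\<Union>\<beta>\<in>weak_compositions h m. ?E \<beta>)" by blast
    qed
    show "(\<Union>\<beta>\<in>weak_compositions h m. ?E \<beta>) \<subseteq> multiset_families h m"
    proof
      fix F assume "F \<in> (\<Union>\<beta>\<in>weak_compositions h m. ?E \<beta>)"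
      then obtain \<beta> where \<beta>: "\<beta> \<in> weak_compositions h m" "F \<in> ?E \<beta>" by blast
      have "(\<Sum>i<h. \<Sum>\<^sub># (F i)) = (\<Sum>i<h. \<beta> ! i)"
        using \<beta>(2) by (intro sum.cong) (auto simp: PiE_iff)
      also have "\<dots> = m"
        using \<beta>(1) by (auto simp: weak_compositions_def sum_list_sum_nth lessThan_atLeast0)
      finally show "F \<in> multiset_families h m"
        using \<beta>(2) by (auto simp: multiset_families_def PiE_iff)
    qed
  qed
  moreover have "card (\<Union>\<beta>\<in>weak_compositions h m. ?E \<beta>) = (\<Sum>\<beta>\<in>weak_compositions h m. card (?E \<beta>))"
  proof (rule card_UN_disjoint)
    show "finite (weak_compositions h m)" by (rule finite_weak_compositions)
    show "\<forall>\<beta>\<in>weak_compositions h m. finite (?E \<beta>)"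
      by (intro ballI finite_PiE finite_partition_multisets) simp
    show "\<forall>\<beta>\<in>weak_compositions h m. \<forall>\<gamma>\<in>weak_compositions h m. \<beta> \<noteq> \<gamma> \<longrightarrow> ?E \<beta> \<inter> ?E \<gamma> = {}"
    proof (intro ballI impI)
      fix \<beta> \<gamma> assume wc: "\<beta> \<in> weak_compositions h m" "\<gamma> \<in> weak_compositions h m" and ne: "\<beta> \<noteq> \<gamma>"
      have False if F: "F \<in> ?E \<beta>" "F \<in> ?E \<gamma>" for F
      proof -
        have "\<beta> ! i = \<gamma> ! i" if "i < h" for i
          using F that by (auto simp: PiE_iff)
        then have "\<beta> = \<gamma>" using wc by (intro nth_equalityI) (auto simp: weak_compositions_def)
        then show False using ne by simp
      qed
      then show "?E \<beta> \<inter> ?E \<gamma> = {}" by blast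
    qed
  qed
  ultimately show ?thesis by (simp add: card_PiE card_partition_multisets)
qed

text \<open>The functions are total, with the empty multiset as default, because
  \<open>cycle_type\<close> produces functions of this kind.\<close>

definition cycle_types :: "nat list \<Rightarrow> 'k set \<Rightarrow> (nat \<times> 'k \<Rightarrow> nat multiset) set" where
  "cycle_types \<alpha> C = {T. (\<forall>q. 0 \<notin># T q) \<and> (\<forall>q. q \<notin> {..<length \<alpha>} \<times> C \<longrightarrow> T q = {#}) \<and>
     (\<forall>j<length \<alpha>. (\<Sum>K\<in>C. \<Sum>\<^sub># (T (j, K))) = \<alpha> ! j)}"

lemma card_cycle_types:
  assumes C: "finite C"
  shows "card (cycle_types \<alpha> C) = (\<Prod>j<length \<alpha>. card (multiset_families (card C) (\<alpha> ! j)))"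
proof -
  let ?h = "card C" and ?l = "length \<alpha>"
  let ?R = "PiE {..<?l} (\<lambda>j. multiset_families ?h (\<alpha> ! j))"
  obtain \<kappa> where \<kappa>: "bij_betw \<kappa> {..<?h} C"
    using ex_bij_betw_nat_finite[OF C] unfolding lessThan_atLeast0 by blast
  define \<iota> where "\<iota> = inv_into {..<?h} \<kappa>"
  have \<kappa>C: "\<kappa> i \<in> C" if "i < ?h" for i using bij_betwE[OF \<kappa>] that by blast
  have \<iota>\<kappa>: "\<iota> (\<kappa> i) = i" if "i < ?h" for i
    unfolding \<iota>_def by (rule inv_into_f_f[OF bij_betw_imp_inj_on[OF \<kappa>]]) (use that in simp)
  have \<kappa>\<iota>: "\<kappa> (\<iota> K) = K" if "K \<in> C" for K
    unfolding \<iota>_def by (rule bij_betw_inv_into_right[OF \<kappa> that])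
  have \<iota>h: "\<iota> K < ?h" if "K \<in> C" for K
    using bij_betwE[OF bij_betw_inv_into[OF \<kappa>]] that by (auto simp: \<iota>_def)
  \<comment> \<open>\<open>\<Psi>\<close> curries and numbers the elements of \<open>C\<close>. It
    also exchanges the default outside the index sets, the empty multiset, for
    \<open>undefined\<close>; \<open>\<Theta>\<close> changes it back.\<close>
  define \<Psi> where "\<Psi> T = (\<lambda>j\<in>{..<?l}. \<lambda>i\<in>{..<?h}. T (j, \<kappa> i))" for T :: "nat \<times> 'a \<Rightarrow> nat multiset"
  define \<Theta> where "\<Theta> F = (\<lambda>(j, K). if j < ?l \<and> K \<in> C then F j (\<iota> K) else {#})"
    for F :: "nat \<Rightarrow> nat \<Rightarrow> nat multiset"
  have sumC: "(\<Sum>K\<in>C. f K) = (\<Sum>i<?h. f (\<kappa> i))" for f :: "'a \<Rightarrow> nat"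
    by (rule sum.reindex_bij_betw[OF \<kappa>, symmetric])
  have "bij_betw \<Psi> (cycle_types \<alpha> C) ?R"
  proof (rule bij_betw_byWitness[where f' = \<Theta>])
    show "\<forall>T\<in>cycle_types \<alpha> C. \<Theta> (\<Psi> T) = T"
      using \<iota>h \<kappa>\<iota> by (auto simp: \<Theta>_def \<Psi>_def cycle_types_def fun_eq_iff)
    show "\<forall>F\<in>?R. \<Psi> (\<Theta> F) = F"
    proof
      fix F assume F: "F \<in> ?R"
      show "\<Psi> (\<Theta> F) = F"
      proof (intro ext)
        fix j i
        show "\<Psi> (\<Theta> F) j i = F j i"
        proof (cases "j < ?l")
          case True
          then have "F j \<in> multiset_families ?h (\<alpha> ! j)" using F by auto
          then have "F j i = undefined" if "\<not> i < ?h"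
            using that by (auto simp: multiset_families_def PiE_iff extensional_def)
          then show ?thesis using True \<kappa>C \<iota>\<kappa> by (auto simp: \<Psi>_def \<Theta>_def)
        next
          case False
          then have "F j = undefined" using F by (auto simp: PiE_iff extensional_def)
          then show ?thesis using False by (simp add: \<Psi>_def)
        qed
      qed
    qed
    show "\<Psi> ` cycle_types \<alpha> C \<subseteq> ?R"
      by (auto simp: \<Psi>_def cycle_types_def multiset_families_def sumC split: if_splits)
    show "\<Theta> ` ?R \<subseteq> cycle_types \<alpha> C"
    proof (rule image_subsetI)
      fix F assume F: "F \<in> ?R"
      then have Fj: "F j \<in> multiset_families ?h (\<alpha> ! j)" if "j < ?l" for j using that by auto
      have "0 \<notin># \<Theta> F q" for q
        using Fj \<iota>h by (cases q) (auto simp: \<Theta>_def multiset_families_def PiE_iff)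
      moreover have "(\<Sum>K\<in>C. \<Sum>\<^sub># (\<Theta> F (j, K))) = \<alpha> ! j" if "j < ?l" for j
      proof -
        have "(\<Sum>K\<in>C. \<Sum>\<^sub># (\<Theta> F (j, K))) = (\<Sum>i<?h. \<Sum>\<^sub># (F j i))"
          unfolding sumC using that \<kappa>C \<iota>\<kappa> by (intro sum.cong) (auto simp: \<Theta>_def)
        then show ?thesis using Fj[OF that] by (simp add: multiset_families_def)
      qed
      moreover have "\<Theta> F q = {#}" if "q \<notin> {..<?l} \<times> C" for q
        using that by (cases q) (auto simp: \<Theta>_def)
      ultimately show "\<Theta> F \<in> cycle_types \<alpha> C" by (simp add: cycle_types_def)
    qed
  qed
  then have "card (cycle_types \<alpha> C) = card ?R" by (rule bij_betw_same_card)
  then show ?thesis by (simp add: card_PiE)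
qed

section \<open>Wreath products with Young subgroups\<close>

text \<open>For positive \<open>i\<close> the least index is right even if some parts are 0: their
  blocks are empty and are never selected.\<close>

definition block_index :: "nat list \<Rightarrow> nat \<Rightarrow> nat" where
  "block_index \<alpha> i = (LEAST j. i \<le> sum_list (take (Suc j) \<alpha>))"

lemma sum_list_take_mono: "j \<le> k \<Longrightarrow> sum_list (take j \<alpha>) \<le> sum_list (take k (\<alpha> :: nat list))"
  using take_add[of j "k - j" \<alpha>] by simp

lemma block_index_eq:
  assumes "i \<in> block \<alpha> j"
  shows "block_index \<alpha> i = j"
  unfolding block_index_def
proof (rule Least_equality)
  show "i \<le> sum_list (take (Suc j) \<alpha>)" using assms by (simp add: block_def)
  fix k assume k: "i \<le> sum_list (take (Suc k) \<alpha>)"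
  show "j \<le> k"
  proof (rule ccontr)
    assume "\<not> j \<le> k"
    then have "sum_list (take (Suc k) \<alpha>) \<le> sum_list (take j \<alpha>)" by (intro sum_list_take_mono) simp
    then show False using assms k by (simp add: block_def)
  qed
qed

lemma block_index_mem:
  assumes i: "i \<in> {1..sum_list \<alpha>}"
  shows "block_index \<alpha> i < length \<alpha>" "i \<in> block \<alpha> (block_index \<alpha> i)"
proof -
  let ?P = "\<lambda>j. i \<le> sum_list (take (Suc j) \<alpha>)"
  have ne: "\<alpha> \<noteq> []" using i by auto
  have last: "?P (length \<alpha> - 1)" using i ne by simp
  have P: "?P (block_index \<alpha> i)" unfolding block_index_def by (rule LeastI[of ?P, OF last])
  have "block_index \<alpha> i \<le> length \<alpha> - 1" unfolding block_index_def by (rule Least_le[of ?P, OF last])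
  then show "block_index \<alpha> i < length \<alpha>" using ne by (cases \<alpha>) auto
  have "sum_list (take (block_index \<alpha> i) \<alpha>) < i"
  proof (cases "block_index \<alpha> i")
    case 0
    then show ?thesis using i by simp
  next
    case (Suc j)
    then have "\<not> ?P j" unfolding block_index_def using not_less_Least[of j ?P] by simp
    then show ?thesis using Suc by simp
  qed
  then show "i \<in> block \<alpha> (block_index \<alpha> i)" using P by (simp add: block_def)
qed

lemma block_subset: "block \<alpha> j \<subseteq> {1..sum_list \<alpha>}"
  using sum_list_take_mono[of "Suc j" "max (Suc j) (length \<alpha>)" \<alpha>] by (auto simp: block_def)

lemma block_eq_fiber: "j < length \<alpha> \<Longrightarrow> {i \<in> {1..sum_list \<alpha>}. block_index \<alpha> i = j} = block \<alpha> j"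
  using block_subset[of \<alpha> j] block_index_eq[of _ \<alpha> j] block_index_mem(2)[of _ \<alpha>] by blast

lemma card_block: "j < length \<alpha> \<Longrightarrow> card (block \<alpha> j) = \<alpha> ! j"
  by (simp add: block_def take_Suc_conv_app_nth)

text \<open>The blocks are the fibres of \<open>block_index\<close>, so preserving blocks means
  preserving colours, the form needed for cycle types. In the converse direction, finiteness
  upgrades the inclusion of the image of a block to equality.\<close>

lemma young_subgroup_iff:
  "p \<in> young_subgroup \<alpha> \<longleftrightarrow>
     p permutes {1..sum_list \<alpha>} \<and> (\<forall>i\<in>{1..sum_list \<alpha>}. block_index \<alpha> (p i) = block_index \<alpha> i)"
proof (intro iffI conjI ballI)
  assume p: "p \<in> young_subgroup \<alpha>"
  then show "p permutes {1..sum_list \<alpha>}" by (simp add: young_subgroup_def)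
  fix i assume i: "i \<in> {1..sum_list \<alpha>}"
  have "p ` block \<alpha> (block_index \<alpha> i) = block \<alpha> (block_index \<alpha> i)"
    using p block_index_mem(1)[OF i] by (simp add: young_subgroup_def)
  then have "p i \<in> block \<alpha> (block_index \<alpha> i)" using block_index_mem(2)[OF i] by blast
  then show "block_index \<alpha> (p i) = block_index \<alpha> i" by (rule block_index_eq)
next
  assume p: "p permutes {1..sum_list \<alpha>} \<and> (\<forall>i\<in>{1..sum_list \<alpha>}. block_index \<alpha> (p i) = block_index \<alpha> i)"
  have "p ` block \<alpha> j = block \<alpha> j" if j: "j < length \<alpha>" for j
  proof (rule endo_inj_surj)
    show "finite (block \<alpha> j)" by (simp add: block_def)
    show "inj_on p (block \<alpha> j)" using p permutes_inj inj_on_subset by blast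
    show "p ` block \<alpha> j \<subseteq> block \<alpha> j"
    proof (rule image_subsetI)
      fix i assume i: "i \<in> block \<alpha> j"
      then have iA: "i \<in> {1..sum_list \<alpha>}" using block_subset by blast
      then have "p i \<in> {1..sum_list \<alpha>}" using p permutes_in_image by metis
      moreover have "block_index \<alpha> (p i) = j" using p iA block_index_eq[OF i] by simp
      ultimately show "p i \<in> block \<alpha> j" using block_index_mem(2) by metis
    qed
  qed
  then show "p \<in> young_subgroup \<alpha>" using p by (simp add: young_subgroup_def)
qed

section \<open>Conjugacy classes of wreath products\<close>

text \<open>Lets one complete invariant be counted in place of another: below, cycle types in place
  of conjugacy classes.\<close>

lemma card_image_eq_of_same_kernel:
  assumes "\<And>x y. x \<in> X \<Longrightarrow> y \<in> X \<Longrightarrow> f x = f y \<longleftrightarrow> g x = g y"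
  shows "card (f ` X) = card (g ` X)"
proof -
  define h where "h z = g (inv_into X f z)" for z
  have h: "h (f x) = g x" if "x \<in> X" for x
  proof -
    have "inv_into X f (f x) \<in> X" "f (inv_into X f (f x)) = f x"
      using that by (auto intro: inv_into_into f_inv_into_f)
    then show ?thesis using assms that by (simp add: h_def)
  qed
  have "inj_on h (f ` X)" by (rule inj_onI) (use h assms in auto)
  moreover have "h ` f ` X = g ` X" unfolding image_image using h by (rule image_cong[OF refl])
  ultimately show ?thesis by (metis card_image)
qed

lemma wreath_carrier: "carrier (wreath G n H) = ({1..n} \<rightarrow>\<^sub>E carrier G) \<times> H"
  by (simp add: wreath_def)

lemma wreath_mult:
  "(b, \<sigma>) \<otimes>\<^bsub>wreath G n H\<^esub> (a, \<pi>) = (\<lambda>i\<in>{1..n}. b i \<otimes>\<^bsub>G\<^esub> a (inv_into UNIV \<sigma> i), \<sigma> \<circ> \<pi>)"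
  by (simp add: wreath_def)

text \<open>A conjugating element \<open>(b, \<sigma>)\<close> corresponds to the isomorphism
  \<open>\<sigma>\<close> with gauge \<open>c i = b (\<sigma> i)\<close>: entries of the wreath
  product are indexed by the target of \<open>\<sigma>\<close>, gauge values by its source.\<close>

lemma conj_class_wreath_eq_iff:
  fixes \<alpha> :: "nat list" and G :: "('a, 'b) monoid_scheme"
  defines "A \<equiv> {1..sum_list \<alpha>}"
  defines "W \<equiv> wreath G (sum_list \<alpha>) (young_subgroup \<alpha>)"
  assumes G: "group G" and x: "(a, \<pi>) \<in> carrier W" and y: "(a', \<pi>') \<in> carrier W"
  shows "conj_class W (a, \<pi>) = conj_class W (a', \<pi>') \<longleftrightarrow>
    cycle_type G A (block_index \<alpha>) a \<pi> = cycle_type G A (block_index \<alpha>) a' \<pi>'"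
proof -
  interpret group G by (rule G)
  let ?c = "block_index \<alpha>"
  have finA: "finite A" by (simp add: A_def)
  have W: "group W" unfolding W_def by (rule wreath_is_group[OF G young_subgroup_subgroup])
  have W_iff: "(b, \<sigma>) \<in> carrier W \<longleftrightarrow>
      b \<in> A \<rightarrow>\<^sub>E carrier G \<and> \<sigma> permutes A \<and> (\<forall>i\<in>A. ?c (\<sigma> i) = ?c i)" for b \<sigma>
    unfolding W_def A_def by (simp only: wreath_carrier young_subgroup_iff mem_Sigma_iff)
  have W_mult: "(b, \<sigma>) \<otimes>\<^bsub>W\<^esub> (b', \<tau>) = (\<lambda>i\<in>A. b i \<otimes>\<^bsub>G\<^esub> b' (inv_into UNIV \<sigma> i), \<sigma> \<circ> \<tau>)" for b b' \<sigma> \<tau>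
    unfolding W_def A_def by (rule wreath_mult)
  have \<pi>: "\<pi> permutes A" "\<And>i. i \<in> A \<Longrightarrow> ?c (\<pi> i) = ?c i" and a: "a \<in> A \<rightarrow> carrier G"
    using x by (auto simp: W_iff)
  have \<pi>': "\<pi>' permutes A" "\<And>i. i \<in> A \<Longrightarrow> ?c (\<pi>' i) = ?c i" and a': "a' \<in> A \<rightarrow> carrier G"
    using y by (auto simp: W_iff)
  have "(\<exists>g\<in>carrier W. g \<otimes>\<^bsub>W\<^esub> (a, \<pi>) = (a', \<pi>') \<otimes>\<^bsub>W\<^esub> g) \<longleftrightarrow>
      (\<exists>\<sigma> c. cycle_iso G A ?c a \<pi> A ?c a' \<pi>' \<sigma> c)"
  proof
    assume "\<exists>g\<in>carrier W. g \<otimes>\<^bsub>W\<^esub> (a, \<pi>) = (a', \<pi>') \<otimes>\<^bsub>W\<^esub> g"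
    then obtain b \<sigma> where g: "(b, \<sigma>) \<in> carrier W"
      and eq: "(b, \<sigma>) \<otimes>\<^bsub>W\<^esub> (a, \<pi>) = (a', \<pi>') \<otimes>\<^bsub>W\<^esub> (b, \<sigma>)" by auto
    have \<sigma>: "\<sigma> permutes A" "\<And>i. i \<in> A \<Longrightarrow> ?c (\<sigma> i) = ?c i" and b: "b \<in> A \<rightarrow> carrier G"
      using g by (auto simp: W_iff)
    have comm: "\<sigma> \<circ> \<pi> = \<pi>' \<circ> \<sigma>"
      and re: "(\<lambda>i\<in>A. b i \<otimes>\<^bsub>G\<^esub> a (inv_into UNIV \<sigma> i)) = (\<lambda>i\<in>A. a' i \<otimes>\<^bsub>G\<^esub> b (inv_into UNIV \<pi>' i))"
      using eq by (simp_all only: W_mult prod.inject)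
    have "cycle_iso G A ?c a \<pi> A ?c a' \<pi>' \<sigma> (\<lambda>i. b (\<sigma> i))"
      unfolding cycle_iso_def
    proof (intro conjI ballI)
      show "bij_betw \<sigma> A A" by (rule permutes_imp_bij[OF \<sigma>(1)])
      show "(\<lambda>i. b (\<sigma> i)) \<in> A \<rightarrow> carrier G" using b \<sigma>(1) by (auto simp: permutes_in_image)
      fix i assume i: "i \<in> A"
      show "?c (\<sigma> i) = ?c i" by (rule \<sigma>(2)[OF i])
      show eqi: "\<sigma> (\<pi> i) = \<pi>' (\<sigma> i)" using comm by (metis comp_apply)
      have k: "\<sigma> (\<pi> i) \<in> A" using i \<sigma>(1) \<pi>(1) by (simp add: permutes_in_image)
      \<comment> \<open>At the entry with index \<open>\<sigma> (\<pi> i)\<close> both inverse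
        permutations cancel.\<close>
      have "b (\<sigma> (\<pi> i)) \<otimes>\<^bsub>G\<^esub> a (inv_into UNIV \<sigma> (\<sigma> (\<pi> i))) =
          a' (\<sigma> (\<pi> i)) \<otimes>\<^bsub>G\<^esub> b (inv_into UNIV \<pi>' (\<pi>' (\<sigma> i)))"
        using fun_cong[OF re, of "\<sigma> (\<pi> i)"] k by (simp add: eqi)
      then have "b (\<sigma> (\<pi> i)) \<otimes>\<^bsub>G\<^esub> a (\<pi> i) = a' (\<sigma> (\<pi> i)) \<otimes>\<^bsub>G\<^esub> b (\<sigma> i)"
        by (simp only: inv_f_f[OF permutes_inj[OF \<sigma>(1)]] inv_f_f[OF permutes_inj[OF \<pi>'(1)]])
      then show "b (\<sigma> (\<pi> i)) \<otimes>\<^bsub>G\<^esub> a (\<pi> i) = a' (\<pi>' (\<sigma> i)) \<otimes>\<^bsub>G\<^esub> b (\<sigma> i)"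
        by (simp only: eqi)
    qed
    then show "\<exists>\<sigma> c. cycle_iso G A ?c a \<pi> A ?c a' \<pi>' \<sigma> c" by (intro exI)
  next
    assume "\<exists>\<sigma> c. cycle_iso G A ?c a \<pi> A ?c a' \<pi>' \<sigma> c"
    then obtain \<sigma>0 c where iso: "cycle_iso G A ?c a \<pi> A ?c a' \<pi>' \<sigma>0 c" by auto
    \<comment> \<open>An isomorphism may be arbitrary outside \<open>A\<close>, whereas a
      permutation of \<open>A\<close> has to fix every point there.\<close>
    define \<sigma> where "\<sigma> i = (if i \<in> A then \<sigma>0 i else i)" for i
    have "bij_betw \<sigma>0 A A" using iso by (simp add: cycle_iso_def)
    then have "bij_betw \<sigma> A A" by (rule bij_betw_cong[THEN iffD1, rotated]) (simp add: \<sigma>_def)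
    then have \<sigma>: "\<sigma> permutes A" by (rule bij_imp_permutes) (simp add: \<sigma>_def)
    have \<sigma>c: "?c (\<sigma> i) = ?c i" and eqv: "\<sigma> (\<pi> i) = \<pi>' (\<sigma> i)"
      and gauge: "c (\<pi> i) \<otimes>\<^bsub>G\<^esub> a (\<pi> i) = a' (\<pi>' (\<sigma> i)) \<otimes>\<^bsub>G\<^esub> c i" if "i \<in> A" for i
      using iso that \<pi>(1) by (auto simp: cycle_iso_def \<sigma>_def permutes_in_image)
    have c: "c i \<in> carrier G" if "i \<in> A" for i using iso that by (auto simp: cycle_iso_def)
    define b where "b = (\<lambda>i\<in>A. c (inv_into UNIV \<sigma> i))"
    have inv\<sigma>: "inv_into UNIV \<sigma> permutes A" by (rule permutes_inv[OF \<sigma>])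
    have g: "(b, \<sigma>) \<in> carrier W"
      using c \<sigma> \<sigma>c permutes_in_image[OF inv\<sigma>] by (simp add: W_iff b_def)
    have comm: "\<sigma> \<circ> \<pi> = \<pi>' \<circ> \<sigma>"
    proof
      fix i
      show "(\<sigma> \<circ> \<pi>) i = (\<pi>' \<circ> \<sigma>) i"
        using eqv[of i] permutes_not_in[OF \<pi>(1), of i] permutes_not_in[OF \<pi>'(1), of i]
          permutes_not_in[OF \<sigma>, of i] by (cases "i \<in> A") auto
    qed
    have re: "b k \<otimes>\<^bsub>G\<^esub> a (inv_into UNIV \<sigma> k) = a' k \<otimes>\<^bsub>G\<^esub> b (inv_into UNIV \<pi>' k)" if k: "k \<in> A" for k
    proof -
      \<comment> \<open>The position \<open>k\<close> equals \<open>\<sigma> (\<pi> i)\<close> for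
        this \<open>i\<close>, and the gauge condition at \<open>i\<close> is the required equation
        at \<open>k\<close>.\<close>
      define i where "i = inv_into UNIV \<pi> (inv_into UNIV \<sigma> k)"
      have i: "i \<in> A"
        using k by (simp add: i_def permutes_in_image[OF inv\<sigma>] permutes_in_image[OF permutes_inv[OF \<pi>(1)]])
      have \<pi>i: "\<pi> i = inv_into UNIV \<sigma> k"
        by (simp add: i_def surj_f_inv_f[OF permutes_surj[OF \<pi>(1)]])
      have \<sigma>k: "\<sigma> (\<pi> i) = k" by (simp add: \<pi>i surj_f_inv_f[OF permutes_surj[OF \<sigma>]])
      have \<pi>'k: "\<pi>' (\<sigma> i) = k" using eqv[OF i] \<sigma>k by simp
      then have inv: "inv_into UNIV \<pi>' k = \<sigma> i"
        using inv_f_f[OF permutes_inj[OF \<pi>'(1)], of "\<sigma> i"] by simp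
      have "\<sigma> i \<in> A" using i \<sigma> by (simp add: permutes_in_image)
      then have "b (\<sigma> i) = c i" by (simp add: b_def inv_f_f[OF permutes_inj[OF \<sigma>]])
      moreover have "b k = c (\<pi> i)" using k by (simp add: b_def \<pi>i)
      ultimately show ?thesis using gauge[OF i] by (simp add: inv \<pi>'k flip: \<pi>i)
    qed
    have "(\<lambda>i\<in>A. b i \<otimes>\<^bsub>G\<^esub> a (inv_into UNIV \<sigma> i)) = (\<lambda>i\<in>A. a' i \<otimes>\<^bsub>G\<^esub> b (inv_into UNIV \<pi>' i))"
      by (rule restrict_ext) (rule re)
    then have eq: "(b, \<sigma>) \<otimes>\<^bsub>W\<^esub> (a, \<pi>) = (a', \<pi>') \<otimes>\<^bsub>W\<^esub> (b, \<sigma>)"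
      by (simp only: W_mult comm)
    show "\<exists>g\<in>carrier W. g \<otimes>\<^bsub>W\<^esub> (a, \<pi>) = (a', \<pi>') \<otimes>\<^bsub>W\<^esub> g"
      by (rule bexI[where x = "(b, \<sigma>)"]) (rule eq, rule g)
  qed
  also have "\<dots> \<longleftrightarrow> cycle_type G A ?c a \<pi> = cycle_type G A ?c a' \<pi>'"
  proof
    assume "\<exists>\<sigma> c. cycle_iso G A ?c a \<pi> A ?c a' \<pi>' \<sigma> c"
    then obtain \<sigma> c where "cycle_iso G A ?c a \<pi> A ?c a' \<pi>' \<sigma> c" by auto
    then show "cycle_type G A ?c a \<pi> = cycle_type G A ?c a' \<pi>'"
      by (rule cycle_iso_imp_cycle_type_eq[OF G \<pi>(1) finA a \<pi>'(1) finA a'])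
  next
    assume eq: "cycle_type G A ?c a \<pi> = cycle_type G A ?c a' \<pi>'"
    show "\<exists>\<sigma> c. cycle_iso G A ?c a \<pi> A ?c a' \<pi>' \<sigma> c"
      by (rule cycle_type_eq_imp_cycle_iso[OF G \<pi>(1) finA a \<pi>'(1) finA a' _ _ eq])
        (simp_all add: \<pi>(2) \<pi>'(2))
  qed
  finally show ?thesis using conj_class_eq_iff[OF W x y] by simp
qed

text \<open>Since the cycle type is a complete conjugacy invariant, it remains to identify its image
  with \<open>cycle_types\<close>: one inclusion collects the constraints proved above, the other is
  the realisation.\<close>

lemma card_conj_classes_wreath:
  fixes \<alpha> :: "nat list"
  assumes G: "group G" and fin: "finite (carrier G)"
  shows "card (conj_classes (wreath G (sum_list \<alpha>) (young_subgroup \<alpha>))) =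
    (\<Prod>j<length \<alpha>. \<Sum>\<beta>\<in>weak_compositions (card (conj_classes G)) (\<alpha> ! j).
       \<Prod>i<card (conj_classes G). num_partitions (\<beta> ! i))"
proof -
  interpret group G by (rule G)
  let ?A = "{1..sum_list \<alpha>}" and ?c = "block_index \<alpha>"
  let ?W = "wreath G (sum_list \<alpha>) (young_subgroup \<alpha>)"
  define type where "type = (\<lambda>(a, \<pi>). cycle_type G ?A ?c a \<pi>)"
  have finK: "finite (conj_classes G)" using fin by (simp add: conj_classes_def)
  have cA: "?c ` ?A \<subseteq> {..<length \<alpha>}" using block_index_mem(1)[of _ \<alpha>] by blast
  have dest: "\<pi> permutes ?A" "a \<in> ?A \<rightarrow> carrier G" "\<And>i. i \<in> ?A \<Longrightarrow> ?c (\<pi> i) = ?c i"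
    if "(a, \<pi>) \<in> carrier ?W" for a \<pi>
    using that by (auto simp: wreath_carrier young_subgroup_iff)
  have fiber: "card {i \<in> ?A. ?c i = j} = \<alpha> ! j" if "j < length \<alpha>" for j
    using block_eq_fiber[OF that] card_block[OF that] by simp
  have "type ` carrier ?W = cycle_types \<alpha> (conj_classes G)"
  proof
    show "type ` carrier ?W \<subseteq> cycle_types \<alpha> (conj_classes G)"
    proof (rule image_subsetI)
      fix x assume "x \<in> carrier ?W"
      then obtain a \<pi> where x: "x = (a, \<pi>)" "(a, \<pi>) \<in> carrier ?W" by (cases x) auto
      note d = dest[OF x(2)]
      have "cycle_type G ?A ?c a \<pi> q = {#}" if "q \<notin> {..<length \<alpha>} \<times> conj_classes G" for q
      proof (rule cycle_type_eq_empty[OF G d(1) finite_atLeastAtMost d(2)])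
        show "q \<notin> ?c ` ?A \<times> conj_classes G" using that cA by (cases q) blast
      qed
      moreover have "(\<Sum>K\<in>conj_classes G. \<Sum>\<^sub># (cycle_type G ?A ?c a \<pi> (j, K))) = \<alpha> ! j"
        if "j < length \<alpha>" for j
        using sum_cycle_type[OF G fin d(1) _ d(2), of ?c j] d(3) fiber[OF that] by simp
      moreover have "0 \<notin># cycle_type G ?A ?c a \<pi> q" for q
        by (rule zero_notin_cycle_type[OF d(1) finite_atLeastAtMost])
      ultimately show "type x \<in> cycle_types \<alpha> (conj_classes G)"
        by (simp add: type_def x(1) cycle_types_def del: atLeastAtMost_iff split_paired_All)
    qed
    show "cycle_types \<alpha> (conj_classes G) \<subseteq> type ` carrier ?W"
    proof
      fix T assume T: "T \<in> cycle_types \<alpha> (conj_classes G)"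
      then have T0: "\<And>q. 0 \<notin># T q"
        and Tsupp: "\<And>q. q \<notin> {..<length \<alpha>} \<times> conj_classes G \<Longrightarrow> T q = {#}"
        and Tsum: "\<And>j. j < length \<alpha> \<Longrightarrow> (\<Sum>K\<in>conj_classes G. \<Sum>\<^sub># (T (j, K))) = \<alpha> ! j"
        unfolding cycle_types_def by blast+
      obtain \<pi> a where \<pi>: "\<pi> permutes ?A" and a: "a \<in> ?A \<rightarrow> carrier G"
        and c: "\<forall>i\<in>?A. ?c (\<pi> i) = ?c i" and type: "cycle_type G ?A ?c a \<pi> = T"
      proof (rule cycle_type_realization[OF G fin, of ?A "{..<length \<alpha>}" ?c T])
        show "?c ` ?A \<subseteq> {..<length \<alpha>}" by (rule cA)
        show "0 \<notin># T q" for q by (rule T0)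
        show "T q = {#}" if "q \<notin> {..<length \<alpha>} \<times> conj_classes G" for q
          using that by (rule Tsupp)
        show "(\<Sum>K\<in>conj_classes G. \<Sum>\<^sub># (T (j, K))) = card {i \<in> ?A. ?c i = j}"
          if "j \<in> {..<length \<alpha>}" for j
          using Tsum[of j] that fiber[of j] by simp
      qed simp_all
      \<comment> \<open>Elements of the wreath product have extensional first components, so the
        realising function is restricted. The identity with trivial gauge shows that this leaves the
        cycle type unchanged.\<close>
      define a' where "a' = restrict a ?A"
      have a': "a' \<in> ?A \<rightarrow>\<^sub>E carrier G" using a by (auto simp: a'_def)
      have mem: "(a', \<pi>) \<in> carrier ?W"
        using \<pi> c a' by (simp add: wreath_carrier young_subgroup_iff)
      have "cycle_iso G ?A ?c a \<pi> ?A ?c a' \<pi> id (\<lambda>_. \<one>\<^bsub>G\<^esub>)"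
        unfolding cycle_iso_def
      proof (intro conjI ballI)
        fix i assume i: "i \<in> ?A"
        then have "\<pi> i \<in> ?A" using \<pi> by (simp only: permutes_in_image)
        moreover from this have "a (\<pi> i) \<in> carrier G" using a by blast
        ultimately show "\<one>\<^bsub>G\<^esub> \<otimes>\<^bsub>G\<^esub> a (\<pi> i) = a' (\<pi> (id i)) \<otimes>\<^bsub>G\<^esub> \<one>\<^bsub>G\<^esub>"
          by (simp add: a'_def del: atLeastAtMost_iff)
      qed simp_all
      then have "cycle_type G ?A ?c a \<pi> = cycle_type G ?A ?c a' \<pi>"
        using cycle_iso_imp_cycle_type_eq[OF G \<pi> _ a \<pi> _ dest(2)[OF mem]] by blast
      then have "type (a', \<pi>) = T" using type by (simp add: type_def)
      then show "T \<in> type ` carrier ?W" using mem by blast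
    qed
  qed
  moreover have "card (conj_class ?W ` carrier ?W) = card (type ` carrier ?W)"
  proof (rule card_image_eq_of_same_kernel)
    fix x y assume "x \<in> carrier ?W" "y \<in> carrier ?W"
    then show "conj_class ?W x = conj_class ?W y \<longleftrightarrow> type x = type y"
      using conj_class_wreath_eq_iff[OF G] by (cases x; cases y) (simp add: type_def)
  qed
  ultimately show ?thesis
    by (simp add: conj_classes_def[of ?W] card_cycle_types[OF finK] card_multiset_families)
qed

text \<open>Serves to remove the constructor \<open>Node\<close> from the iterated wreath
  product.\<close>

lemma card_conj_classes_iso:
  assumes G: "group G" and H: "group H" and \<phi>: "\<phi> \<in> iso G H"
  shows "card (conj_classes H) = card (conj_classes G)"
proof -
  have bij: "bij_betw \<phi> (carrier G) (carrier H)" and hom: "\<phi> \<in> hom G H"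
    using \<phi> by (auto simp: iso_def)
  have mem: "\<phi> x \<in> carrier H" if "x \<in> carrier G" for x by (rule hom_in_carrier[OF hom that])
  have "card ((\<lambda>x. conj_class H (\<phi> x)) ` carrier G) = card (conj_class G ` carrier G)"
  proof (rule card_image_eq_of_same_kernel)
    fix x y assume xy: "x \<in> carrier G" "y \<in> carrier G"
    have "\<phi> g \<otimes>\<^bsub>H\<^esub> \<phi> x = \<phi> y \<otimes>\<^bsub>H\<^esub> \<phi> g \<longleftrightarrow> g \<otimes>\<^bsub>G\<^esub> x = y \<otimes>\<^bsub>G\<^esub> g"
      if g: "g \<in> carrier G" for g
    proof -
      have "g \<otimes>\<^bsub>G\<^esub> x \<in> carrier G" "y \<otimes>\<^bsub>G\<^esub> g \<in> carrier G"
        using g xy G by (simp_all add: group.is_monoid monoid.m_closed)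
      then show ?thesis
        using inj_on_eq_iff[OF bij_betw_imp_inj_on[OF bij]] g xy by (simp flip: hom_mult[OF hom])
    qed
    moreover have "(\<exists>k\<in>carrier H. k \<otimes>\<^bsub>H\<^esub> \<phi> x = \<phi> y \<otimes>\<^bsub>H\<^esub> k) \<longleftrightarrow>
        (\<exists>g\<in>carrier G. \<phi> g \<otimes>\<^bsub>H\<^esub> \<phi> x = \<phi> y \<otimes>\<^bsub>H\<^esub> \<phi> g)"
      unfolding bij_betw_imp_surj_on[OF bij, symmetric] by simp
    ultimately show "conj_class H (\<phi> x) = conj_class H (\<phi> y) \<longleftrightarrow> conj_class G x = conj_class G y"
      using conj_class_eq_iff[OF G xy] conj_class_eq_iff[OF H mem[OF xy(1)] mem[OF xy(2)]] by simp
  qed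
  then show ?thesis
    by (simp add: conj_classes_def image_image flip: bij_betw_imp_surj_on[OF bij])
qed

section \<open>Back to representations, and the recursion\<close>

lemma finite_wreath:
  assumes "finite (carrier G)" "subgroup H (sym_group n)"
  shows "finite (carrier (wreath G n H))"
proof -
  have "H \<subseteq> {p. p permutes {1..n}}" using subgroup.subset[OF assms(2)] by (simp add: sym_group_def)
  then have "finite H" by (rule finite_subset) (simp add: finite_permutations)
  then show ?thesis using assms(1) by (simp add: wreath_carrier finite_PiE)
qed

lemma finite_iter_wreath: "finite (carrier (iter_wreath r k))"
proof (induction k)
  case (Suc k)
  then have "finite (carrier (wreath (iter_wreath r k) (r (Suc k)) (carrier (sym_group (r (Suc k))))))"
    by (intro finite_wreath group.subgroup_self sym_group_is_group)
  then show ?case by (simp add: image_group_def)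
qed (simp add: singleton_group_def)

lemma carrier_sym_group_eq_young_subgroup: "carrier (sym_group m) = young_subgroup [m]"
  using permutes_image[of _ "{1..m}"]
  by (auto simp: young_subgroup_def sym_group_def block_def atLeastSucAtMost_greaterThanAtMost[symmetric])

lemma num_irreps_wreath_young_subgroup:
  assumes G: "group G" and fin: "finite (carrier G)"
  shows "num_irreps (wreath G (sum_list \<alpha>) (young_subgroup \<alpha>)) =
    (\<Prod>j<length \<alpha>. \<Sum>\<beta>\<in>weak_compositions (num_irreps G) (\<alpha> ! j). \<Prod>i<num_irreps G. num_partitions (\<beta> ! i))"
  unfolding num_irreps_eq_card_conj_classes[OF G fin]
    num_irreps_eq_card_conj_classes[OF wreath_is_group[OF G young_subgroup_subgroup]
      finite_wreath[OF fin young_subgroup_subgroup]]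
  by (rule card_conj_classes_wreath[OF G fin])

lemma num_irreps_iter_Suc:
  "num_irreps_iter r (Suc k) = multi_partitions (r (Suc k)) (num_irreps_iter r k)"
proof -
  let ?G = "iter_wreath r k" and ?m = "r (Suc k)"
  let ?W = "wreath ?G ?m (carrier (sym_group ?m))"
  have sub: "subgroup (carrier (sym_group ?m)) (sym_group ?m)"
    by (rule group.subgroup_self[OF sym_group_is_group])
  have W: "group ?W" "finite (carrier ?W)"
    by (rule wreath_is_group[OF iter_wreath_is_group sub])
      (rule finite_wreath[OF finite_iter_wreath sub])
  have "num_irreps_iter r (Suc k) = card (conj_classes (iter_wreath r (Suc k)))"
    by (rule num_irreps_eq_card_conj_classes[OF iter_wreath_is_group finite_iter_wreath])
  \<comment> \<open>Isomorphism invariance is available for class numbers, so the count of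
    representations is translated to classes and back.\<close>
  also have "\<dots> = card (conj_classes ?W)"
    by (rule card_conj_classes_iso[OF W(1) iter_wreath_is_group iter_wreath_Suc_iso])
  also have "\<dots> = num_irreps ?W"
    by (rule num_irreps_eq_card_conj_classes[OF W, symmetric])
  also have "\<dots> = num_irreps (wreath ?G (sum_list [?m]) (young_subgroup [?m]))"
    by (simp add: carrier_sym_group_eq_young_subgroup)
  also have "\<dots> = multi_partitions ?m (num_irreps ?G)"
    unfolding num_irreps_wreath_young_subgroup[OF iter_wreath_is_group finite_iter_wreath]
    by (simp add: multi_partitions_def)
  finally show ?thesis .
qed

theorem corollary2:
  fixes G :: "('a, 'b) monoid_scheme" and h n k :: nat and \<alpha> :: "nat list" and r :: "nat \<Rightarrow> nat"
  shows
    "(group G \<and> finite (carrier G) \<and> num_irreps G = h \<and> 0 < n \<and> is_partition \<alpha> n \<longrightarrow>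
       num_irreps (wreath G n (young_subgroup \<alpha>)) =
         (\<Prod>j<length \<alpha>. \<Sum>\<beta>\<in>weak_compositions h (\<alpha> ! j). \<Prod>i<h. num_partitions (\<beta> ! i))) \<and>
     ((\<forall>i\<ge>1. 0 < r i) \<and> 1 \<le> k \<longrightarrow>
       num_irreps_iter r k = multi_partitions (r k) (num_irreps_iter r (k - 1)) \<and>
       multi_partitions (r k) (num_irreps_iter r (k - 1)) =
         (let h' = num_irreps_iter r (k - 1) in
            \<Sum>\<alpha>'\<in>weak_compositions h' (r k). \<Prod>i<h'. num_partitions (\<alpha>' ! i)))"
proof (intro conjI impI)
  assume "group G \<and> finite (carrier G) \<and> num_irreps G = h \<and> 0 < n \<and> is_partition \<alpha> n"
  then show "num_irreps (wreath G n (young_subgroup \<alpha>)) =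
      (\<Prod>j<length \<alpha>. \<Sum>\<beta>\<in>weak_compositions h (\<alpha> ! j). \<Prod>i<h. num_partitions (\<beta> ! i))"
    using num_irreps_wreath_young_subgroup[of G \<alpha>] by (auto simp: is_partition_def)
next
  assume "(\<forall>i\<ge>1. 0 < r i) \<and> 1 \<le> k"
  then show "num_irreps_iter r k = multi_partitions (r k) (num_irreps_iter r (k - 1))"
    using num_irreps_iter_Suc[of r "k - 1"] by simp
  show "multi_partitions (r k) (num_irreps_iter r (k - 1)) =
      (let h' = num_irreps_iter r (k - 1) in
        \<Sum>\<alpha>'\<in>weak_compositions h' (r k). \<Prod>i<h'. num_partitions (\<alpha>' ! i))"
    by (simp add: multi_partitions_def Let_def)
qed

end
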